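(* Let $2<p<\infty$. There do not exist a function $g\in L^p(\mathbb R)$ and a countable set $\Lambda\subset\mathbb R\times\mathbb R$ such that the Gabor system $\mathcal G(g;\Lambda)$ forms an unconditional basis of $L^p(\mathbb R)$.
   Context: For $t,s\in\mathbb R$ write $(\tau_t g)(x)=g(x-t)$ and $e_s(x)=e^{2\pi i s x}$. For a function $g$ on $\mathbb R$ and a countable set $\Lambda\subset\mathbb R\times\mathbb R$, the Gabor system is $\mathcal G(g;\Lambda)=\{e_s\tau_t g:(t,s)\in\Lambda\}$, i.e. the functions $x\mapsto g(x-t)e^{2\pi i s x}$, indexed by $\Lambda$. A system $\{u_n\}$ in a Banach space $X$ is an unconditional basis of $X$ if every $x\in X$ has a unique expansion $x=\sum_n c_nu_n$ and this series converges unconditionally. *)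

theory Defs
  imports "HOL-Analysis.Analysis"
begin

definition transl :: "real \<Rightarrow> (real \<Rightarrow> complex) \<Rightarrow> real \<Rightarrow> complex" where
  "transl t g = (\<lambda>x. g (x - t))"

definition modul_char :: "real \<Rightarrow> real \<Rightarrow> complex" where
  "modul_char s = (\<lambda>x. exp (2 * pi * \<i> * complex_of_real (s * x)))"

definition gabor :: "(real \<Rightarrow> complex) \<Rightarrow> real \<times> real \<Rightarrow> real \<Rightarrow> complex" where
  "gabor g = (\<lambda>(t, s). (\<lambda>x. modul_char s x * transl t g x))"

definition in_Lp :: "real \<Rightarrow> (real \<Rightarrow> complex) \<Rightarrow> bool" where
  "in_Lp p f \<longleftrightarrow> f \<in> borel_measurable lborel \<and> integrable lborel (\<lambda>x. cmod (f x) powr p)"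

definition Lp_norm :: "real \<Rightarrow> (real \<Rightarrow> complex) \<Rightarrow> real" where
  "Lp_norm p f = (\<integral>x. cmod (f x) powr p \<partial>lborel) powr (1 / p)"

definition Lp_uncond_sums ::
  "real \<Rightarrow> ('i \<Rightarrow> real \<Rightarrow> complex) \<Rightarrow> 'i set \<Rightarrow> ('i \<Rightarrow> complex) \<Rightarrow> (real \<Rightarrow> complex) \<Rightarrow> bool" where
  "Lp_uncond_sums p u I c f \<longleftrightarrow>
     (\<forall>\<epsilon>>0. \<exists>F0. finite F0 \<and> F0 \<subseteq> I \<and>
        (\<forall>F. finite F \<and> F0 \<subseteq> F \<and> F \<subseteq> I \<longrightarrow>
           Lp_norm p (\<lambda>x. f x - (\<Sum>i\<in>F. c i * u i x)) < \<epsilon>))"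

definition Lp_unconditional_basis :: "real \<Rightarrow> ('i \<Rightarrow> real \<Rightarrow> complex) \<Rightarrow> 'i set \<Rightarrow> bool" where
  "Lp_unconditional_basis p u I \<longleftrightarrow>
     (\<forall>i\<in>I. in_Lp p (u i)) \<and>
     (\<forall>f. in_Lp p f \<longrightarrow>
        (\<exists>c. Lp_uncond_sums p u I c f \<and>
             (\<forall>c'. Lp_uncond_sums p u I c' f \<longrightarrow> (\<forall>i\<in>I. c' i = c i))))"

end

theory Submission
  imports Defs "HOL-Library.Diagonal_Subsequence"
begin

text \<open>
  Let \<open>u\<^sub>\<lambda>\<close>, \<open>\<lambda> = (t, s)\<close>, be the basis and let \<open>r = p / 2 > 1\<close>. Averaging over signs, the norm of
  \<open>f = \<Sum> c\<^sub>\<lambda> u\<^sub>\<lambda>\<close> is comparable to that of the square function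
  \<open>(\<Sum> |c\<^sub>\<lambda>|\<^sup>2 |g (x - t)|\<^sup>2)\<close> in \<open>L\<^sup>r\<close>, raised to the power \<open>1/2\<close>. Group the indices into blocks
  \<open>kR \<le> t < (k + 1)R\<close> and let \<open>a\<^sub>k\<close> be the sum of \<open>|c\<^sub>\<lambda>|\<^sup>2\<close> over the \<open>k\<close>-th block. Since
  most of \<open>|g|\<close> lies in \<open>[-R, R]\<close>, Jensen's inequality gives \<open>\<Sum> a\<^sub>k\<^sup>r \<le> C \<parallel>f\<parallel>\<^sup>p\<close>. Conversely, replacing each
  \<open>u\<^sub>\<lambda>\<close> by its restriction to \<open>[t - R, t + R]\<close> is an operator whose diagonal is close to the identity,
  and by unconditionality the diagonal is controlled by averages of the operator conjugated with signs;
  the restrictions of different blocks have bounded overlap, whence \<open>\<parallel>f\<parallel>\<^sup>p \<le> C \<Sum> a\<^sub>k\<^sup>r\<close>. So \<open>L\<^sup>p\<close>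
  would be isomorphic to \<open>\<ell>\<^sup>p(\<ell>\<^sup>2)\<close>. Applied to signed families of dyadic indicators, this yields positive
  additive set functions with values in \<open>\<ell>\<^sup>r\<close>, which a gliding hump argument shows to be impossible.
\<close>

section \<open>Lebesgue spaces on the line\<close>

text \<open>Only sign averages are compared: under them block energies become additive, and a family
  of functions is seen only through the sum of its squared moduli. The definition of a basis
  contains no bound on coefficients, so the constant \<open>K\<close> behind every estimate comes
  from a Baire argument. The obstacle at the end is that the energy vectors of finer and finer
  dyadic levels may drift away along the coordinates, so that single levels have no common tail
  bound. But all levels have the same square function, so levels can be superposed: with N of them
  the sum of squares on the line is multiplied by N, hence the integral by \<open>N^r\<close>,
  whereas the drifting parts are disjoint and contribute only a multiple of N to the sum of r-th
  powers. This is where r > 1, that is p > 2, decides. The order of choices is a finite set of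
  coordinates, then the fineness n of the partition, then the levels, all at least n.\<close>

lemma convex_on_powr:
  fixes p :: real
  assumes "1 \<le> p"
  shows "convex_on {0..} (\<lambda>x. x powr p)"
proof (rule convex_onI)
  fix t x y :: real
  assume t: "0 < t" "t < 1" and xy: "x \<in> {0..}" "y \<in> {0..}"
  \<comment> \<open>If one of the two points is 0, convexity reduces to
    \<open>s powr p \<le> s\<close> on the unit interval.\<close>
  have scale: "(s * z) powr p \<le> s * z powr p" if "0 < s" "s < 1" "0 \<le> z" for s z :: real
  proof -
    have "s powr p \<le> s powr 1"
      using that assms by (intro powr_mono') auto
    then show ?thesis
      using that by (simp add: powr_mult mult_right_mono)
  qed
  show "((1 - t) *\<^sub>R x + t *\<^sub>R y) powr p \<le> (1 - t) * x powr p + t * y powr p"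
  proof (cases "x = 0 \<or> y = 0")
    case True
    then show ?thesis
      using scale[of t y] scale[of "1 - t" x] t xy assms by auto
  next
    case False
    then show ?thesis
      using convex_onD[OF powr_convex[OF assms], of t x y] t xy by auto
  qed
qed auto

text \<open>Jensen's inequality for weights that are not normalised: dividing by the total weight W
  and multiplying back leaves the factor \<open>W powr (p - 1)\<close>.\<close>

lemma powr_sum_le:
  fixes w x :: "'i \<Rightarrow> real"
  assumes "1 \<le> p" "finite I" "\<And>i. i \<in> I \<Longrightarrow> 0 \<le> w i" "\<And>i. i \<in> I \<Longrightarrow> 0 \<le> x i"
  shows "(\<Sum>i\<in>I. w i * x i) powr p \<le> (\<Sum>i\<in>I. w i) powr (p - 1) * (\<Sum>i\<in>I. w i * x i powr p)"
proof (cases "(\<Sum>i\<in>I. w i) = 0")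
  case True
  then have "\<forall>i\<in>I. w i = 0"
    using assms by (simp add: sum_nonneg_eq_0_iff)
  then show ?thesis using assms by simp
next
  case False
  define W where "W = (\<Sum>i\<in>I. w i)"
  have W: "W > 0"
    using False assms by (simp add: W_def sum_nonneg order_less_le)
  have "(\<Sum>i\<in>I. (w i / W) *\<^sub>R x i) powr p \<le> (\<Sum>i\<in>I. (w i / W) * x i powr p)"
  proof (rule convex_on_sum[OF _ _ convex_on_powr])
    show "(\<Sum>i\<in>I. w i / W) = 1"
      using False by (simp add: W_def flip: sum_divide_distrib)
  qed (use assms W False W_def in auto)
  then have "((\<Sum>i\<in>I. w i * x i) / W) powr p \<le> (\<Sum>i\<in>I. w i * x i powr p) / W"
    by (simp add: sum_divide_distrib)
  then have "(\<Sum>i\<in>I. w i * x i) powr p / W powr p \<le> (\<Sum>i\<in>I. w i * x i powr p) / W"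
    using W assms by (simp add: powr_divide sum_nonneg)
  then have "(\<Sum>i\<in>I. w i * x i) powr p \<le> W powr p * ((\<Sum>i\<in>I. w i * x i powr p) / W)"
    using W by (simp add: divide_le_eq mult.commute)
  also have "\<dots> = W powr (p - 1) * (\<Sum>i\<in>I. w i * x i powr p)"
    using W by (simp add: powr_diff)
  finally show ?thesis by (simp add: W_def)
qed

lemma powr_add_le:
  fixes a b :: real
  assumes "1 \<le> p" "0 \<le> a" "0 \<le> b"
  shows "(a + b) powr p \<le> 2 powr p * (a powr p + b powr p)"
proof -
  have "(a + b) powr p \<le> (2 * max a b) powr p"
    using assms by (intro powr_mono2) auto
  also have "\<dots> = 2 powr p * max a b powr p"
    using assms by (simp add: powr_mult)
  also have "\<dots> \<le> 2 powr p * (a powr p + b powr p)"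
    by (intro mult_left_mono) (auto simp: max_def)
  finally show ?thesis .
qed

text \<open>Superadditivity of the power: in \<open>a i * a i powr (p - 1)\<close> the second factor
  can only grow when \<open>a i\<close> is replaced by the whole sum. It merges separate blocks into
  one square function.\<close>

lemma sum_powr_le_powr_sum:
  fixes a :: "'i \<Rightarrow> real"
  assumes "1 \<le> p" "finite I" "\<And>i. i \<in> I \<Longrightarrow> 0 \<le> a i"
  shows "(\<Sum>i\<in>I. a i powr p) \<le> (\<Sum>i\<in>I. a i) powr p"
proof -
  define A where "A = (\<Sum>i\<in>I. a i)"
  have A: "0 \<le> A" by (simp add: A_def sum_nonneg assms)
  have "(\<Sum>i\<in>I. a i powr p) \<le> (\<Sum>i\<in>I. a i * A powr (p - 1))"
  proof (rule sum_mono)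
    fix i assume i: "i \<in> I"
    have "a i \<le> A" unfolding A_def using assms i by (intro member_le_sum) auto
    then have "a i * a i powr (p - 1) \<le> a i * A powr (p - 1)"
      using assms i by (intro mult_left_mono powr_mono2) auto
    moreover have "a i powr p = a i * a i powr (p - 1)"
      using assms(3)[OF i] by (cases "a i = 0") (auto simp: powr_diff)
    ultimately show "a i powr p \<le> a i * A powr (p - 1)" by simp
  qed
  also have "\<dots> = A * A powr (p - 1)" by (simp add: A_def sum_distrib_right)
  also have "\<dots> = A powr p"
    using A by (cases "A = 0") (auto simp: powr_diff)
  finally show ?thesis by (simp add: A_def)
qed

lemma powr_sum_le_card:
  fixes a :: "'i \<Rightarrow> real"
  assumes "1 \<le> p" "finite I" "\<And>i. i \<in> I \<Longrightarrow> 0 \<le> a i" "card I \<le> n"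
  shows "(\<Sum>i\<in>I. a i) powr p \<le> real n powr (p - 1) * (\<Sum>i\<in>I. a i powr p)"
proof -
  have "(\<Sum>i\<in>I. a i) powr p \<le> real (card I) powr (p - 1) * (\<Sum>i\<in>I. a i powr p)"
    using powr_sum_le[OF assms(1,2), of "\<lambda>_. 1" a] assms by simp
  also have "\<dots> \<le> real n powr (p - 1) * (\<Sum>i\<in>I. a i powr p)"
    using assms by (intro mult_right_mono powr_mono2 sum_nonneg) auto
  finally show ?thesis .
qed

locale Lp_exponent =
  fixes p :: real
  assumes p_ge_1: "1 \<le> p"
begin

lemma in_Lp_measurable: "in_Lp p f \<Longrightarrow> f \<in> borel_measurable borel"
  by (simp add: in_Lp_def)

lemma in_Lp_mono:
  assumes "in_Lp p f" "h \<in> borel_measurable borel" "\<And>x. cmod (h x) \<le> C * cmod (f x)"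
  shows "in_Lp p h"
proof -
  note [measurable] = in_Lp_measurable[OF assms(1)] assms(2)
  have "integrable lborel (\<lambda>x. \<bar>C\<bar> powr p * cmod (f x) powr p)"
    using assms(1) by (simp add: in_Lp_def)
  then have "integrable lborel (\<lambda>x. cmod (h x) powr p)"
  proof (rule Bochner_Integration.integrable_bound)
    show "AE x in lborel. norm (cmod (h x) powr p) \<le> norm (\<bar>C\<bar> powr p * cmod (f x) powr p)"
    proof (rule AE_I2)
      fix x
      have "cmod (h x) \<le> \<bar>C\<bar> * cmod (f x)"
        using assms(3)[of x] by (smt (verit) mult_right_mono norm_ge_zero)
      then show "norm (cmod (h x) powr p) \<le> norm (\<bar>C\<bar> powr p * cmod (f x) powr p)"
        using p_ge_1 by (simp flip: powr_mult add: powr_mono2)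
    qed
  qed measurable
  then show ?thesis using assms by (simp add: in_Lp_def)
qed

lemma in_Lp_0 [simp]: "in_Lp p (\<lambda>x. 0)"
  using p_ge_1 by (simp add: in_Lp_def)

lemma in_Lp_cmult: "in_Lp p f \<Longrightarrow> in_Lp p (\<lambda>x. a * f x)"
  by (rule in_Lp_mono[where f=f and C="cmod a"]) (auto simp: in_Lp_def norm_mult)

lemma in_Lp_minus: "in_Lp p f \<Longrightarrow> in_Lp p (\<lambda>x. - f x)"
  using in_Lp_cmult[of f "-1"] by simp

lemma in_Lp_add:
  assumes "in_Lp p f" "in_Lp p h"
  shows "in_Lp p (\<lambda>x. f x + h x)"
proof -
  note [measurable] = in_Lp_measurable[OF assms(1)] in_Lp_measurable[OF assms(2)]
  have "integrable lborel (\<lambda>x. 2 powr p * (cmod (f x) powr p + cmod (h x) powr p))"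
    using assms by (simp add: in_Lp_def)
  then have "integrable lborel (\<lambda>x. cmod (f x + h x) powr p)"
  proof (rule Bochner_Integration.integrable_bound)
    show "AE x in lborel. norm (cmod (f x + h x) powr p)
      \<le> norm (2 powr p * (cmod (f x) powr p + cmod (h x) powr p))"
    proof (rule AE_I2)
      fix x
      have "cmod (f x + h x) powr p \<le> (cmod (f x) + cmod (h x)) powr p"
        using p_ge_1 by (intro powr_mono2 norm_triangle_ineq) auto
      also have "\<dots> \<le> 2 powr p * (cmod (f x) powr p + cmod (h x) powr p)"
        by (rule powr_add_le[OF p_ge_1]) auto
      finally show "norm (cmod (f x + h x) powr p)
        \<le> norm (2 powr p * (cmod (f x) powr p + cmod (h x) powr p))"
        by simp
    qed
  qed measurable
  then show ?thesis by (simp add: in_Lp_def)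
qed

lemma in_Lp_diff: "in_Lp p f \<Longrightarrow> in_Lp p h \<Longrightarrow> in_Lp p (\<lambda>x. f x - h x)"
  using in_Lp_add[of f "\<lambda>x. - h x"] in_Lp_minus[of h] by simp

lemma in_Lp_sum: "(\<And>i. i \<in> I \<Longrightarrow> in_Lp p (f i)) \<Longrightarrow> in_Lp p (\<lambda>x. \<Sum>i\<in>I. f i x)"
  by (induction I rule: infinite_finite_induct) (auto intro: in_Lp_add)

lemma in_Lp_bounded_on_interval:
  assumes "f \<in> borel_measurable borel" "\<And>x. cmod (f x) \<le> C * indicator {a..b} x"
  shows "in_Lp p f"
proof (rule in_Lp_mono[where C=C])
  have "integrable lborel (\<lambda>x. indicator {a..b} x :: real)"
    by (rule integrable_real_indicator) (auto simp: emeasure_lborel_Icc_eq)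
  moreover have "cmod (indicator {a..b} x :: complex) powr p = indicator {a..b} x" for x
    using p_ge_1 by (simp add: indicator_def)
  ultimately show "in_Lp p (\<lambda>x. indicator {a..b} x)" by (simp add: in_Lp_def)
  show "cmod (f x) \<le> C * cmod (indicator {a..b} x)" for x
    using assms(2)[of x] by (cases "x \<in> {a..b}") auto
qed (use assms in auto)

lemma Lp_norm_nonneg [simp]: "0 \<le> Lp_norm p f"
  by (simp add: Lp_norm_def)

lemma Lp_norm_powr: "Lp_norm p f powr p = (\<integral>x. cmod (f x) powr p \<partial>lborel)"
  using p_ge_1 by (simp add: Lp_norm_def powr_powr)

lemma Lp_norm_le_iff:
  assumes "0 \<le> C"
  shows "Lp_norm p f \<le> C \<longleftrightarrow> (\<integral>x. cmod (f x) powr p \<partial>lborel) \<le> C powr p"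
  using p_ge_1 assms unfolding Lp_norm_powr[symmetric]
  by (metis Lp_norm_nonneg less_le_not_le linorder_not_less order_less_le_trans powr_less_mono2
      powr_mono2 zero_less_one nle_le)

lemma Lp_norm_0 [simp]: "Lp_norm p (\<lambda>x. 0) = 0"
  using p_ge_1 by (simp add: Lp_norm_def)

lemma Lp_norm_cmult: "Lp_norm p (\<lambda>x. a * f x) = cmod a * Lp_norm p f"
proof -
  have "Lp_norm p (\<lambda>x. a * f x) = (cmod a powr p * (\<integral>x. cmod (f x) powr p \<partial>lborel)) powr (1 / p)"
    using p_ge_1 by (simp add: Lp_norm_def norm_mult powr_mult)
  also have "\<dots> = cmod a * Lp_norm p f"
    using p_ge_1 by (simp add: powr_mult powr_powr Lp_norm_def)
  finally show ?thesis .
qed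

lemma Lp_norm_minus: "Lp_norm p (\<lambda>x. - f x) = Lp_norm p f"
  by (simp add: Lp_norm_def)

lemma Lp_norm_minus_commute: "Lp_norm p (\<lambda>x. f x - h x) = Lp_norm p (\<lambda>x. h x - f x)"
  by (simp add: Lp_norm_def norm_minus_commute)

text \<open>Minkowski's inequality by convexity: \<open>(f + h) / (A + B)\<close> is the convex
  combination of \<open>f / A\<close> and \<open>h / B\<close> with weights
  \<open>A / (A + B)\<close> and \<open>B / (A + B)\<close>. Positive upper bounds instead of the
  norms themselves avoid a division by zero.\<close>

lemma Lp_norm_triangle_scaled:
  assumes f: "in_Lp p f" "Lp_norm p f \<le> A" and h: "in_Lp p h" "Lp_norm p h \<le> B"
    and pos: "0 < A" "0 < B"
  shows "Lp_norm p (\<lambda>x. f x + h x) \<le> A + B"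
proof -
  have pw: "cmod (f x + h x) powr p \<le> (A + B) powr p *
      (A / (A + B) * (cmod (f x) powr p / A powr p) + B / (A + B) * (cmod (h x) powr p / B powr p))" for x
  proof -
    define s where "s = B / (A + B)"
    have s: "0 \<le> s" "s \<le> 1" "1 - s = A / (A + B)"
      using pos by (auto simp: s_def field_simps)
    have "cmod (f x + h x) \<le> (A + B) * ((1 - s) * (cmod (f x) / A) + s * (cmod (h x) / B))"
    proof -
      have "(A + B) * ((1 - s) * (cmod (f x) / A) + s * (cmod (h x) / B)) = cmod (f x) + cmod (h x)"
        unfolding s(3) unfolding s_def distrib_left using pos by simp
      then show ?thesis using norm_triangle_ineq[of "f x" "h x"] by simp
    qed
    then have "cmod (f x + h x) powr p \<le> ((A + B) * ((1 - s) * (cmod (f x) / A) + s * (cmod (h x) / B))) powr p"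
      using p_ge_1 by (intro powr_mono2) auto
    also have "\<dots> = (A + B) powr p * ((1 - s) * (cmod (f x) / A) + s * (cmod (h x) / B)) powr p"
      using pos s by (intro powr_mult)
    also have "\<dots> \<le> (A + B) powr p * ((1 - s) * (cmod (f x) / A) powr p + s * (cmod (h x) / B) powr p)"
      using convex_onD[OF convex_on_powr[OF p_ge_1], of s "cmod (f x) / A" "cmod (h x) / B"] s pos
      by (intro mult_left_mono) auto
    finally show ?thesis unfolding s(3) using pos by (simp add: s_def powr_divide)
  qed
  have int: "integrable lborel (\<lambda>x. cmod (f x) powr p)" "integrable lborel (\<lambda>x. cmod (h x) powr p)"
    "integrable lborel (\<lambda>x. cmod (f x + h x) powr p)"
    using f h in_Lp_add[OF f(1) h(1)] by (auto simp: in_Lp_def)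
  have le: "(\<integral>x. cmod (f x) powr p \<partial>lborel) \<le> A powr p" "(\<integral>x. cmod (h x) powr p \<partial>lborel) \<le> B powr p"
    using f h pos by (auto simp: Lp_norm_le_iff)
  have "(\<integral>x. cmod (f x + h x) powr p \<partial>lborel) \<le> (\<integral>x. (A + B) powr p *
      (A / (A + B) * (cmod (f x) powr p / A powr p) + B / (A + B) * (cmod (h x) powr p / B powr p)) \<partial>lborel)"
    by (intro integral_mono pw) (use int in auto)
  also have "\<dots> = (A + B) powr p * (A / (A + B) * ((\<integral>x. cmod (f x) powr p \<partial>lborel) / A powr p)
      + B / (A + B) * ((\<integral>x. cmod (h x) powr p \<partial>lborel) / B powr p))"
    using int by simp
  also have "\<dots> \<le> (A + B) powr p * (A / (A + B) * 1 + B / (A + B) * 1)"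
    using pos le by (intro mult_left_mono add_mono) auto
  also have "\<dots> = (A + B) powr p"
    using pos by (simp flip: add_divide_distrib)
  finally show ?thesis using pos by (simp add: Lp_norm_le_iff)
qed

lemma Lp_norm_triangle:
  assumes "in_Lp p f" "in_Lp p h"
  shows "Lp_norm p (\<lambda>x. f x + h x) \<le> Lp_norm p f + Lp_norm p h"
proof (rule field_le_epsilon)
  fix e :: real assume "0 < e"
  then show "Lp_norm p (\<lambda>x. f x + h x) \<le> Lp_norm p f + Lp_norm p h + e"
    using Lp_norm_triangle_scaled[OF assms(1) _ assms(2), of "Lp_norm p f + e / 2" "Lp_norm p h + e / 2"]
    by (simp add: add_nonneg_pos algebra_simps)
qed

lemma Lp_norm_triangle_diff:
  assumes "in_Lp p f" "in_Lp p h"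
  shows "Lp_norm p (\<lambda>x. f x - h x) \<le> Lp_norm p f + Lp_norm p h"
  using Lp_norm_triangle[OF assms(1) in_Lp_minus[OF assms(2)]] by (simp add: Lp_norm_minus)

lemma Lp_norm_le_diff:
  assumes "in_Lp p f" "in_Lp p h"
  shows "Lp_norm p f \<le> Lp_norm p (\<lambda>x. f x - h x) + Lp_norm p h"
  using Lp_norm_triangle[OF in_Lp_diff[OF assms] assms(2)] by simp

lemma Lp_norm_sum:
  "(\<And>i. i \<in> I \<Longrightarrow> in_Lp p (f i)) \<Longrightarrow> Lp_norm p (\<lambda>x. \<Sum>i\<in>I. f i x) \<le> (\<Sum>i\<in>I. Lp_norm p (f i))"
proof (induction I rule: infinite_finite_induct)
  case (insert i I)
  have "Lp_norm p (\<lambda>x. f i x + (\<Sum>i\<in>I. f i x)) \<le> Lp_norm p (f i) + Lp_norm p (\<lambda>x. \<Sum>i\<in>I. f i x)"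
    by (intro Lp_norm_triangle in_Lp_sum insert) auto
  then show ?case using insert by (fastforce intro: order_trans)
qed auto

lemma Lp_norm_cong_AE:
  assumes "in_Lp p f" "in_Lp p h" "AE x in lborel. f x = h x"
  shows "Lp_norm p f = Lp_norm p h"
  unfolding Lp_norm_def
  by (intro arg_cong[where f="\<lambda>z. z powr _"] integral_cong_AE) (use assms in \<open>auto simp: in_Lp_def\<close>)

section \<open>Limits and completeness\<close>

lemma Lp_Fatou:
  assumes F: "\<And>m. in_Lp p (F m)" "\<And>m. Lp_norm p (F m) \<le> C"
    and meas: "f \<in> borel_measurable borel"
    and lim: "AE x in lborel. (\<lambda>m. F m x) \<longlonglongrightarrow> f x"
  shows "in_Lp p f" "Lp_norm p f \<le> C"
proof -
  have C: "0 \<le> C" using F(2)[of 0] Lp_norm_nonneg order_trans by blast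
  have [measurable]: "F m \<in> borel_measurable borel" for m using F by (simp add: in_Lp_def)
  note [measurable] = meas
  have "(\<integral>\<^sup>+x. ennreal (cmod (f x) powr p) \<partial>lborel)
      = (\<integral>\<^sup>+x. liminf (\<lambda>m. ennreal (cmod (F m x) powr p)) \<partial>lborel)"
  proof (rule nn_integral_cong_AE, use lim in eventually_elim)
    fix x assume "(\<lambda>m. F m x) \<longlonglongrightarrow> f x"
    then have "(\<lambda>m. cmod (F m x) powr p) \<longlonglongrightarrow> cmod (f x) powr p"
      using p_ge_1 by (intro tendsto_powr2 tendsto_norm tendsto_const) auto
    then have "(\<lambda>m. ennreal (cmod (F m x) powr p)) \<longlonglongrightarrow> ennreal (cmod (f x) powr p)"
      by (intro tendsto_ennrealI)
    then show "ennreal (cmod (f x) powr p) = liminf (\<lambda>m. ennreal (cmod (F m x) powr p))"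
      by (rule lim_imp_Liminf[OF trivial_limit_sequentially, symmetric])
  qed
  also have "\<dots> \<le> liminf (\<lambda>m. \<integral>\<^sup>+x. ennreal (cmod (F m x) powr p) \<partial>lborel)"
    by (rule nn_integral_liminf) measurable
  also have "\<dots> \<le> liminf (\<lambda>m. ennreal (C powr p))"
  proof (rule Liminf_mono, rule always_eventually, rule allI)
    fix m
    have "(\<integral>\<^sup>+x. ennreal (cmod (F m x) powr p) \<partial>lborel) = ennreal (\<integral>x. cmod (F m x) powr p \<partial>lborel)"
      using F by (intro nn_integral_eq_integral) (auto simp: in_Lp_def)
    also have "\<dots> \<le> ennreal (C powr p)"
      using F(2)[of m] C by (intro ennreal_leI) (simp add: Lp_norm_le_iff)
    finally show "(\<integral>\<^sup>+x. ennreal (cmod (F m x) powr p) \<partial>lborel) \<le> ennreal (C powr p)" .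
  qed
  also have "\<dots> = ennreal (C powr p)" by (simp add: Liminf_const)
  finally have le: "(\<integral>\<^sup>+x. ennreal (cmod (f x) powr p) \<partial>lborel) \<le> ennreal (C powr p)" .
  have "integrable lborel (\<lambda>x. cmod (f x) powr p)"
    by (rule integrableI_bounded) (use le in \<open>auto intro: le_less_trans\<close>)
  then show "in_Lp p f" using meas by (simp add: in_Lp_def)
  have "ennreal (\<integral>x. cmod (f x) powr p \<partial>lborel) \<le> ennreal (C powr p)"
    using le \<open>integrable _ _\<close> by (simp add: nn_integral_eq_integral)
  then show "Lp_norm p f \<le> C"
    using C by (simp add: Lp_norm_le_iff)
qed

text \<open>Riesz-Fischer with an explicit remainder. It supplies the limit point of the nested
  balls in the Baire argument, where the remainder bound keeps the limit inside every ball.\<close>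

lemma Lp_complete:
  assumes g: "\<And>n. in_Lp p (g n)" and sm: "summable (\<lambda>n. Lp_norm p (g n))"
  obtains f where "in_Lp p f"
    "\<And>n. Lp_norm p (\<lambda>x. f x - (\<Sum>i<n. g i x)) \<le> (\<Sum>i. Lp_norm p (g (i + n)))"
proof -
  define t where "t n = (\<Sum>i. Lp_norm p (g (i + n)))" for n
  have [measurable]: "g n \<in> borel_measurable borel" for n using g by (simp add: in_Lp_def)
  \<comment> \<open>The partial sums of the moduli stay complex-valued so that the norm lemmas apply
    to them; monotone convergence then makes the series absolutely convergent almost
    everywhere.\<close>
  define H where "H n x = complex_of_real (\<Sum>i<n. cmod (g i x))" for n x
  have normH: "cmod (H n x) = (\<Sum>i<n. cmod (g i x))" for n x
    unfolding H_def norm_of_real by (simp add: sum_nonneg)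
  have HLp: "in_Lp p (H n)" and HN: "Lp_norm p (H n) \<le> t 0" for n
  proof -
    have gc: "in_Lp p (\<lambda>x. complex_of_real (cmod (g i x)))" for i
      by (rule in_Lp_mono[OF g[of i], where C=1]) auto
    show "in_Lp p (H n)" unfolding H_def of_real_sum by (intro in_Lp_sum gc)
    have "Lp_norm p (H n) \<le> (\<Sum>i<n. Lp_norm p (\<lambda>x. complex_of_real (cmod (g i x))))"
      unfolding H_def of_real_sum by (intro Lp_norm_sum gc)
    also have "\<dots> = (\<Sum>i<n. Lp_norm p (g i))" by (simp add: Lp_norm_def)
    also have "\<dots> \<le> t 0" unfolding t_def using sm by (auto intro: sum_le_suminf)
    finally show "Lp_norm p (H n) \<le> t 0" .
  qed
  have [measurable]: "H n \<in> borel_measurable borel" for n using HLp by (simp add: in_Lp_def)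
  have abs_conv: "AE x in lborel. summable (\<lambda>i. cmod (g i x))"
  proof -
    have "(\<integral>\<^sup>+x. (SUP n. ennreal (cmod (H n x) powr p)) \<partial>lborel)
        = (SUP n. \<integral>\<^sup>+x. ennreal (cmod (H n x) powr p) \<partial>lborel)"
    proof (rule nn_integral_monotone_convergence_SUP)
      show "incseq (\<lambda>n x. ennreal (cmod (H n x) powr p))"
        using p_ge_1 by (intro incseq_SucI le_funI ennreal_leI powr_mono2) (auto simp: normH sum_nonneg)
    qed measurable
    also have "\<dots> \<le> ennreal (t 0 powr p)"
    proof (rule SUP_least)
      fix n
      have "(\<integral>\<^sup>+x. ennreal (cmod (H n x) powr p) \<partial>lborel) = ennreal (\<integral>x. cmod (H n x) powr p \<partial>lborel)"
        using HLp by (intro nn_integral_eq_integral) (auto simp: in_Lp_def)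
      also have "\<dots> \<le> ennreal (t 0 powr p)"
        using HN[of n] Lp_norm_nonneg[of "H n"] by (intro ennreal_leI, subst Lp_norm_le_iff[symmetric]) linarith+
      finally show "(\<integral>\<^sup>+x. ennreal (cmod (H n x) powr p) \<partial>lborel) \<le> ennreal (t 0 powr p)" .
    qed
    finally have "(\<integral>\<^sup>+x. (SUP n. ennreal (cmod (H n x) powr p)) \<partial>lborel) < \<infinity>"
      by (simp add: le_less_trans)
    then have "AE x in lborel. (SUP n. ennreal (cmod (H n x) powr p)) \<noteq> \<infinity>"
      by (intro nn_integral_PInf_AE) auto
    then show ?thesis
    proof eventually_elim
      fix x assume fin: "(SUP n. ennreal (cmod (H n x) powr p)) \<noteq> \<infinity>"
      define B where "B = enn2real (SUP n. ennreal (cmod (H n x) powr p))"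
      have B: "(\<Sum>i<n. cmod (g i x)) \<le> B powr (1 / p)" for n
      proof -
        have "ennreal (cmod (H n x) powr p) \<le> (SUP n. ennreal (cmod (H n x) powr p))"
          by (rule SUP_upper) auto
        also have "\<dots> = ennreal B" unfolding B_def
          using fin by (intro ennreal_enn2real[symmetric]) (simp only: top.not_eq_extremum infinity_ennreal_def)
        finally have "cmod (H n x) powr p \<le> B" by (simp add: B_def)
        then have "(cmod (H n x) powr p) powr (1 / p) \<le> B powr (1 / p)"
          using p_ge_1 by (intro powr_mono2) auto
        then show ?thesis
          using p_ge_1 by (simp add: powr_powr normH sum_nonneg)
      qed
      show "summable (\<lambda>i. cmod (g i x))"
        by (rule bounded_imp_summable[where B="B powr (1 / p)"])
          (use B[of "Suc _"] in \<open>auto simp: lessThan_Suc_atMost\<close>)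
    qed
  qed
  define f where "f x = (\<Sum>i. g i x)" for x
  have [measurable]: "f \<in> borel_measurable borel" unfolding f_def by measurable
  \<comment> \<open>Fatou is applied to the finite sections of the tail, whose norms are all at most
    \<open>t n\<close>; n = 0 gives membership of \<open>f\<close>.\<close>
  have gn: "in_Lp p (\<lambda>x. f x - (\<Sum>i<n. g i x)) \<and> Lp_norm p (\<lambda>x. f x - (\<Sum>i<n. g i x)) \<le> t n" for n
  proof -
    have NF: "Lp_norm p (\<lambda>x. \<Sum>i<m. g (i + n) x) \<le> t n" for m
    proof -
      have "Lp_norm p (\<lambda>x. \<Sum>i<m. g (i + n) x) \<le> (\<Sum>i<m. Lp_norm p (g (i + n)))"
        by (intro Lp_norm_sum g)
      also have "\<dots> \<le> t n" unfolding t_def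
        using sm by (intro sum_le_suminf summable_ignore_initial_segment) auto
      finally show ?thesis .
    qed
    have "AE x in lborel. (\<lambda>m. \<Sum>i<m. g (i + n) x) \<longlonglongrightarrow> f x - (\<Sum>i<n. g i x)"
      using abs_conv
    proof eventually_elim
      fix x assume "summable (\<lambda>i. cmod (g i x))"
      then have "summable (\<lambda>i. g i x)" by (rule summable_norm_cancel)
      then have "(\<lambda>i. g (i + n) x) sums (f x - (\<Sum>i<n. g i x))"
        unfolding f_def by (intro sums_split_initial_segment summable_sums)
      then show "(\<lambda>m. \<Sum>i<m. g (i + n) x) \<longlonglongrightarrow> f x - (\<Sum>i<n. g i x)" by (simp add: sums_def)
    qed
    from Lp_Fatou[OF in_Lp_sum NF _ this] g show ?thesis by simp
  qed
  have "in_Lp p f" using gn[of 0] by simp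
  then show ?thesis using that gn unfolding t_def by blast
qed

end

section \<open>Random signs and the Khinchine inequalities\<close>

text \<open>A choice of signs is encoded by the set of indices with sign +1. The function is total
  and equals -1 at every other index.\<close>

definition rsign :: "'i set \<Rightarrow> 'i \<Rightarrow> real" where
  "rsign A i = (if i \<in> A then 1 else - 1)"

text \<open>Expectation over independent fair signs, as a finite sum over the subsets of
  \<open>F\<close> rather than over a probability space.\<close>

definition ravg :: "'i set \<Rightarrow> (('i \<Rightarrow> real) \<Rightarrow> real) \<Rightarrow> real" where
  "ravg F \<Phi> = (\<Sum>A\<in>Pow F. \<Phi> (rsign A)) / 2 ^ card F"

lemma abs_rsign [simp]: "\<bar>rsign A i\<bar> = 1"
  by (simp add: rsign_def)

lemma rsign_sq [simp]: "rsign A i * rsign A i = 1"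
  by (simp add: rsign_def)

lemma ravg_const [simp]: "finite F \<Longrightarrow> ravg F (\<lambda>s. c) = c"
  by (simp add: ravg_def card_Pow)

lemma ravg_add: "ravg F (\<lambda>s. \<Phi> s + \<Psi> s) = ravg F \<Phi> + ravg F \<Psi>"
  by (simp add: ravg_def sum.distrib add_divide_distrib)

lemma ravg_cmult: "ravg F (\<lambda>s. c * \<Phi> s) = c * ravg F \<Phi>"
  by (simp add: ravg_def sum_distrib_left)

lemma ravg_sum: "ravg F (\<lambda>s. \<Sum>i\<in>I. \<Phi> i s) = (\<Sum>i\<in>I. ravg F (\<Phi> i))"
  unfolding ravg_def by (subst sum.swap) (simp add: sum_divide_distrib)

lemma ravg_mono:
  "(\<And>A. A \<subseteq> F \<Longrightarrow> \<Phi> (rsign A) \<le> \<Psi> (rsign A)) \<Longrightarrow> ravg F \<Phi> \<le> ravg F \<Psi>"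
  unfolding ravg_def by (intro divide_right_mono sum_mono) auto

lemma ravg_cong:
  "(\<And>A. A \<subseteq> F \<Longrightarrow> \<Phi> (rsign A) = \<Psi> (rsign A)) \<Longrightarrow> ravg F \<Phi> = ravg F \<Psi>"
  unfolding ravg_def by (intro arg_cong2[where f="(/)"] sum.cong) auto

lemma ravg_nonneg: "(\<And>A. A \<subseteq> F \<Longrightarrow> 0 \<le> \<Phi> (rsign A)) \<Longrightarrow> 0 \<le> ravg F \<Phi>"
  unfolding ravg_def by (intro divide_nonneg_nonneg sum_nonneg) auto

lemma ravg_empty [simp]: "ravg {} \<Phi> = \<Phi> (rsign {})"
  by (simp add: ravg_def)

text \<open>Conditioning on the sign at \<open>a\<close>. A subset of \<open>F\<close> already gives
  \<open>a\<close> the sign -1, so only the value +1 needs an update.\<close>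

lemma ravg_insert:
  assumes "finite F" "a \<notin> F"
  shows "ravg (insert a F) \<Phi> = (ravg F \<Phi> + ravg F (\<lambda>s. \<Phi> (s(a := 1)))) / 2"
proof -
  have upd: "rsign (insert a A) = (rsign A)(a := 1)" for A
    by (auto simp: rsign_def fun_eq_iff)
  have "inj_on (insert a) (Pow F)"
    using assms by (auto intro!: inj_onI)
  then have "(\<Sum>A\<in>Pow (insert a F). \<Phi> (rsign A))
      = (\<Sum>A\<in>Pow F. \<Phi> (rsign A)) + (\<Sum>A\<in>Pow F. \<Phi> (rsign (insert a A)))"
    using assms by (subst Pow_insert, subst sum.union_disjoint) (auto simp: sum.reindex)
  then show ?thesis
    using assms by (simp add: ravg_def upd add_divide_distrib)
qed

lemma ravg_orthogonal:
  assumes "finite F" "i \<in> F" "j \<in> F"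
  shows "ravg F (\<lambda>s. s i * s j) = (if i = j then 1 else 0)"
proof (cases "i = j")
  case True
  then show ?thesis
    using assms ravg_cong[of F "\<lambda>s. s i * s j" "\<lambda>s. 1"] by simp
next
  case False
  define G where "G = F - {i}"
  have G: "F = insert i G" "i \<notin> G" "finite G"
    using assms by (auto simp: G_def)
  have "ravg G (\<lambda>s. s i * s j) = ravg G (\<lambda>s. (-1) * s j)"
    by (rule ravg_cong) (use G in \<open>auto simp: rsign_def\<close>)
  then show ?thesis
    using False unfolding G(1) ravg_insert[OF G(3,2)] ravg_cmult by simp
qed

lemma ravg_powr_le:
  assumes "1 \<le> r" "finite F" "\<And>A. A \<subseteq> F \<Longrightarrow> 0 \<le> \<Phi> (rsign A)"
  shows "ravg F \<Phi> powr r \<le> ravg F (\<lambda>s. \<Phi> s powr r)"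
proof -
  have "(\<Sum>A\<in>Pow F. (1 / 2 ^ card F) * \<Phi> (rsign A)) powr r
    \<le> (\<Sum>A\<in>Pow F. 1 / 2 ^ card F) powr (r - 1) * (\<Sum>A\<in>Pow F. (1 / 2 ^ card F) * \<Phi> (rsign A) powr r)"
    by (rule powr_sum_le) (use assms in auto)
  then show ?thesis
    using assms by (simp add: ravg_def card_Pow sum_divide_distrib)
qed

lemma ravg_square:
  assumes "finite F"
  shows "ravg F (\<lambda>s. (cmod (\<Sum>i\<in>F. of_real (s i) * a i))\<^sup>2) = (\<Sum>i\<in>F. (cmod (a i))\<^sup>2)"
proof -
  have expand: "(cmod (\<Sum>i\<in>F. of_real (s i) * a i))\<^sup>2
      = (\<Sum>i\<in>F. \<Sum>j\<in>F. (Re (a i) * Re (a j) + Im (a i) * Im (a j)) * (s i * s j))" for s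
    unfolding cmod_power2
    by (simp add: power2_eq_square sum_product flip: sum.distrib)
      (simp add: algebra_simps)
  have "ravg F (\<lambda>s. (cmod (\<Sum>i\<in>F. of_real (s i) * a i))\<^sup>2)
      = (\<Sum>i\<in>F. \<Sum>j\<in>F. (Re (a i) * Re (a j) + Im (a i) * Im (a j)) * (if i = j then 1 else 0))"
    unfolding expand ravg_sum ravg_cmult
    by (intro sum.cong refl) (simp add: ravg_orthogonal assms)
  also have "\<dots> = (\<Sum>i\<in>F. (cmod (a i))\<^sup>2)"
    using assms by (simp add: cmod_power2 if_distrib cong: if_cong) (simp add: power2_eq_square)
  finally show ?thesis .
qed

text \<open>Signs are orthonormal, so the left side is the power \<open>p / 2\<close> of a second
  moment; Jensen with \<open>p / 2 \<ge> 1\<close> gives constant 1.\<close>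

lemma khinchine_lower:
  assumes "2 \<le> p" "finite F"
  shows "(\<Sum>i\<in>F. (cmod (a i))\<^sup>2) powr (p / 2) \<le> ravg F (\<lambda>s. cmod (\<Sum>i\<in>F. of_real (s i) * a i) powr p)"
proof -
  have sq: "z\<^sup>2 powr (p / 2) = z powr p" if "0 \<le> z" for z :: real
    using that by (simp add: powr_powr flip: powr_numeral)
  have "(\<Sum>i\<in>F. (cmod (a i))\<^sup>2) powr (p / 2)
      \<le> ravg F (\<lambda>s. (cmod (\<Sum>i\<in>F. of_real (s i) * a i))\<^sup>2 powr (p / 2))"
    unfolding ravg_square[OF assms(2), symmetric] by (rule ravg_powr_le) (use assms in auto)
  then show ?thesis by (simp only: sq norm_ge_zero)
qed

text \<open>The power series compare term by term, since
  \<open>2 ^ n * fact n \<le> fact (2 * n)\<close>.\<close>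

lemma cosh_le_exp_square: "cosh x \<le> exp (x\<^sup>2 / 2)" for x :: real
proof -
  have fct: "2 ^ n * fact n \<le> (fact (2 * n) :: real)" for n
  proof (induction n)
    case (Suc n)
    have "2 ^ Suc n * fact (Suc n) = (2 * (real n + 1)) * (2 ^ n * fact n)"
      by (simp add: algebra_simps)
    also have "\<dots> \<le> ((2 * real n + 2) * (2 * real n + 1)) * fact (2 * n)"
    proof (rule mult_mono[OF _ Suc])
      show "2 * (real n + 1) \<le> (2 * real n + 2) * (2 * real n + 1)"
        by (simp add: algebra_simps)
    qed auto
    also have "\<dots> = fact (Suc (Suc (2 * n)))"
      unfolding fact_Suc mult.assoc[symmetric] by (intro arg_cong2[where f="(*)"]) auto
    also have "\<dots> = fact (2 * Suc n)" by simp
    finally show ?case .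
  qed simp
  have "(\<lambda>n. if even n then x ^ n /\<^sub>R fact n else 0) sums cosh x"
    using cosh_converges[of x] by simp
  moreover have "strict_mono (\<lambda>n::nat. 2 * n)" by (simp add: strict_mono_def)
  moreover have "(if even n then x ^ n /\<^sub>R fact n else 0) = 0" if "n \<notin> range (\<lambda>n::nat. 2 * n)" for n
    using that by (auto elim: evenE)
  ultimately have c: "(\<lambda>n. x ^ (2 * n) /\<^sub>R fact (2 * n)) sums cosh x"
    using sums_mono_reindex[of "\<lambda>n. 2 * n" "\<lambda>n. if even n then x ^ n /\<^sub>R fact n else 0"] by simp
  have e: "(\<lambda>n. (x\<^sup>2 / 2) ^ n /\<^sub>R fact n) sums exp (x\<^sup>2 / 2)"
    by (rule exp_converges)
  show ?thesis
  proof (rule sums_le[OF _ c e])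
    fix n
    have "x ^ (2 * n) /\<^sub>R fact (2 * n) = (x\<^sup>2) ^ n * (1 / fact (2 * n))"
      unfolding power_mult by (simp add: divide_inverse)
    also have "\<dots> \<le> (x\<^sup>2) ^ n * (1 / (2 ^ n * fact n))"
      using fct[of n] by (intro mult_left_mono divide_left_mono) auto
    also have "\<dots> = (x\<^sup>2 / 2) ^ n /\<^sub>R fact n"
      unfolding real_scaleR_def power_divide
      by (simp only: divide_inverse inverse_mult_distrib mult_1_left mult_ac)
    finally show "x ^ (2 * n) /\<^sub>R fact (2 * n) \<le> (x\<^sup>2 / 2) ^ n /\<^sub>R fact n" .
  qed
qed

text \<open>The subgaussian bound: by independence the average is the product of the
  \<open>cosh (b i)\<close>, each at most \<open>exp ((b i)\<^sup>2 / 2)\<close>.\<close>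

lemma ravg_exp_le:
  assumes "finite F"
  shows "ravg F (\<lambda>s. exp (\<Sum>i\<in>F. s i * b i)) \<le> exp ((\<Sum>i\<in>F. (b i)\<^sup>2) / 2)"
  using assms
proof (induction F)
  case (insert a F)
  have 1: "ravg F (\<lambda>s. exp (\<Sum>i\<in>insert a F. s i * b i))
      = exp (- b a) * ravg F (\<lambda>s. exp (\<Sum>i\<in>F. s i * b i))"
    unfolding ravg_cmult[symmetric]
    by (rule ravg_cong) (use insert in \<open>auto simp: rsign_def exp_diff exp_minus field_simps\<close>)
  have "(\<Sum>i\<in>F. (s(a := 1)) i * b i) = (\<Sum>i\<in>F. s i * b i)" for s
    using insert by (intro sum.cong) auto
  then have 2: "ravg F (\<lambda>s. exp (\<Sum>i\<in>insert a F. (s(a := 1)) i * b i))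
      = exp (b a) * ravg F (\<lambda>s. exp (\<Sum>i\<in>F. s i * b i))"
    unfolding ravg_cmult[symmetric] using insert by (simp add: exp_add)
  have "ravg (insert a F) (\<lambda>s. exp (\<Sum>i\<in>insert a F. s i * b i))
      = cosh (b a) * ravg F (\<lambda>s. exp (\<Sum>i\<in>F. s i * b i))"
    unfolding ravg_insert[OF insert(1,2)] 1 2 by (simp add: cosh_def field_simps)
  also have "\<dots> \<le> exp ((b a)\<^sup>2 / 2) * exp ((\<Sum>i\<in>F. (b i)\<^sup>2) / 2)"
    by (intro mult_mono cosh_le_exp_square insert ravg_nonneg) auto
  also have "\<dots> = exp ((\<Sum>i\<in>insert a F. (b i)\<^sup>2) / 2)"
    using insert by (simp add: exp_add[symmetric] add_divide_distrib)
  finally show ?case .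
qed simp

text \<open>For x > 1 round the exponent up to n and keep only the n-th term of the exponential
  series.\<close>

lemma powr_le_fact_exp:
  fixes x p :: real
  assumes "0 \<le> x" "0 \<le> p"
  shows "x powr p \<le> fact (nat \<lceil>p\<rceil>) * exp x"
proof (cases "x \<le> 1")
  case True
  have "x powr p \<le> 1" using assms True by (simp add: powr_le1)
  also have "\<dots> \<le> fact (nat \<lceil>p\<rceil>) * exp x"
    using mult_mono[of 1 "fact (nat \<lceil>p\<rceil>)" 1 "exp x"] assms by (simp add: fact_ge_1)
  finally show ?thesis .
next
  case False
  define n where "n = nat \<lceil>p\<rceil>"
  have "x powr p \<le> x powr real n"
    using False assms by (intro powr_mono) (auto simp: n_def)
  also have "\<dots> = x ^ n" using False by (simp add: powr_realpow)
  also have "\<dots> = fact n * (x ^ n /\<^sub>R fact n)" by simp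
  also have "\<dots> \<le> fact n * exp x"
  proof (rule mult_left_mono)
    have "(\<Sum>k\<in>{n}. x ^ k /\<^sub>R fact k) \<le> (\<Sum>k. x ^ k /\<^sub>R fact k)"
      using assms by (intro sum_le_suminf summable_exp_generic) auto
    then show "x ^ n /\<^sub>R fact n \<le> exp x" by (simp add: exp_def)
  qed auto
  finally show ?thesis by (simp add: n_def)
qed

text \<open>After scaling by \<sigma> to unit variance, the moment is dominated by
  \<open>exp \<bar>X\<bar> \<le> exp X + exp (- X)\<close>, and each exponential has average at most
  \<open>exp (1 / 2)\<close>. The factor 2 counts these two terms.\<close>

lemma khinchine_real:
  fixes b :: "'i \<Rightarrow> real"
  assumes "0 \<le> p" "finite F"
  shows "ravg F (\<lambda>s. \<bar>\<Sum>i\<in>F. s i * b i\<bar> powr p)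
    \<le> (2 * fact (nat \<lceil>p\<rceil>) * exp (1 / 2)) * (\<Sum>i\<in>F. (b i)\<^sup>2) powr (p / 2)"
proof (cases "\<forall>i\<in>F. b i = 0")
  case True
  then show ?thesis using assms by simp
next
  case False
  define \<sigma> where "\<sigma> = sqrt (\<Sum>i\<in>F. (b i)\<^sup>2)"
  have "(\<Sum>i\<in>F. (b i)\<^sup>2) \<noteq> 0" using False assms by (simp add: sum_nonneg_eq_0_iff)
  then have pos: "0 < (\<Sum>i\<in>F. (b i)\<^sup>2)" by (simp add: sum_nonneg order_less_le)
  then have \<sigma>: "0 < \<sigma>" by (simp add: \<sigma>_def)
  have \<sigma>p: "\<sigma> powr p = (\<Sum>i\<in>F. (b i)\<^sup>2) powr (p / 2)"
    using pos by (simp add: \<sigma>_def powr_powr flip: powr_half_sqrt)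
  have E: "ravg F (\<lambda>s. exp (\<Sum>i\<in>F. s i * (\<delta> * b i / \<sigma>))) \<le> exp (1 / 2)" if "\<delta>\<^sup>2 = 1" for \<delta> :: real
  proof -
    have "(\<Sum>i\<in>F. (\<delta> * b i / \<sigma>)\<^sup>2) = (\<Sum>i\<in>F. (b i)\<^sup>2) / \<sigma>\<^sup>2"
      using that by (simp add: power_divide power_mult_distrib sum_divide_distrib)
    also have "\<dots> = 1" using pos by (simp add: \<sigma>_def)
    finally show ?thesis using ravg_exp_le[OF assms(2), of "\<lambda>i. \<delta> * b i / \<sigma>"] by simp
  qed
  have "ravg F (\<lambda>s. \<bar>\<Sum>i\<in>F. s i * b i\<bar> powr p)
      \<le> ravg F (\<lambda>s. \<sigma> powr p * (fact (nat \<lceil>p\<rceil>) *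
          (exp (\<Sum>i\<in>F. s i * (1 * b i / \<sigma>)) + exp (\<Sum>i\<in>F. s i * (- 1 * b i / \<sigma>)))))"
  proof (rule ravg_mono)
    fix A
    define X where "X = (\<Sum>i\<in>F. rsign A i * b i)"
    have X1: "(\<Sum>i\<in>F. rsign A i * (1 * b i / \<sigma>)) = X / \<sigma>"
      and X2: "(\<Sum>i\<in>F. rsign A i * (- 1 * b i / \<sigma>)) = - (X / \<sigma>)"
      by (simp_all add: X_def sum_divide_distrib sum_negf)
    have "\<bar>X\<bar> powr p = \<sigma> powr p * \<bar>X / \<sigma>\<bar> powr p"
      using \<sigma> by (simp add: powr_divide)
    also have "\<bar>X / \<sigma>\<bar> powr p \<le> fact (nat \<lceil>p\<rceil>) * exp \<bar>X / \<sigma>\<bar>"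
      by (rule powr_le_fact_exp) (use assms in auto)
    also have "\<dots> \<le> fact (nat \<lceil>p\<rceil>) * (exp (X / \<sigma>) + exp (- (X / \<sigma>)))"
      by (intro mult_left_mono) (auto simp: abs_if)
    finally show "\<bar>\<Sum>i\<in>F. rsign A i * b i\<bar> powr p \<le> \<sigma> powr p * (fact (nat \<lceil>p\<rceil>) *
          (exp (\<Sum>i\<in>F. rsign A i * (1 * b i / \<sigma>)) + exp (\<Sum>i\<in>F. rsign A i * (- 1 * b i / \<sigma>))))"
      unfolding X1 X2 using \<sigma> by (simp add: X_def mult_left_mono)
  qed
  also have "\<dots> = \<sigma> powr p * (fact (nat \<lceil>p\<rceil>) *
      (ravg F (\<lambda>s. exp (\<Sum>i\<in>F. s i * (1 * b i / \<sigma>))) + ravg F (\<lambda>s. exp (\<Sum>i\<in>F. s i * (- 1 * b i / \<sigma>)))))"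
    by (simp only: ravg_cmult ravg_add)
  also have "\<dots> \<le> \<sigma> powr p * (fact (nat \<lceil>p\<rceil>) * (exp (1 / 2) + exp (1 / 2)))"
    by (intro mult_left_mono add_mono E) auto
  finally show ?thesis unfolding \<sigma>p by (simp add: mult_ac)
qed

text \<open>The factor \<open>2 powr p\<close> is the price of splitting into real and imaginary
  parts; 4 is 2 for the two parts times the 2 in the constant of
  \<open>khinchine_real\<close>.\<close>

definition khinchine_const :: "real \<Rightarrow> real" where
  "khinchine_const p = 2 powr p * (4 * fact (nat \<lceil>p\<rceil>) * exp (1 / 2))"

lemma khinchine_const_pos: "0 < khinchine_const p"
  by (simp add: khinchine_const_def)

lemma khinchine_upper:
  assumes "1 \<le> p" "finite F"
  shows "ravg F (\<lambda>s. cmod (\<Sum>i\<in>F. of_real (s i) * a i) powr p)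
    \<le> khinchine_const p * (\<Sum>i\<in>F. (cmod (a i))\<^sup>2) powr (p / 2)"
proof -
  define D where "D = 2 * fact (nat \<lceil>p\<rceil>) * exp (1 / 2 :: real)"
  define S where "S = (\<Sum>i\<in>F. (cmod (a i))\<^sup>2)"
  have D: "0 \<le> D" by (simp add: D_def)
  have le: "(\<Sum>i\<in>F. (Re (a i))\<^sup>2) powr (p / 2) \<le> S powr (p / 2)"
    "(\<Sum>i\<in>F. (Im (a i))\<^sup>2) powr (p / 2) \<le> S powr (p / 2)"
    using assms by (auto intro!: powr_mono2 sum_nonneg sum_mono simp: S_def cmod_power2)
  have "ravg F (\<lambda>s. cmod (\<Sum>i\<in>F. of_real (s i) * a i) powr p)
    \<le> ravg F (\<lambda>s. 2 powr p * (\<bar>\<Sum>i\<in>F. s i * Re (a i)\<bar> powr p + \<bar>\<Sum>i\<in>F. s i * Im (a i)\<bar> powr p))"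
  proof (rule ravg_mono)
    fix A
    define z where "z = (\<Sum>i\<in>F. of_real (rsign A i) * a i)"
    have "cmod z powr p \<le> (\<bar>Re z\<bar> + \<bar>Im z\<bar>) powr p"
      using assms by (intro powr_mono2 cmod_le) auto
    also have "\<dots> \<le> 2 powr p * (\<bar>Re z\<bar> powr p + \<bar>Im z\<bar> powr p)"
      by (rule powr_add_le) (use assms in auto)
    finally show "cmod (\<Sum>i\<in>F. of_real (rsign A i) * a i) powr p
      \<le> 2 powr p * (\<bar>\<Sum>i\<in>F. rsign A i * Re (a i)\<bar> powr p + \<bar>\<Sum>i\<in>F. rsign A i * Im (a i)\<bar> powr p)"
      by (simp add: z_def)
  qed
  also have "\<dots> = 2 powr p * (ravg F (\<lambda>s. \<bar>\<Sum>i\<in>F. s i * Re (a i)\<bar> powr p)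
      + ravg F (\<lambda>s. \<bar>\<Sum>i\<in>F. s i * Im (a i)\<bar> powr p))"
    by (simp only: ravg_cmult ravg_add)
  also have "\<dots> \<le> 2 powr p * (D * (\<Sum>i\<in>F. (Re (a i))\<^sup>2) powr (p / 2) + D * (\<Sum>i\<in>F. (Im (a i))\<^sup>2) powr (p / 2))"
    unfolding D_def using assms by (intro mult_left_mono add_mono khinchine_real) auto
  also have "\<dots> \<le> 2 powr p * (D * S powr (p / 2) + D * S powr (p / 2))"
    using D le by (intro mult_left_mono add_mono) auto
  also have "\<dots> = khinchine_const p * S powr (p / 2)"
    by (simp add: khinchine_const_def D_def)
  finally show ?thesis by (simp add: S_def)
qed

text \<open>Khinchine for random sums with values in a Hilbert space. Jensen with the variances
  \<open>\<sigma> l\<close> as weights reduces it to the scalar inequality in each coordinate; these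
  weights make the coordinate bounds add up to the total variance.\<close>

lemma khinchine_l2:
  fixes y :: "'n \<Rightarrow> 'l \<Rightarrow> complex"
  assumes r: "1 \<le> r" and fin: "finite F" "finite L"
  shows "ravg F (\<lambda>s. (\<Sum>l\<in>L. (cmod (\<Sum>n\<in>F. of_real (s n) * y n l))\<^sup>2) powr r)
    \<le> khinchine_const (2 * r) * (\<Sum>n\<in>F. \<Sum>l\<in>L. (cmod (y n l))\<^sup>2) powr r"
proof -
  define C where "C = khinchine_const (2 * r)"
  define \<sigma> where "\<sigma> l = (\<Sum>n\<in>F. (cmod (y n l))\<^sup>2)" for l
  define X where "X s l = cmod (\<Sum>n\<in>F. of_real (s n) * y n l)" for s l
  have \<sigma>0: "0 \<le> \<sigma> l" for l by (simp add: \<sigma>_def sum_nonneg)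
  have X0: "X s l = 0" if "\<sigma> l = 0" for s l
  proof -
    have "\<forall>n\<in>F. y n l = 0" using that fin by (simp add: \<sigma>_def sum_nonneg_eq_0_iff)
    then show ?thesis by (simp add: X_def)
  qed
  have Xr: "((X s l)\<^sup>2) powr r = X s l powr (2 * r)" for s l
    by (simp add: X_def powr_powr flip: powr_numeral)
  have "ravg F (\<lambda>s. (\<Sum>l\<in>L. (X s l)\<^sup>2) powr r)
      \<le> ravg F (\<lambda>s. (\<Sum>l\<in>L. \<sigma> l) powr (r - 1) * (\<Sum>l\<in>L. (\<sigma> l / \<sigma> l powr r) * X s l powr (2 * r)))"
  proof (rule ravg_mono)
    fix A :: "'n set"
    define s where "s = rsign A"
    \<comment> \<open>Where \<open>\<sigma> l = 0\<close>, \<open>X0\<close> makes both sides zero,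
      so dividing by the weight is harmless.\<close>
    have "(\<Sum>l\<in>L. (X s l)\<^sup>2) = (\<Sum>l\<in>L. \<sigma> l * ((X s l)\<^sup>2 / \<sigma> l))"
      using X0 by (intro sum.cong) auto
    then have "(\<Sum>l\<in>L. (X s l)\<^sup>2) powr r \<le> (\<Sum>l\<in>L. \<sigma> l) powr (r - 1) * (\<Sum>l\<in>L. \<sigma> l * ((X s l)\<^sup>2 / \<sigma> l) powr r)"
      using powr_sum_le[OF r fin(2), of \<sigma> "\<lambda>l. (X s l)\<^sup>2 / \<sigma> l"] \<sigma>0 by simp
    also have "(\<Sum>l\<in>L. \<sigma> l * ((X s l)\<^sup>2 / \<sigma> l) powr r) = (\<Sum>l\<in>L. (\<sigma> l / \<sigma> l powr r) * X s l powr (2 * r))"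
      using \<sigma>0 by (simp add: powr_divide Xr)
    finally show "(\<Sum>l\<in>L. (X (rsign A) l)\<^sup>2) powr r
        \<le> (\<Sum>l\<in>L. \<sigma> l) powr (r - 1) * (\<Sum>l\<in>L. (\<sigma> l / \<sigma> l powr r) * X (rsign A) l powr (2 * r))"
      by (simp add: s_def)
  qed
  also have "\<dots> = (\<Sum>l\<in>L. \<sigma> l) powr (r - 1) * (\<Sum>l\<in>L. (\<sigma> l / \<sigma> l powr r) * ravg F (\<lambda>s. X s l powr (2 * r)))"
    by (simp only: ravg_cmult ravg_sum)
  also have "\<dots> \<le> (\<Sum>l\<in>L. \<sigma> l) powr (r - 1) * (\<Sum>l\<in>L. (\<sigma> l / \<sigma> l powr r) * (C * \<sigma> l powr r))"
  proof (intro mult_left_mono sum_mono)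
    fix l
    show "ravg F (\<lambda>s. X s l powr (2 * r)) \<le> C * \<sigma> l powr r"
      using khinchine_upper[OF _ fin(1), of "2 * r" "\<lambda>n. y n l"] r by (simp add: X_def C_def \<sigma>_def)
  qed (use \<sigma>0 in auto)
  also have "(\<Sum>l\<in>L. (\<sigma> l / \<sigma> l powr r) * (C * \<sigma> l powr r)) = (\<Sum>l\<in>L. C * \<sigma> l)"
    by (intro sum.cong) auto
  also have "(\<Sum>l\<in>L. \<sigma> l) powr (r - 1) * (\<Sum>l\<in>L. C * \<sigma> l) = C * (\<Sum>l\<in>L. \<sigma> l) powr r"
    using sum_nonneg[of L \<sigma>] \<sigma>0 r
    by (cases "(\<Sum>l\<in>L. \<sigma> l) = 0") (auto simp: powr_diff simp flip: sum_distrib_left)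
  also have "(\<Sum>l\<in>L. \<sigma> l) = (\<Sum>n\<in>F. \<Sum>l\<in>L. (cmod (y n l))\<^sup>2)"
    unfolding \<sigma>_def by (rule sum.swap)
  finally show ?thesis by (simp add: X_def C_def)
qed

section \<open>Square functions and sign averages of norms\<close>

context Lp_exponent
begin

text \<open>This is the p-th power of the usual square function, so its integral is compared with
  p-th powers of norms without taking roots.\<close>

definition square_fun :: "'i set \<Rightarrow> ('i \<Rightarrow> real \<Rightarrow> complex) \<Rightarrow> real \<Rightarrow> real" where
  "square_fun I f x = (\<Sum>i\<in>I. (cmod (f i x))\<^sup>2) powr (p / 2)"

lemma square_fun_nonneg [simp]: "0 \<le> square_fun I f x"
  by (simp add: square_fun_def)

lemma in_Lp_scaled_sum:
  "(\<And>i. i \<in> I \<Longrightarrow> in_Lp p (f i)) \<Longrightarrow> in_Lp p (\<lambda>x. \<Sum>i\<in>I. a i * f i x)"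
  by (intro in_Lp_sum in_Lp_cmult)

text \<open>Khinchine's lower bound provides the integrable majorant, an average of finitely many
  p-th powers of moduli.\<close>

lemma integrable_square_fun:
  assumes "2 \<le> p" "finite I" "\<And>i. i \<in> I \<Longrightarrow> in_Lp p (f i)"
  shows "integrable lborel (square_fun I f)"
proof (rule Bochner_Integration.integrable_bound)
  show "integrable lborel (\<lambda>x. ravg I (\<lambda>s. cmod (\<Sum>i\<in>I. of_real (s i) * f i x) powr p))"
    unfolding ravg_def using in_Lp_scaled_sum[of I f, OF assms(3)]
    by (intro Bochner_Integration.integrable_divide Bochner_Integration.integrable_sum) (simp add: in_Lp_def)
  have [measurable]: "f i \<in> borel_measurable borel" if "i \<in> I" for i
    using assms that by (simp add: in_Lp_def)
  show "square_fun I f \<in> borel_measurable lborel"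
    unfolding square_fun_def by measurable
  show "AE x in lborel. norm (square_fun I f x)
      \<le> norm (ravg I (\<lambda>s. cmod (\<Sum>i\<in>I. of_real (s i) * f i x) powr p))"
    using khinchine_lower[OF assms(1,2)] by (simp add: square_fun_def ravg_nonneg)
qed

lemma ravg_Lp_norm:
  assumes "finite I" "\<And>i. i \<in> I \<Longrightarrow> in_Lp p (f i)"
  shows "ravg I (\<lambda>s. Lp_norm p (\<lambda>x. \<Sum>i\<in>I. of_real (s i) * f i x) powr p)
    = (\<integral>x. ravg I (\<lambda>s. cmod (\<Sum>i\<in>I. of_real (s i) * f i x) powr p) \<partial>lborel)"
    and "integrable lborel (\<lambda>x. ravg I (\<lambda>s. cmod (\<Sum>i\<in>I. of_real (s i) * f i x) powr p))"
proof -
  have int: "integrable lborel (\<lambda>x. cmod (\<Sum>i\<in>I. of_real (s i) * f i x) powr p)" for s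
    using in_Lp_scaled_sum[of I f "\<lambda>i. of_real (s i)"] assms by (simp add: in_Lp_def)
  show "ravg I (\<lambda>s. Lp_norm p (\<lambda>x. \<Sum>i\<in>I. of_real (s i) * f i x) powr p)
    = (\<integral>x. ravg I (\<lambda>s. cmod (\<Sum>i\<in>I. of_real (s i) * f i x) powr p) \<partial>lborel)"
    unfolding ravg_def Lp_norm_powr using int by (simp add: integral_sum)
  show "integrable lborel (\<lambda>x. ravg I (\<lambda>s. cmod (\<Sum>i\<in>I. of_real (s i) * f i x) powr p))"
    unfolding ravg_def using int by auto
qed

lemma integral_square_fun_le:
  assumes "2 \<le> p" "finite I" "\<And>i. i \<in> I \<Longrightarrow> in_Lp p (f i)"
  shows "(\<integral>x. square_fun I f x \<partial>lborel)
    \<le> ravg I (\<lambda>s. Lp_norm p (\<lambda>x. \<Sum>i\<in>I. of_real (s i) * f i x) powr p)"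
  using khinchine_lower[OF assms(1,2)]
  by (subst ravg_Lp_norm(1)[of I f], simp_all add: assms, intro integral_mono integrable_square_fun ravg_Lp_norm(2) assms) (auto simp: square_fun_def)

lemma ravg_Lp_norm_le:
  assumes "2 \<le> p" "finite I" "\<And>i. i \<in> I \<Longrightarrow> in_Lp p (f i)"
  shows "ravg I (\<lambda>s. Lp_norm p (\<lambda>x. \<Sum>i\<in>I. of_real (s i) * f i x) powr p)
    \<le> khinchine_const p * (\<integral>x. square_fun I f x \<partial>lborel)"
proof -
  have "(\<integral>x. ravg I (\<lambda>s. cmod (\<Sum>i\<in>I. of_real (s i) * f i x) powr p) \<partial>lborel)
      \<le> (\<integral>x. khinchine_const p * square_fun I f x \<partial>lborel)"
    using khinchine_upper[OF p_ge_1 assms(2)]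
    by (intro integral_mono integrable_mult_right integrable_square_fun ravg_Lp_norm(2) assms)
      (auto simp: square_fun_def)
  then show ?thesis by (subst ravg_Lp_norm(1)[of I f]) (simp_all add: assms)
qed

end

section \<open>Unconditional bases of Lebesgue spaces\<close>

context Lp_exponent
begin

text \<open>Since \<open>q\<close> has finite values, the sets where \<open>q \<le> n\<close> cover
  the whole space; one of them must be dense in some ball. The usual nested balls are built by hand,
  because functions equal almost everywhere are not identified and \<open>Lp_norm\<close> is only a
  seminorm here.\<close>

lemma Lp_Baire:
  fixes q :: "(real \<Rightarrow> complex) \<Rightarrow> real"
  obtains n :: nat and h \<delta> where "in_Lp p h" "0 < \<delta>"
    "\<And>f \<epsilon>. in_Lp p f \<Longrightarrow> Lp_norm p (\<lambda>x. f x - h x) < \<delta> \<Longrightarrow> 0 < \<epsilon> \<Longrightarrow>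
      \<exists>e. in_Lp p e \<and> q e \<le> real n \<and> Lp_norm p (\<lambda>x. f x - e x) < \<epsilon>"
proof (rule ccontr)
  assume contra: "\<not> thesis"
  note found = that
  \<comment> \<open>If no such ball exists, every ball contains the centre of a smaller one on which
    \<open>q\<close> exceeds n.\<close>
  have step: "\<exists>f \<epsilon>. in_Lp p f \<and> Lp_norm p (\<lambda>x. f x - h x) < \<delta> \<and> 0 < \<epsilon> \<and>
      (\<forall>e. in_Lp p e \<and> Lp_norm p (\<lambda>x. f x - e x) < \<epsilon> \<longrightarrow> real n < q e)"
    if "in_Lp p h" "0 < \<delta>" for n :: nat and h \<delta>
  proof (rule ccontr)
    assume "\<not> ?thesis"
    then have thesis by (intro found[of h \<delta> n] that) (meson not_less)+
    then show False using contra by blast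
  qed
  define P where "P n a \<longleftrightarrow> in_Lp p (fst a) \<and> 0 < snd a" for n :: nat and a :: "(real \<Rightarrow> complex) \<times> real"
  \<comment> \<open>A centre moves by less than a quarter of the radius while the radius is at least
    halved. From stage n on the total displacement is then at most half of the n-th radius, so the
    limit lies in every ball.\<close>
  define R where "R n a b \<longleftrightarrow> Lp_norm p (\<lambda>x. fst b x - fst a x) < snd a / 4 \<and> snd b \<le> snd a / 2 \<and>
      (\<forall>e. in_Lp p e \<and> Lp_norm p (\<lambda>x. fst b x - e x) < snd b \<longrightarrow> real n < q e)"
    for n and a b :: "(real \<Rightarrow> complex) \<times> real"
  have "\<exists>a. \<forall>n. P n (a n) \<and> R n (a n) (a (Suc n))"
  proof (rule dependent_nat_choice)
    show "\<exists>a. P 0 a" using in_Lp_0 by (auto simp: P_def intro!: exI[of _ "\<lambda>x. 0"] exI[of _ 1])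
    fix a n assume "P n a"
    then obtain f \<epsilon> where f: "in_Lp p f" "Lp_norm p (\<lambda>x. f x - fst a x) < snd a / 4" "0 < \<epsilon>"
      "\<And>e. in_Lp p e \<Longrightarrow> Lp_norm p (\<lambda>x. f x - e x) < \<epsilon> \<Longrightarrow> real n < q e"
      using step[of "fst a" "snd a / 4" n] by (auto simp: P_def)
    then show "\<exists>b. P (Suc n) b \<and> R n a b"
      using \<open>P n a\<close> by (intro exI[of _ "(f, min (snd a / 2) \<epsilon>)"]) (auto simp: P_def R_def)
  qed
  then obtain a where a: "\<And>n. P n (a n)" "\<And>n. R n (a n) (a (Suc n))" by blast
  define f where "f n = fst (a n)" for n
  define d where "d n = snd (a n)" for n
  have f: "in_Lp p (f n)" and d: "0 < d n" for n using a(1)[of n] by (auto simp: P_def f_def d_def)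
  have step_f: "Lp_norm p (\<lambda>x. f (Suc n) x - f n x) \<le> d n / 4"
    and d_half: "d (Suc n) \<le> d n / 2"
    and far: "in_Lp p e \<Longrightarrow> Lp_norm p (\<lambda>x. f (Suc n) x - e x) < d (Suc n) \<Longrightarrow> real n < q e" for n e
    using a(2)[of n] by (auto simp: R_def f_def d_def)
  have d_pow: "d (n + k) \<le> d n * (1 / 2) ^ k" for n k
  proof (induction k)
    case (Suc k)
    have "d (n + Suc k) \<le> d (n + k) / 2" using d_half[of "n + k"] by simp
    also have "\<dots> \<le> (d n * (1 / 2) ^ k) / 2" using Suc by simp
    also have "\<dots> = d n * (1 / 2) ^ Suc k" by simp
    finally show ?case .
  qed simp
  define g where "g n = (\<lambda>x. f (Suc n) x - f n x)" for n
  have gL: "in_Lp p (g n)" for n unfolding g_def by (intro in_Lp_diff f)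
  have gbd: "Lp_norm p (g (i + n)) \<le> d n / 4 * (1 / 2) ^ i" for i n
    using step_f[of "i + n"] d_pow[of n i] by (simp add: g_def add.commute)
  have geo: "(\<lambda>i. d n / 4 * (1 / 2) ^ i) sums (d n / 2)" for n
    using sums_mult[OF geometric_sums[of "1 / 2 :: real"], of "d n / 4"] by simp
  have sm: "summable (\<lambda>i. Lp_norm p (g (i + n)))" for n
    by (rule summable_comparison_test'[OF sums_summable[OF geo[of n]], of 0]) (use gbd in auto)
  have tail: "(\<Sum>i. Lp_norm p (g (i + n))) \<le> d n / 2" for n
    using suminf_le[OF gbd sm sums_summable[OF geo]] sums_unique[OF geo] by metis
  obtain F where F: "in_Lp p F"
    "\<And>n. Lp_norm p (\<lambda>x. F x - (\<Sum>i<n. g i x)) \<le> (\<Sum>i. Lp_norm p (g (i + n)))"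
    by (rule Lp_complete[of g, OF gL]) (use sm[of 0] in auto)
  \<comment> \<open>\<open>F\<close> is the limit of the telescoped differences, which start from
    the centre \<open>f 0\<close>.\<close>
  define e where "e = (\<lambda>x. F x + f 0 x)"
  have e: "in_Lp p e" unfolding e_def by (intro in_Lp_add F f)
  have "(\<Sum>i<n. g i x) = f n x - f 0 x" for n x
    unfolding g_def by (simp add: sum_lessThan_telescope[of "\<lambda>i. f i x"])
  then have "(\<lambda>x. F x - (\<Sum>i<n. g i x)) = (\<lambda>x. e x - f n x)" for n
    by (simp add: e_def fun_eq_iff)
  then have close: "Lp_norm p (\<lambda>x. f n x - e x) < d n" for n
    using F(2)[of n] tail[of n] d[of n] Lp_norm_minus_commute[of "f n" e] by simp
  obtain n :: nat where "q e \<le> real n" using real_arch_simple by blast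
  moreover have "real n < q e" by (rule far[OF e close])
  ultimately show False by simp
qed

text \<open>By Baire, \<open>{q \<le> n}\<close> is dense in some ball for some \<open>n\<close>; rescaling and successive approximation,
  as in the open mapping theorem, turn this into a bound for \<open>q\<close>.\<close>

lemma Zabreiko:
  fixes q :: "(real \<Rightarrow> complex) \<Rightarrow> real"
  assumes q_scale: "\<And>f a. in_Lp p f \<Longrightarrow> 0 \<le> a \<Longrightarrow> q (\<lambda>x. of_real a * f x) \<le> a * q f"
    and q_diff: "\<And>f h. in_Lp p f \<Longrightarrow> in_Lp p h \<Longrightarrow> q (\<lambda>x. f x - h x) \<le> q f + q h"
    and q_nonneg: "\<And>f. in_Lp p f \<Longrightarrow> 0 \<le> q f"
    and q_suminf: "\<And>f g. in_Lp p f \<Longrightarrow> (\<And>j. in_Lp p (g j)) \<Longrightarrow>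
      (\<lambda>n. Lp_norm p (\<lambda>x. f x - (\<Sum>j<n. g j x))) \<longlonglongrightarrow> 0 \<Longrightarrow> summable (\<lambda>j. q (g j)) \<Longrightarrow>
      q f \<le> (\<Sum>j. q (g j))"
  obtains K where "0 \<le> K" "\<And>f. in_Lp p f \<Longrightarrow> q f \<le> K * Lp_norm p f"
proof -
  obtain n :: nat and h \<delta> where h: "in_Lp p h" and \<delta>: "0 < \<delta>" and
    dense: "\<And>f \<epsilon>. in_Lp p f \<Longrightarrow> Lp_norm p (\<lambda>x. f x - h x) < \<delta> \<Longrightarrow> 0 < \<epsilon> \<Longrightarrow>
      \<exists>e. in_Lp p e \<and> q e \<le> real n \<and> Lp_norm p (\<lambda>x. f x - e x) < \<epsilon>"
    by (rule Lp_Baire[of q]) blast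
  define M where "M = 2 * real n / \<delta>"
  have M: "0 \<le> M" using \<delta> by (simp add: M_def)
  \<comment> \<open>The ball is moved to the origin by approximating \<open>f + h\<close> and
    \<open>h\<close> separately and subtracting, which doubles the bound n.\<close>
  have approx0: "\<exists>e. in_Lp p e \<and> q e \<le> 2 * real n \<and> Lp_norm p (\<lambda>x. f x - e x) < \<epsilon>"
    if f: "in_Lp p f" "Lp_norm p f < \<delta>" and \<epsilon>: "0 < \<epsilon>" for f \<epsilon>
  proof -
    obtain e1 where e1: "in_Lp p e1" "q e1 \<le> real n" "Lp_norm p (\<lambda>x. (f x + h x) - e1 x) < \<epsilon> / 2"
      using dense[OF in_Lp_add[OF f(1) h], of "\<epsilon> / 2"] f \<epsilon> by auto
    obtain e2 where e2: "in_Lp p e2" "q e2 \<le> real n" "Lp_norm p (\<lambda>x. h x - e2 x) < \<epsilon> / 2"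
      using dense[OF h, of "\<epsilon> / 2"] \<delta> \<epsilon> by auto
    have "Lp_norm p (\<lambda>x. f x - (e1 x - e2 x))
        \<le> Lp_norm p (\<lambda>x. (f x + h x) - e1 x) + Lp_norm p (\<lambda>x. h x - e2 x)"
      using Lp_norm_triangle_diff[OF in_Lp_diff[OF in_Lp_add[OF f(1) h] e1(1)] in_Lp_diff[OF h e2(1)]]
      by (simp add: algebra_simps)
    then show ?thesis
      using e1 e2 q_diff[OF e1(1) e2(1)] in_Lp_diff[OF e1(1) e2(1)]
      by (intro exI[of _ "\<lambda>x. e1 x - e2 x"]) auto
  qed
  have approx: "\<exists>e. in_Lp p e \<and> q e \<le> M * t \<and> Lp_norm p (\<lambda>x. f x - e x) < \<epsilon>"
    if f: "in_Lp p f" "Lp_norm p f < t" and t: "0 < t" and \<epsilon>: "0 < \<epsilon>" for f t \<epsilon>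
  proof -
    define a where "a = \<delta> / t"
    have a: "0 < a" using \<delta> t by (simp add: a_def)
    have "Lp_norm p (\<lambda>x. of_real a * f x) < \<delta>"
    proof -
      have "Lp_norm p (\<lambda>x. of_real a * f x) = a * Lp_norm p f"
        using Lp_norm_cmult[of "of_real a" f] a by simp
      also have "\<dots> < a * t" using f a by simp
      also have "\<dots> = \<delta>" using t by (simp add: a_def)
      finally show ?thesis .
    qed
    then obtain e where e: "in_Lp p e" "q e \<le> 2 * real n" "Lp_norm p (\<lambda>x. of_real a * f x - e x) < a * \<epsilon>"
      using approx0[OF in_Lp_cmult[OF f(1)], of "of_real a" "a * \<epsilon>"] a \<epsilon> by auto
    have "(\<lambda>x. f x - of_real (1 / a) * e x) = (\<lambda>x. of_real (1 / a) * (of_real a * f x - e x))"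
      using a by (simp add: algebra_simps)
    note arg_cong[where f="Lp_norm p", OF this]
    also have "Lp_norm p (\<lambda>x. of_real (1 / a) * (of_real a * f x - e x)) = 1 / a * Lp_norm p (\<lambda>x. of_real a * f x - e x)"
      using a unfolding Lp_norm_cmult norm_of_real by simp
    also have "\<dots> < \<epsilon>" using e a by (simp add: field_simps)
    finally have "Lp_norm p (\<lambda>x. f x - of_real (1 / a) * e x) < \<epsilon>" .
    moreover have "q (\<lambda>x. of_real (1 / a) * e x) \<le> 1 / a * q e"
      using q_scale[OF e(1), of "1 / a"] a by simp
    moreover have "1 / a * q e \<le> 1 / a * (2 * real n)"
      using e a by (intro mult_left_mono) auto
    moreover have "1 / a * (2 * real n) = M * t"
      using t \<delta> by (simp add: a_def M_def)
    ultimately show ?thesis using in_Lp_cmult[OF e(1), of "of_real (1 / a)"] by fastforce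
  qed
  then obtain E where E: "\<And>f t \<epsilon>. in_Lp p f \<Longrightarrow> Lp_norm p f < t \<Longrightarrow> 0 < t \<Longrightarrow> 0 < \<epsilon> \<Longrightarrow>
      in_Lp p (E f t \<epsilon>) \<and> q (E f t \<epsilon>) \<le> M * t \<and> Lp_norm p (\<lambda>x. f x - E f t \<epsilon> x) < \<epsilon>"
    by metis
  have bound: "q f \<le> 2 * M * t" if f: "in_Lp p f" "Lp_norm p f < t" for f t
  proof -
    have t: "0 < t" using f(2) Lp_norm_nonneg[of f] by linarith
    \<comment> \<open>\<open>r k\<close> is what remains after k corrections and is smaller than
      \<open>t / 2 ^ k\<close>. The k-th correction costs at most \<open>M * t / 2 ^ k\<close>, so
      all of them together cost \<open>2 * M * t\<close>.\<close>
    define r where "r = rec_nat f (\<lambda>k r x. r x - E r (t / 2 ^ k) (t / 2 ^ Suc k) x)"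
    define e where "e k = E (r k) (t / 2 ^ k) (t / 2 ^ Suc k)" for k
    have r0: "r 0 = f" and rS: "r (Suc k) = (\<lambda>x. r k x - e k x)" for k
      by (simp_all add: r_def e_def)
    have r: "in_Lp p (r k) \<and> Lp_norm p (r k) < t / 2 ^ k" for k
    proof (induction k)
      case 0 then show ?case using f by (simp add: r0)
    next
      case (Suc k)
      then show ?case
        using E[of "r k" "t / 2 ^ k" "t / 2 ^ Suc k"] t in_Lp_diff[of "r k" "e k"]
        unfolding rS by (simp add: e_def)
    qed
    have e: "in_Lp p (e k)" "q (e k) \<le> M * t * (1 / 2) ^ k" for k
      using E[of "r k" "t / 2 ^ k" "t / 2 ^ Suc k"] r[of k] t by (simp_all add: e_def power_divide)
    have tel: "f x - (\<Sum>j<k. e j x) = r k x" for k x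
      by (induction k) (simp_all add: r0 rS algebra_simps)
    have "(\<lambda>k. t * (1 / 2) ^ k) \<longlonglongrightarrow> t * 0"
      by (intro tendsto_mult tendsto_const LIMSEQ_realpow_zero) auto
    then have lim: "(\<lambda>k. Lp_norm p (r k)) \<longlonglongrightarrow> 0"
      by (rule_tac tendsto_sandwich[where f="\<lambda>_. 0" and h="\<lambda>k. t * (1 / 2) ^ k"])
        (use r in \<open>auto intro!: always_eventually simp: less_imp_le power_divide\<close>)
    have geo: "(\<lambda>k. M * t * (1 / 2) ^ k) sums (2 * M * t)"
      using sums_mult[OF geometric_sums[of "1 / 2 :: real"], of "M * t"] by (simp add: mult_ac)
    have sm: "summable (\<lambda>k. q (e k))"
      by (rule summable_comparison_test'[OF sums_summable[OF geo], of 0]) (use e q_nonneg in auto)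
    have "q f \<le> (\<Sum>k. q (e k))"
      by (rule q_suminf[OF f(1) e(1) _ sm]) (simp add: tel lim)
    also have "\<dots> \<le> 2 * M * t"
      using suminf_le[OF e(2) sm sums_summable[OF geo]] sums_unique[OF geo] by metis
    finally show ?thesis .
  qed
  have "q f \<le> 2 * M * Lp_norm p f" if f: "in_Lp p f" for f
  proof (rule field_le_epsilon)
    fix s :: real assume s: "0 < s"
    define t where "t = s / (2 * M + 1)"
    have t: "0 < t" "2 * M * t \<le> s" using s M by (auto simp: t_def field_simps)
    have "q f \<le> 2 * M * (Lp_norm p f + t)" by (rule bound[OF f]) (use t in auto)
    then show "q f \<le> 2 * M * Lp_norm p f + s" using t by (simp add: algebra_simps)
  qed
  then show ?thesis using that[of "2 * M"] M by simp
qed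

text \<open>A point of the unit cube is a convex combination of its vertices, and the norm is
  convex. The induction treats one coordinate at a time; \<open>h\<close> carries the terms whose
  multiplier has already been inserted.\<close>

lemma Lp_norm_multiplier:
  assumes "finite F" "\<And>i. i \<in> F \<Longrightarrow> in_Lp p (w i)" "in_Lp p h"
    and "\<And>A. A \<subseteq> F \<Longrightarrow> Lp_norm p (\<lambda>x. h x + (\<Sum>i\<in>A. w i x)) \<le> B"
    and "\<And>i. i \<in> F \<Longrightarrow> 0 \<le> m i \<and> m i \<le> 1"
  shows "Lp_norm p (\<lambda>x. h x + (\<Sum>i\<in>F. of_real (m i) * w i x)) \<le> B"
  using assms
proof (induction F arbitrary: h)
  case empty
  from empty.prems(3)[of "{}"] show ?case by simp
next
  case (insert a F)
  have m: "0 \<le> m a" "m a \<le> 1" using insert.prems by auto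
  have "Lp_norm p (\<lambda>x. (h x + of_real (m a) * w a x) + (\<Sum>i\<in>F. of_real (m i) * w i x)) \<le> B"
  proof (rule insert.IH)
    show "in_Lp p (\<lambda>x. h x + of_real (m a) * w a x)"
      using insert.prems by (intro in_Lp_add in_Lp_cmult) auto
    fix A assume A: "A \<subseteq> F"
    then have fin: "finite A" "a \<notin> A" using insert.hyps by (auto intro: finite_subset)
    define f1 where "f1 = (\<lambda>x. h x + (\<Sum>i\<in>A. w i x))"
    define f2 where "f2 = (\<lambda>x. h x + (\<Sum>i\<in>insert a A. w i x))"
    have L: "in_Lp p f1" "in_Lp p f2" unfolding f1_def f2_def
      using insert.prems A by (auto intro!: in_Lp_add in_Lp_sum)
    have N: "Lp_norm p f1 \<le> B" "Lp_norm p f2 \<le> B" unfolding f1_def f2_def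
      using A by (intro insert.prems(3); auto)+
    have "(\<lambda>x. (h x + of_real (m a) * w a x) + (\<Sum>i\<in>A. w i x))
        = (\<lambda>x. of_real (1 - m a) * f1 x + of_real (m a) * f2 x)"
      using fin by (simp add: f1_def f2_def algebra_simps)
    note arg_cong[where f="Lp_norm p", OF this]
    also have "Lp_norm p \<dots> \<le> cmod (of_real (1 - m a)) * Lp_norm p f1 + cmod (of_real (m a)) * Lp_norm p f2"
      unfolding Lp_norm_cmult[symmetric] using L by (intro Lp_norm_triangle in_Lp_cmult)
    also have "\<dots> \<le> (1 - m a) * B + m a * B"
      unfolding norm_of_real using m N by (intro add_mono mult_mono) auto
    also have "\<dots> = B" by (simp add: algebra_simps)
    finally show "Lp_norm p (\<lambda>x. (h x + of_real (m a) * w a x) + (\<Sum>i\<in>A. w i x)) \<le> B" .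
  qed (use insert.prems in auto)
  then show ?case using insert.hyps by (simp add: add.assoc)
qed

text \<open>The factor 4 counts the positive and negative parts of the real and imaginary parts of
  the multiplier.\<close>

lemma Lp_norm_complex_multiplier:
  assumes "finite F" "\<And>i. i \<in> F \<Longrightarrow> in_Lp p (w i)"
    and B: "\<And>A. A \<subseteq> F \<Longrightarrow> Lp_norm p (\<lambda>x. \<Sum>i\<in>A. w i x) \<le> B"
    and m: "\<And>i. i \<in> F \<Longrightarrow> cmod (m i) \<le> 1"
  shows "Lp_norm p (\<lambda>x. \<Sum>i\<in>F. m i * w i x) \<le> 4 * B"
proof -
  have pos: "Lp_norm p (\<lambda>x. \<Sum>i\<in>F. of_real (\<mu> i) * w i x) \<le> B"
    if "\<And>i. i \<in> F \<Longrightarrow> 0 \<le> \<mu> i \<and> \<mu> i \<le> 1" for \<mu>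
    using Lp_norm_multiplier[of F w "\<lambda>x. 0" B \<mu>] assms that by simp
  have real: "Lp_norm p (\<lambda>x. \<Sum>i\<in>F. of_real (\<mu> i) * w i x) \<le> 2 * B"
    if \<mu>: "\<And>i. i \<in> F \<Longrightarrow> \<bar>\<mu> i\<bar> \<le> 1" for \<mu>
  proof -
    have "\<mu> i = max 0 (\<mu> i) - max 0 (- \<mu> i)" for i by auto
    then have "(of_real (\<mu> i) :: complex) = of_real (max 0 (\<mu> i)) - of_real (max 0 (- \<mu> i))" for i
      by (metis of_real_diff)
    then have "(\<lambda>x. \<Sum>i\<in>F. of_real (\<mu> i) * w i x)
      = (\<lambda>x. (\<Sum>i\<in>F. of_real (max 0 (\<mu> i)) * w i x) - (\<Sum>i\<in>F. of_real (max 0 (- \<mu> i)) * w i x))"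
      by (simp add: sum_subtractf[symmetric] left_diff_distrib[symmetric])
    note arg_cong[where f="Lp_norm p", OF this]
    also have "Lp_norm p \<dots> \<le> Lp_norm p (\<lambda>x. \<Sum>i\<in>F. of_real (max 0 (\<mu> i)) * w i x)
        + Lp_norm p (\<lambda>x. \<Sum>i\<in>F. of_real (max 0 (- \<mu> i)) * w i x)"
      using assms(2) by (intro Lp_norm_triangle_diff in_Lp_scaled_sum) auto
    also have "\<dots> \<le> B + B" using \<mu> by (intro add_mono pos) (force simp: abs_le_iff)+
    finally show ?thesis by simp
  qed
  have "(\<lambda>x. \<Sum>i\<in>F. m i * w i x)
    = (\<lambda>x. \<Sum>i\<in>F. (of_real (Re (m i)) + \<i> * of_real (Im (m i))) * w i x)"
    by (intro ext sum.cong refl arg_cong2[where f="(*)"]) (rule complex_eq)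
  also have "(\<lambda>x. \<Sum>i\<in>F. (of_real (Re (m i)) + \<i> * of_real (Im (m i))) * w i x)
      = (\<lambda>x. (\<Sum>i\<in>F. of_real (Re (m i)) * w i x) + \<i> * (\<Sum>i\<in>F. of_real (Im (m i)) * w i x))"
    by (simp add: distrib_right sum.distrib sum_distrib_left mult.assoc)
  finally have split: "(\<lambda>x. \<Sum>i\<in>F. m i * w i x)
      = (\<lambda>x. (\<Sum>i\<in>F. of_real (Re (m i)) * w i x) + \<i> * (\<Sum>i\<in>F. of_real (Im (m i)) * w i x))" .
  note arg_cong[where f="Lp_norm p", OF split]
  also have "Lp_norm p \<dots> \<le> Lp_norm p (\<lambda>x. \<Sum>i\<in>F. of_real (Re (m i)) * w i x)
      + Lp_norm p (\<lambda>x. \<i> * (\<Sum>i\<in>F. of_real (Im (m i)) * w i x))"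
    using assms(2) by (intro Lp_norm_triangle in_Lp_cmult[of _ \<i>] in_Lp_scaled_sum) auto
  also have "\<dots> = Lp_norm p (\<lambda>x. \<Sum>i\<in>F. of_real (Re (m i)) * w i x)
      + Lp_norm p (\<lambda>x. \<Sum>i\<in>F. of_real (Im (m i)) * w i x)"
    by (simp add: Lp_norm_cmult)
  also have "\<dots> \<le> 2 * B + 2 * B"
    using m by (intro add_mono real) (meson abs_Re_le_cmod abs_Im_le_cmod order_trans)+
  finally show ?thesis by simp
qed

end

section \<open>Coefficients and the unconditional constant\<close>

locale Lp_basis = Lp_exponent +
  fixes u :: "'i \<Rightarrow> real \<Rightarrow> complex" and I :: "'i set"
  assumes basis: "Lp_unconditional_basis p u I"
begin

lemma u_Lp: "i \<in> I \<Longrightarrow> in_Lp p (u i)"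
  using basis by (simp add: Lp_unconditional_basis_def)

text \<open>Uniqueness of the expansion determines these values only for indices in \<open>I\<close>
  and functions in the space; this is why linearity is stated under those conditions.\<close>

definition coef :: "(real \<Rightarrow> complex) \<Rightarrow> 'i \<Rightarrow> complex" where
  "coef f = (SOME c. Lp_uncond_sums p u I c f)"

abbreviation partial :: "'i set \<Rightarrow> (real \<Rightarrow> complex) \<Rightarrow> real \<Rightarrow> complex" where
  "partial F f \<equiv> (\<lambda>x. \<Sum>i\<in>F. coef f i * u i x)"

lemma coef_sums: "in_Lp p f \<Longrightarrow> Lp_uncond_sums p u I (coef f) f"
  unfolding coef_def using basis unfolding Lp_unconditional_basis_def by (metis (lifting) someI_ex)

lemma coef_unique:
  assumes "in_Lp p f" "Lp_uncond_sums p u I c f" "i \<in> I"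
  shows "coef f i = c i"
proof -
  obtain d where d: "\<And>c'. Lp_uncond_sums p u I c' f \<Longrightarrow> \<forall>i\<in>I. c' i = d i"
    using basis assms(1) unfolding Lp_unconditional_basis_def by meson
  show ?thesis using d[OF assms(2)] d[OF coef_sums[OF assms(1)]] assms(3) by simp
qed

lemma in_Lp_span: "F \<subseteq> I \<Longrightarrow> in_Lp p (\<lambda>x. \<Sum>i\<in>F. a i * u i x)"
  by (intro in_Lp_scaled_sum u_Lp) auto

lemma uncond_sums_add:
  assumes f: "in_Lp p f" "Lp_uncond_sums p u I c f" and h: "in_Lp p h" "Lp_uncond_sums p u I d h"
  shows "Lp_uncond_sums p u I (\<lambda>i. c i + d i) (\<lambda>x. f x + h x)"
  unfolding Lp_uncond_sums_def
proof (intro allI impI)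
  fix \<epsilon> :: real assume \<epsilon>: "0 < \<epsilon>"
  obtain F1 where F1: "finite F1" "F1 \<subseteq> I"
    "\<And>F. finite F \<and> F1 \<subseteq> F \<and> F \<subseteq> I \<Longrightarrow> Lp_norm p (\<lambda>x. f x - (\<Sum>i\<in>F. c i * u i x)) < \<epsilon> / 2"
    using f(2) \<epsilon> unfolding Lp_uncond_sums_def by (meson half_gt_zero)
  obtain F2 where F2: "finite F2" "F2 \<subseteq> I"
    "\<And>F. finite F \<and> F2 \<subseteq> F \<and> F \<subseteq> I \<Longrightarrow> Lp_norm p (\<lambda>x. h x - (\<Sum>i\<in>F. d i * u i x)) < \<epsilon> / 2"
    using h(2) \<epsilon> unfolding Lp_uncond_sums_def by (meson half_gt_zero)
  show "\<exists>F0. finite F0 \<and> F0 \<subseteq> I \<and> (\<forall>F. finite F \<and> F0 \<subseteq> F \<and> F \<subseteq> I \<longrightarrow>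
      Lp_norm p (\<lambda>x. f x + h x - (\<Sum>i\<in>F. (c i + d i) * u i x)) < \<epsilon>)"
  proof (intro exI[of _ "F1 \<union> F2"] conjI allI impI)
    fix F assume F: "finite F \<and> F1 \<union> F2 \<subseteq> F \<and> F \<subseteq> I"
    have "(\<lambda>x. f x + h x - (\<Sum>i\<in>F. (c i + d i) * u i x))
      = (\<lambda>x. (f x - (\<Sum>i\<in>F. c i * u i x)) + (h x - (\<Sum>i\<in>F. d i * u i x)))"
      by (simp add: distrib_right sum.distrib algebra_simps)
    note arg_cong[where f="Lp_norm p", OF this]
    also have "Lp_norm p \<dots> \<le> Lp_norm p (\<lambda>x. f x - (\<Sum>i\<in>F. c i * u i x))
        + Lp_norm p (\<lambda>x. h x - (\<Sum>i\<in>F. d i * u i x))"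
      using F f h by (intro Lp_norm_triangle in_Lp_diff in_Lp_span) auto
    also have "\<dots> < \<epsilon> / 2 + \<epsilon> / 2" using F by (intro add_strict_mono F1 F2) auto
    finally show "Lp_norm p (\<lambda>x. f x + h x - (\<Sum>i\<in>F. (c i + d i) * u i x)) < \<epsilon>" by simp
  qed (use F1 F2 in auto)
qed

lemma uncond_sums_cmult:
  assumes "Lp_uncond_sums p u I c f"
  shows "Lp_uncond_sums p u I (\<lambda>i. a * c i) (\<lambda>x. a * f x)"
  unfolding Lp_uncond_sums_def
proof (intro allI impI)
  fix \<epsilon> :: real assume \<epsilon>: "0 < \<epsilon>"
  then have "0 < \<epsilon> / (cmod a + 1)" by (simp add: add_nonneg_pos)
  then obtain F0 where F0: "finite F0" "F0 \<subseteq> I" "\<And>F. finite F \<and> F0 \<subseteq> F \<and> F \<subseteq> I \<Longrightarrow>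
      Lp_norm p (\<lambda>x. f x - (\<Sum>i\<in>F. c i * u i x)) < \<epsilon> / (cmod a + 1)"
    using assms unfolding Lp_uncond_sums_def by meson
  show "\<exists>F0. finite F0 \<and> F0 \<subseteq> I \<and> (\<forall>F. finite F \<and> F0 \<subseteq> F \<and> F \<subseteq> I \<longrightarrow>
      Lp_norm p (\<lambda>x. a * f x - (\<Sum>i\<in>F. a * c i * u i x)) < \<epsilon>)"
  proof (intro exI[of _ F0] conjI allI impI F0(1,2))
    fix F assume F: "finite F \<and> F0 \<subseteq> F \<and> F \<subseteq> I"
    have "(\<lambda>x. a * f x - (\<Sum>i\<in>F. a * c i * u i x)) = (\<lambda>x. a * (f x - (\<Sum>i\<in>F. c i * u i x)))"
      by (simp add: right_diff_distrib sum_distrib_left mult.assoc)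
    then have "Lp_norm p (\<lambda>x. a * f x - (\<Sum>i\<in>F. a * c i * u i x))
        = cmod a * Lp_norm p (\<lambda>x. f x - (\<Sum>i\<in>F. c i * u i x))"
      by (simp only: Lp_norm_cmult)
    also have "\<dots> \<le> (cmod a + 1) * Lp_norm p (\<lambda>x. f x - (\<Sum>i\<in>F. c i * u i x))"
      by (intro mult_right_mono) auto
    also have "\<dots> < \<epsilon>"
      using F0(3)[OF F] by (simp add: pos_less_divide_eq add_nonneg_pos mult.commute)
    finally show "Lp_norm p (\<lambda>x. a * f x - (\<Sum>i\<in>F. a * c i * u i x)) < \<epsilon>" .
  qed
qed

lemma uncond_sums_finite:
  assumes "finite F" "F \<subseteq> I"
  shows "Lp_uncond_sums p u I (\<lambda>i. if i \<in> F then a i else 0) (\<lambda>x. \<Sum>i\<in>F. a i * u i x)"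
  unfolding Lp_uncond_sums_def
proof (intro allI impI exI[of _ F] conjI assms)
  fix \<epsilon> :: real and G assume "0 < \<epsilon>" and G: "finite G \<and> F \<subseteq> G \<and> G \<subseteq> I"
  have "(\<Sum>i\<in>G. (if i \<in> F then a i else 0) * u i x) = (\<Sum>i\<in>F. a i * u i x)" for x
    using G by (intro sum.mono_neutral_cong_right) auto
  then show "Lp_norm p (\<lambda>x. (\<Sum>i\<in>F. a i * u i x) - (\<Sum>i\<in>G. (if i \<in> F then a i else 0) * u i x)) < \<epsilon>"
    using \<open>0 < \<epsilon>\<close> by simp
qed

lemma coef_add: "in_Lp p f \<Longrightarrow> in_Lp p h \<Longrightarrow> i \<in> I \<Longrightarrow> coef (\<lambda>x. f x + h x) i = coef f i + coef h i"
  using coef_unique[OF in_Lp_add uncond_sums_add[OF _ coef_sums _ coef_sums]] by simp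

lemma coef_cmult: "in_Lp p f \<Longrightarrow> i \<in> I \<Longrightarrow> coef (\<lambda>x. a * f x) i = a * coef f i"
  using coef_unique[OF in_Lp_cmult uncond_sums_cmult[OF coef_sums]] by simp

lemma coef_diff: "in_Lp p f \<Longrightarrow> in_Lp p h \<Longrightarrow> i \<in> I \<Longrightarrow> coef (\<lambda>x. f x - h x) i = coef f i - coef h i"
  using coef_add[of f "\<lambda>x. (-1) * h x" i] coef_cmult[of h i "-1"] in_Lp_cmult[of h "-1"] by simp

lemma coef_span:
  assumes "finite F" "F \<subseteq> I" "i \<in> I"
  shows "coef (\<lambda>x. \<Sum>i\<in>F. a i * u i x) i = (if i \<in> F then a i else 0)"
  using coef_unique[OF in_Lp_span uncond_sums_finite] assms by simp

lemma coef_0: "i \<in> I \<Longrightarrow> coef (\<lambda>x. 0) i = 0"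
  using coef_span[of "{}" i] by simp

lemma coef_scaled_sum:
  "(\<And>n. n \<in> J \<Longrightarrow> in_Lp p (f n)) \<Longrightarrow> i \<in> I \<Longrightarrow>
    coef (\<lambda>x. \<Sum>n\<in>J. a n * f n x) i = (\<Sum>n\<in>J. a n * coef (f n) i)"
proof (induction J rule: infinite_finite_induct)
  case (insert n J)
  then show ?case
    by (simp add: coef_add coef_cmult in_Lp_cmult in_Lp_scaled_sum)
qed (auto simp: coef_0)

lemma coef_sum:
  "(\<And>n. n \<in> J \<Longrightarrow> in_Lp p (f n)) \<Longrightarrow> i \<in> I \<Longrightarrow>
    coef (\<lambda>x. \<Sum>n\<in>J. f n x) i = (\<Sum>n\<in>J. coef (f n) i)"
  using coef_scaled_sum[of J f i "\<lambda>_. 1"] by simp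

text \<open>A basis vector of seminorm zero could be added to the expansion of 0 with coefficient 1,
  against uniqueness.\<close>

lemma norm_u_pos:
  assumes "i \<in> I"
  shows "0 < Lp_norm p (u i)"
proof (rule ccontr)
  assume "\<not> 0 < Lp_norm p (u i)"
  then have 0: "Lp_norm p (u i) = 0" using Lp_norm_nonneg[of "u i"] by linarith
  have "Lp_uncond_sums p u I (\<lambda>j. if j = i then 1 else 0) (\<lambda>x. 0)"
    unfolding Lp_uncond_sums_def
  proof (intro allI impI exI[of _ "{i}"] conjI)
    fix \<epsilon> :: real and F assume "0 < \<epsilon>" and F: "finite F \<and> {i} \<subseteq> F \<and> F \<subseteq> I"
    have "(\<Sum>j\<in>F. (if j = i then 1 else 0) * u j x) = u i x" for x
      using F by (simp add: if_distrib[of "\<lambda>z. z * _"] cong: if_cong)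
    then show "Lp_norm p (\<lambda>x. 0 - (\<Sum>j\<in>F. (if j = i then 1 else 0) * u j x)) < \<epsilon>"
      using 0 \<open>0 < \<epsilon>\<close> by (simp add: Lp_norm_minus)
  qed (use assms in auto)
  then show False using coef_unique[OF in_Lp_0 _ assms] coef_0[OF assms] by fastforce
qed

text \<open>The seminorm fed to \<open>Zabreiko\<close>: a bound for it by the original norm says
  that all partial-sum projections are uniformly bounded.\<close>

definition coef_norm :: "(real \<Rightarrow> complex) \<Rightarrow> real" where
  "coef_norm f = (SUP F\<in>{F. finite F \<and> F \<subseteq> I}. Lp_norm p (partial F f))"

text \<open>Enlarging F by the set \<open>F0\<close> of the convergence criterion with \<epsilon> =
  1 brings the partial sum within 1 of \<open>f\<close>. What was added lies in \<open>F0\<close>,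
  so its norm is bounded independently of F.\<close>

lemma partial_bounded:
  assumes "in_Lp p f"
  shows "bdd_above ((\<lambda>F. Lp_norm p (partial F f)) ` {F. finite F \<and> F \<subseteq> I})"
proof -
  obtain F0 where F0: "finite F0" "F0 \<subseteq> I"
    "\<And>F. finite F \<and> F0 \<subseteq> F \<and> F \<subseteq> I \<Longrightarrow> Lp_norm p (\<lambda>x. f x - partial F f x) < 1"
    using coef_sums[OF assms] unfolding Lp_uncond_sums_def by (meson zero_less_one)
  define B where "B = Lp_norm p f + 1 + (\<Sum>i\<in>F0. Lp_norm p (\<lambda>x. coef f i * u i x))"
  show ?thesis
  proof (rule bdd_aboveI2)
    fix F assume "F \<in> {F. finite F \<and> F \<subseteq> I}"
    then have F: "finite F" "F \<subseteq> I" by auto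
    have "(\<Sum>i\<in>F \<union> F0. coef f i * u i x) = (\<Sum>i\<in>F. coef f i * u i x) + (\<Sum>i\<in>F0 - F. coef f i * u i x)" for x
      using F F0 sum.union_disjoint[of F "F0 - F" "\<lambda>i. coef f i * u i x"] by (simp add: Un_Diff_cancel)
    then have "partial F f = (\<lambda>x. (f x - (f x - partial (F \<union> F0) f x)) - partial (F0 - F) f x)"
      by simp
    note arg_cong[where f="Lp_norm p", OF this]
    also have "Lp_norm p \<dots> \<le> Lp_norm p (\<lambda>x. f x - (f x - partial (F \<union> F0) f x)) + Lp_norm p (partial (F0 - F) f)"
      using F F0 assms by (intro Lp_norm_triangle_diff in_Lp_diff in_Lp_span) auto
    finally have "Lp_norm p (partial F f) \<le> Lp_norm p (\<lambda>x. f x - (f x - partial (F \<union> F0) f x)) + Lp_norm p (partial (F0 - F) f)" .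
    moreover have "Lp_norm p (\<lambda>x. f x - (f x - partial (F \<union> F0) f x))
        \<le> Lp_norm p f + Lp_norm p (\<lambda>x. f x - partial (F \<union> F0) f x)"
      using F F0 assms by (intro Lp_norm_triangle_diff in_Lp_diff in_Lp_span) auto
    moreover have "Lp_norm p (\<lambda>x. f x - partial (F \<union> F0) f x) \<le> 1"
      using F0 F by (intro less_imp_le F0(3)) auto
    moreover have "Lp_norm p (partial (F0 - F) f) \<le> (\<Sum>i\<in>F0 - F. Lp_norm p (\<lambda>x. coef f i * u i x))"
      using F0 by (intro Lp_norm_sum in_Lp_cmult u_Lp) auto
    moreover have "(\<Sum>i\<in>F0 - F. Lp_norm p (\<lambda>x. coef f i * u i x)) \<le> (\<Sum>i\<in>F0. Lp_norm p (\<lambda>x. coef f i * u i x))"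
      using F0 by (intro sum_mono2) auto
    ultimately show "Lp_norm p (partial F f) \<le> B" unfolding B_def by linarith
  qed
qed

lemma partial_le_coef_norm:
  "in_Lp p f \<Longrightarrow> finite F \<Longrightarrow> F \<subseteq> I \<Longrightarrow> Lp_norm p (partial F f) \<le> coef_norm f"
  unfolding coef_norm_def by (rule cSUP_upper[OF _ partial_bounded]) auto

lemma coef_norm_le:
  "(\<And>F. finite F \<Longrightarrow> F \<subseteq> I \<Longrightarrow> Lp_norm p (partial F f) \<le> B) \<Longrightarrow> coef_norm f \<le> B"
  unfolding coef_norm_def by (rule cSUP_least) auto

lemma coef_norm_nonneg: "in_Lp p f \<Longrightarrow> 0 \<le> coef_norm f"
  using partial_le_coef_norm[of f "{}"] by simp

lemma coef_le_coef_norm: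
  assumes "in_Lp p f" "i \<in> I"
  shows "cmod (coef f i) \<le> coef_norm f / Lp_norm p (u i)"
  using partial_le_coef_norm[OF assms(1), of "{i}"] assms norm_u_pos[OF assms(2)]
    Lp_norm_cmult[of "coef f i" "u i"]
  by (simp add: pos_le_divide_eq)

text \<open>The countable subadditivity needed by \<open>Zabreiko\<close>. The coefficients of the
  \<open>g j\<close> sum to some \<open>c\<close>; it has to be shown that \<open>c\<close> expands
  \<open>f\<close>, and then uniqueness identifies it with \<open>coef f\<close>. This replaces the
  closed-graph step.\<close>

lemma coef_norm_suminf:
  assumes f: "in_Lp p f" and g: "\<And>j. in_Lp p (g j)"
    and lim: "(\<lambda>n. Lp_norm p (\<lambda>x. f x - (\<Sum>j<n. g j x))) \<longlonglongrightarrow> 0"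
    and sm: "summable (\<lambda>j. coef_norm (g j))"
  shows "coef_norm f \<le> (\<Sum>j. coef_norm (g j))"
proof -
  define c where "c i = (\<Sum>j. coef (g j) i)" for i
  define T where "T n = (\<Sum>j. coef_norm (g (j + n)))" for n
  have c: "(\<lambda>j. coef (g j) i) sums c i" if i: "i \<in> I" for i
    unfolding c_def
  proof (rule summable_sums, rule summable_norm_cancel)
    show "summable (\<lambda>j. cmod (coef (g j) i))"
      by (rule summable_comparison_test'[OF summable_divide[OF sm, of "Lp_norm p (u i)"], of 0])
        (use coef_le_coef_norm[OF g i] in auto)
  qed
  \<comment> \<open>The bound is uniform in \<open>F\<close>. For fixed F the infinite tail is cut
    at a large m, at a cost of \<epsilon>, and the finite part is controlled term by term by
    \<open>coef_norm\<close>.\<close>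
  have partial_diff: "Lp_norm p (\<lambda>x. \<Sum>i\<in>F. (c i - (\<Sum>j<n. coef (g j) i)) * u i x) \<le> T n"
    if F: "finite F" "F \<subseteq> I" for F n
  proof (rule field_le_epsilon)
    fix \<epsilon> :: real assume \<epsilon>: "0 < \<epsilon>"
    define e where "e m i = c i - (\<Sum>j<m + n. coef (g j) i)" for m i
    have e0: "(\<lambda>m. e m i) \<longlonglongrightarrow> 0" if "i \<in> I" for i
      using tendsto_diff[OF tendsto_const[of "c i"] LIMSEQ_ignore_initial_segment[OF c[OF that, unfolded sums_def], of n]]
      by (simp add: e_def)
    have "(\<lambda>m. \<Sum>i\<in>F. cmod (e m i) * Lp_norm p (u i)) \<longlonglongrightarrow> (\<Sum>i\<in>F. 0 * Lp_norm p (u i))"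
      using F by (intro tendsto_sum tendsto_mult tendsto_const tendsto_norm_zero e0) auto
    then have "\<forall>\<^sub>F m in sequentially. (\<Sum>i\<in>F. cmod (e m i) * Lp_norm p (u i)) < \<epsilon>"
      using \<epsilon> by (intro order_tendstoD(2)) auto
    then obtain m where m: "(\<Sum>i\<in>F. cmod (e m i) * Lp_norm p (u i)) < \<epsilon>"
      by (auto simp: eventually_sequentially)
    have split: "(\<Sum>j<m + n. a j) = (\<Sum>j<n. a j) + (\<Sum>j<m. a (j + n))" for a :: "nat \<Rightarrow> complex"
      by (induction m) (simp_all add: add.assoc)
    have swap: "(\<Sum>j<m. partial F (g (j + n)) x) = (\<Sum>i\<in>F. (\<Sum>j<m. coef (g (j + n)) i) * u i x)" for x
      unfolding sum_distrib_right by (rule sum.swap)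
    have "(\<lambda>x. \<Sum>i\<in>F. (c i - (\<Sum>j<n. coef (g j) i)) * u i x)
      = (\<lambda>x. (\<Sum>i\<in>F. e m i * u i x) + (\<Sum>j<m. partial F (g (j + n)) x))"
      unfolding swap sum.distrib[symmetric] distrib_right[symmetric] by (simp add: e_def split)
    note arg_cong[where f="Lp_norm p", OF this]
    also have "Lp_norm p \<dots> \<le> Lp_norm p (\<lambda>x. \<Sum>i\<in>F. e m i * u i x) + Lp_norm p (\<lambda>x. \<Sum>j<m. partial F (g (j + n)) x)"
      using F by (intro Lp_norm_triangle in_Lp_sum in_Lp_span) auto
    finally have "Lp_norm p (\<lambda>x. \<Sum>i\<in>F. (c i - (\<Sum>j<n. coef (g j) i)) * u i x)
      \<le> Lp_norm p (\<lambda>x. \<Sum>i\<in>F. e m i * u i x) + Lp_norm p (\<lambda>x. \<Sum>j<m. partial F (g (j + n)) x)" .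
    moreover have "Lp_norm p (\<lambda>x. \<Sum>i\<in>F. e m i * u i x) \<le> (\<Sum>i\<in>F. Lp_norm p (\<lambda>x. e m i * u i x))"
      using F by (intro Lp_norm_sum in_Lp_cmult u_Lp) auto
    moreover have "(\<Sum>i\<in>F. Lp_norm p (\<lambda>x. e m i * u i x)) \<le> \<epsilon>"
      using m by (simp add: Lp_norm_cmult)
    moreover have "Lp_norm p (\<lambda>x. \<Sum>j<m. partial F (g (j + n)) x) \<le> (\<Sum>j<m. Lp_norm p (partial F (g (j + n))))"
      using F by (intro Lp_norm_sum in_Lp_span) auto
    moreover have "(\<Sum>j<m. Lp_norm p (partial F (g (j + n)))) \<le> (\<Sum>j<m. coef_norm (g (j + n)))"
      using F g by (intro sum_mono partial_le_coef_norm) auto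
    moreover have "(\<Sum>j<m. coef_norm (g (j + n))) \<le> T n"
      unfolding T_def using g
      by (intro sum_le_suminf summable_ignore_initial_segment[OF sm] coef_norm_nonneg) auto
    ultimately show "Lp_norm p (\<lambda>x. \<Sum>i\<in>F. (c i - (\<Sum>j<n. coef (g j) i)) * u i x) \<le> T n + \<epsilon>" by linarith
  qed
  have "Lp_uncond_sums p u I c f"
    unfolding Lp_uncond_sums_def
  proof (intro allI impI)
    fix \<epsilon> :: real assume \<epsilon>: "0 < \<epsilon>"
    have T0: "T \<longlonglongrightarrow> 0"
      unfolding T_def by (rule suminf_exist_split2[OF sm])
    have "\<forall>\<^sub>F n in sequentially. T n < \<epsilon> / 3 \<and> Lp_norm p (\<lambda>x. f x - (\<Sum>j<n. g j x)) < \<epsilon> / 3"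
      using order_tendstoD(2)[OF T0, of "\<epsilon> / 3"] order_tendstoD(2)[OF lim, of "\<epsilon> / 3"] \<epsilon>
      by (auto elim: eventually_elim2)
    then obtain n where n: "T n < \<epsilon> / 3" "Lp_norm p (\<lambda>x. f x - (\<Sum>j<n. g j x)) < \<epsilon> / 3"
      by (auto simp: eventually_sequentially)
    define h where "h = (\<lambda>x. \<Sum>j<n. g j x)"
    have fh: "Lp_norm p (\<lambda>x. f x - h x) < \<epsilon> / 3" using n by (simp add: h_def)
    have h: "in_Lp p h" unfolding h_def by (intro in_Lp_sum g)
    have "0 < \<epsilon> / 3" using \<epsilon> by simp
    from coef_sums[OF h, unfolded Lp_uncond_sums_def, THEN spec, THEN mp, OF this]
    obtain F0 where "finite F0 \<and> F0 \<subseteq> I \<and>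
        (\<forall>F. finite F \<and> F0 \<subseteq> F \<and> F \<subseteq> I \<longrightarrow> Lp_norm p (\<lambda>x. h x - partial F h x) < \<epsilon> / 3)"
      by (elim exE)
    then have F0: "finite F0" "F0 \<subseteq> I"
      "\<And>F. finite F \<and> F0 \<subseteq> F \<and> F \<subseteq> I \<Longrightarrow> Lp_norm p (\<lambda>x. h x - partial F h x) < \<epsilon> / 3"
      by simp_all
    show "\<exists>F0. finite F0 \<and> F0 \<subseteq> I \<and> (\<forall>F. finite F \<and> F0 \<subseteq> F \<and> F \<subseteq> I \<longrightarrow>
      Lp_norm p (\<lambda>x. f x - (\<Sum>i\<in>F. c i * u i x)) < \<epsilon>)"
    proof (intro exI[of _ F0] conjI allI impI F0(1,2))
      fix F assume F: "finite F \<and> F0 \<subseteq> F \<and> F \<subseteq> I"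
      define w where "w = (\<lambda>x. \<Sum>i\<in>F. (c i - (\<Sum>j<n. coef (g j) i)) * u i x)"
      have w: "in_Lp p w" unfolding w_def using F by (intro in_Lp_span) auto
      have "partial F h x = (\<Sum>i\<in>F. (\<Sum>j<n. coef (g j) i) * u i x)" for x
        using F coef_sum[of "{..<n}" g] g by (intro sum.cong) (auto simp: h_def)
      then have "(\<lambda>x. f x - (\<Sum>i\<in>F. c i * u i x)) = (\<lambda>x. ((f x - h x) + (h x - partial F h x)) - w x)"
        by (simp add: w_def left_diff_distrib sum_subtractf)
      note arg_cong[where f="Lp_norm p", OF this]
      also have "Lp_norm p \<dots> \<le> Lp_norm p (\<lambda>x. (f x - h x) + (h x - partial F h x)) + Lp_norm p w"
        using F by (intro Lp_norm_triangle_diff in_Lp_add in_Lp_diff f h w in_Lp_span) auto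
      finally have "Lp_norm p (\<lambda>x. f x - (\<Sum>i\<in>F. c i * u i x))
          \<le> Lp_norm p (\<lambda>x. (f x - h x) + (h x - partial F h x)) + Lp_norm p w" .
      moreover have "Lp_norm p (\<lambda>x. (f x - h x) + (h x - partial F h x))
          \<le> Lp_norm p (\<lambda>x. f x - h x) + Lp_norm p (\<lambda>x. h x - partial F h x)"
        using F by (intro Lp_norm_triangle in_Lp_diff f h in_Lp_span) auto
      ultimately show "Lp_norm p (\<lambda>x. f x - (\<Sum>i\<in>F. c i * u i x)) < \<epsilon>"
        using F0(3)[OF F] n(1) fh partial_diff[of F n, folded w_def] F by simp
    qed
  qed
  then have coef_f: "coef f i = c i" if "i \<in> I" for i using coef_unique[OF f] that by simp
  show ?thesis
  proof (rule coef_norm_le)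
    fix F assume F: "finite F" "F \<subseteq> I"
    have "partial F f = (\<lambda>x. \<Sum>i\<in>F. (c i - (\<Sum>j<0. coef (g j) i)) * u i x)"
      using F coef_f by (auto intro!: ext sum.cong)
    then show "Lp_norm p (partial F f) \<le> (\<Sum>j. coef_norm (g j))"
      using partial_diff[OF F, of 0] by (simp add: T_def)
  qed
qed

lemma unconditional_constant:
  obtains K where "1 \<le> K"
    "\<And>f F m. in_Lp p f \<Longrightarrow> finite F \<Longrightarrow> F \<subseteq> I \<Longrightarrow> (\<And>i. i \<in> F \<Longrightarrow> cmod (m i) \<le> 1) \<Longrightarrow>
      Lp_norm p (\<lambda>x. \<Sum>i\<in>F. m i * (coef f i * u i x)) \<le> K * Lp_norm p f"
proof -
  obtain K where K: "0 \<le> K" "\<And>f. in_Lp p f \<Longrightarrow> coef_norm f \<le> K * Lp_norm p f"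
  proof (rule Zabreiko[of coef_norm])
    fix f :: "real \<Rightarrow> complex" and a :: real assume f: "in_Lp p f" "0 \<le> a"
    show "coef_norm (\<lambda>x. of_real a * f x) \<le> a * coef_norm f"
    proof (rule coef_norm_le)
      fix F assume F: "finite F" "F \<subseteq> I"
      have "partial F (\<lambda>x. of_real a * f x) = (\<lambda>x. of_real a * partial F f x)"
        unfolding sum_distrib_left using F f
        by (auto intro!: ext sum.cong simp: coef_cmult)
      then show "Lp_norm p (partial F (\<lambda>x. of_real a * f x)) \<le> a * coef_norm f"
        using partial_le_coef_norm[OF f(1) F] f by (simp add: Lp_norm_cmult mult_left_mono)
    qed
  next
    fix f h assume fh: "in_Lp p f" "in_Lp p h"
    show "coef_norm (\<lambda>x. f x - h x) \<le> coef_norm f + coef_norm h"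
    proof (rule coef_norm_le)
      fix F assume F: "finite F" "F \<subseteq> I"
      have "partial F (\<lambda>x. f x - h x) = (\<lambda>x. partial F f x - partial F h x)"
        unfolding sum_subtractf[symmetric] using F fh
        by (auto intro!: ext sum.cong simp: coef_diff left_diff_distrib)
      note arg_cong[where f="Lp_norm p", OF this]
      also have "Lp_norm p \<dots> \<le> Lp_norm p (partial F f) + Lp_norm p (partial F h)"
        using F by (intro Lp_norm_triangle_diff in_Lp_span)
      also have "\<dots> \<le> coef_norm f + coef_norm h"
        using F fh by (intro add_mono partial_le_coef_norm)
      finally show "Lp_norm p (partial F (\<lambda>x. f x - h x)) \<le> coef_norm f + coef_norm h" .
    qed
  qed (use coef_norm_nonneg coef_norm_suminf in auto)
  show ?thesis
  \<comment> \<open>The 4 comes from complex multipliers; 1 is added to make the constant at least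
    1.\<close>
  proof (rule that[of "4 * K + 1"])
    fix f F and m :: "'i \<Rightarrow> complex"
    assume f: "in_Lp p f" and F: "finite F" "F \<subseteq> I" and m: "\<And>i. i \<in> F \<Longrightarrow> cmod (m i) \<le> 1"
    have "Lp_norm p (\<lambda>x. \<Sum>i\<in>F. m i * (coef f i * u i x)) \<le> 4 * (K * Lp_norm p f)"
    proof (rule Lp_norm_complex_multiplier[OF F(1)])
      fix A assume "A \<subseteq> F"
      then have "Lp_norm p (partial A f) \<le> coef_norm f"
        using F f by (intro partial_le_coef_norm) (auto intro: finite_subset)
      then show "Lp_norm p (partial A f) \<le> K * Lp_norm p f" using K(2)[OF f] by linarith
    qed (use F m u_Lp in_Lp_cmult in auto)
    then show "Lp_norm p (\<lambda>x. \<Sum>i\<in>F. m i * (coef f i * u i x)) \<le> (4 * K + 1) * Lp_norm p f"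
      by (simp add: distrib_right add_increasing2)
  qed (use K in auto)
qed

end

section \<open>Gabor systems: block estimates\<close>

text \<open>Jensen on an interval of length L: the graph of \<open>y powr r\<close> lies above its
  tangent at the mean m, and integrating the tangent inequality gives the claim. The indicator keeps
  the constant term integrable.\<close>

lemma powr_integral_le:
  fixes Y :: "real \<Rightarrow> real"
  assumes r: "1 < r" and ab: "a < b" and Y0: "\<And>x. 0 \<le> Y x" and supp: "\<And>x. x \<notin> {a..b} \<Longrightarrow> Y x = 0"
    and int: "integrable lborel Y" "integrable lborel (\<lambda>x. Y x powr r)"
  shows "(\<integral>x. Y x \<partial>lborel) powr r \<le> (b - a) powr (r - 1) * (\<integral>x. Y x powr r \<partial>lborel)"
proof -
  define L where "L = b - a"
  define m where "m = (\<integral>x. Y x \<partial>lborel) / L"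
  have L: "0 < L" using ab by (simp add: L_def)
  have m: "0 \<le> m" using L Y0 by (simp add: m_def)
  have tangent: "r * m powr (r - 1) * Y x - (r - 1) * m powr r * indicator {a..b} x \<le> Y x powr r" for x
  proof (cases "x \<in> {a..b}")
    case True
    \<comment> \<open>Young's inequality with the conjugate exponent \<open>r / (r - 1)\<close> is
      the tangent inequality at m.\<close>
    have "Y x * m powr (r - 1) \<le> Y x powr r / r + (m powr (r - 1)) powr (r / (r - 1)) / (r / (r - 1))"
      using r Y0[of x] by (intro Youngs_inequality) (auto simp: field_simps)
    then have "r * (Y x * m powr (r - 1)) \<le> r * (Y x powr r / r + (m powr (r - 1)) powr (r / (r - 1)) / (r / (r - 1)))"
      using r by (intro mult_left_mono) auto
    also have "(m powr (r - 1)) powr (r / (r - 1)) = m powr r"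
      using r by (simp add: powr_powr)
    also have "r * (Y x powr r / r + m powr r / (r / (r - 1))) = Y x powr r + (r - 1) * m powr r"
      using r by (simp add: distrib_left)
    finally show ?thesis using True by (simp add: algebra_simps)
  next
    case False
    then show ?thesis using supp[OF False] r by simp
  qed
  have ind: "integrable lborel (indicator {a..b} :: real \<Rightarrow> real)" "(\<integral>x. indicator {a..b} x \<partial>lborel) = L"
    using ab by (auto simp: L_def)
  have "(\<integral>x. r * m powr (r - 1) * Y x - (r - 1) * m powr r * indicator {a..b} x \<partial>lborel)
      \<le> (\<integral>x. Y x powr r \<partial>lborel)"
    by (intro integral_mono tangent Bochner_Integration.integrable_diff integrable_mult_right ind int)
  moreover have "(\<integral>x. r * m powr (r - 1) * Y x - (r - 1) * m powr r * indicator {a..b} x \<partial>lborel)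
      = r * m powr (r - 1) * (m * L) - (r - 1) * m powr r * L"
    unfolding Bochner_Integration.integral_diff[OF integrable_mult_right[OF int(1)] integrable_mult_right[OF ind(1)]]
      integral_mult_right_zero ind(2) using L by (simp add: m_def)
  moreover have "m powr (r - 1) * m = m powr r"
    using m r by (cases "m = 0") (auto simp: powr_diff)
  then have "r * m powr (r - 1) * (m * L) = r * (m powr r * L)" by (simp add: mult_ac)
  ultimately have "r * (m powr r * L) - (r - 1) * m powr r * L \<le> (\<integral>x. Y x powr r \<partial>lborel)"
    by linarith
  then have "m powr r * L \<le> (\<integral>x. Y x powr r \<partial>lborel)"
    by (simp add: algebra_simps)
  then have "L powr (r - 1) * (m powr r * L) \<le> L powr (r - 1) * (\<integral>x. Y x powr r \<partial>lborel)"
    by (intro mult_left_mono) auto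
  moreover have "L powr (r - 1) * (m powr r * L) = (\<integral>x. Y x \<partial>lborel) powr r"
    using L Y0 by (simp add: m_def powr_divide powr_diff)
  ultimately show ?thesis by (simp add: L_def)
qed

text \<open>Characters have modulus 1, so square functions see a Gabor system only through its
  translations; hence blocks need only depend on \<open>fst l\<close>.\<close>

lemma cmod_gabor: "cmod (gabor h l x) = cmod (h (x - fst l))"
  by (simp add: gabor_def modul_char_def transl_def norm_mult split: prod.split)

lemma gabor_diff: "gabor (\<lambda>y. f y - h y) l = (\<lambda>x. gabor f l x - gabor h l x)"
  by (simp add: gabor_def transl_def right_diff_distrib split: prod.split)

context Lp_exponent
begin

lemma in_Lp_gabor:
  assumes "in_Lp p h"
  shows "in_Lp p (gabor h l)"
proof -
  have [measurable]: "h \<in> borel_measurable borel" using assms by (simp add: in_Lp_def)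
  have "gabor h l \<in> borel_measurable borel"
    unfolding gabor_def modul_char_def transl_def by (cases l) simp
  moreover have "integrable lborel (\<lambda>x. cmod (h (- fst l + 1 * x)) powr p)"
    using assms by (intro lborel_integrable_real_affine) (auto simp: in_Lp_def)
  ultimately show ?thesis by (simp add: in_Lp_def cmod_gabor)
qed

lemma Lp_norm_gabor: "Lp_norm p (gabor h l) = Lp_norm p h"
  using lborel_integral_real_affine[of 1 "\<lambda>x. cmod (h x) powr p" "- fst l"]
  by (simp add: Lp_norm_def cmod_gabor)

lemma Lp_norm_tail:
  assumes "in_Lp p f" "0 < \<epsilon>"
  obtains R where "0 < R" "Lp_norm p (\<lambda>x. if \<bar>x\<bar> \<le> R then 0 else f x) < \<epsilon>"
proof -
  have [measurable]: "f \<in> borel_measurable borel" using assms by (simp add: in_Lp_def)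
  define F where "F n = (\<lambda>x. if \<bar>x\<bar> \<le> real n then 0 else f x)" for n
  have "(\<lambda>n. \<integral>x. cmod (F n x) powr p \<partial>lborel) \<longlonglongrightarrow> (\<integral>x. 0 \<partial>(lborel :: real measure))"
  proof (rule integral_dominated_convergence[where w="\<lambda>x. cmod (f x) powr p"])
    show "AE x in lborel. (\<lambda>n. cmod (F n x) powr p) \<longlonglongrightarrow> 0"
    proof (rule AE_I2, rule tendsto_eventually)
      fix x :: real
      show "\<forall>\<^sub>F n in sequentially. cmod (F n x) powr p = 0"
        using eventually_ge_at_top[of "nat \<lceil>\<bar>x\<bar>\<rceil>"]
      proof eventually_elim
        fix n assume "nat \<lceil>\<bar>x\<bar>\<rceil> \<le> n"
        then have "\<bar>x\<bar> \<le> real n" by linarith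
        then show "cmod (F n x) powr p = 0" by (simp add: F_def)
      qed
    qed
  qed (use assms in \<open>auto simp: F_def in_Lp_def\<close>)
  then have "\<forall>\<^sub>F n in sequentially. (\<integral>x. cmod (F n x) powr p \<partial>lborel) < (\<epsilon> / 2) powr p"
    using assms by (intro order_tendstoD(2)) auto
  then obtain n where n: "(\<integral>x. cmod (F n x) powr p \<partial>lborel) < (\<epsilon> / 2) powr p" "1 \<le> n"
    using eventually_conj[OF _ eventually_ge_at_top[of 1]] by (metis (no_types, lifting) eventually_sequentially order_refl)
  then have "Lp_norm p (F n) \<le> \<epsilon> / 2"
    using assms by (subst Lp_norm_le_iff) auto
  then show ?thesis using that[of "real n"] n assms by (simp add: F_def)
qed

end

lemma sum_filter_blocks:
  fixes z :: "'l \<Rightarrow> real"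
  assumes "finite F" "finite S" "\<And>l. l \<in> F \<Longrightarrow> 0 \<le> z l"
  shows "(\<Sum>k\<in>S. \<Sum>l\<in>{l \<in> F. b l = k}. z l) \<le> (\<Sum>l\<in>F. z l)"
proof -
  have "(\<Sum>k\<in>S. \<Sum>l\<in>{l \<in> F. b l = k}. z l) = (\<Sum>l\<in>{l \<in> F. b l \<in> S}. z l)"
    using sum.group[of "{l \<in> F. b l \<in> S}" S b z] assms
    by (simp add: image_subset_iff conj_commute cong: conj_cong)
  also have "\<dots> \<le> (\<Sum>l\<in>F. z l)"
    using assms by (intro sum_mono2) auto
  finally show ?thesis .
qed

text \<open>\<open>K\<close> is the unconditional constant, and R is so large that cutting the
  window off outside [-R, R] costs less than half its norm even after multiplication by
  \<open>K\<close>. This yields both \<open>mass_pos\<close> and the lower bound 1/2 for the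
  diagonal coefficients.\<close>

locale gabor_basis = Lp_basis p "gabor g" \<Lambda>
  for p :: real and g :: "real \<Rightarrow> complex" and \<Lambda> :: "(real \<times> real) set" +
  fixes K R :: real
  assumes p_gt_2: "2 < p" and g_Lp: "in_Lp p g" and g_pos: "0 < Lp_norm p g"
    and K_ge_1: "1 \<le> K"
    and K: "\<And>f F m. in_Lp p f \<Longrightarrow> finite F \<Longrightarrow> F \<subseteq> \<Lambda> \<Longrightarrow> (\<And>l. l \<in> F \<Longrightarrow> cmod (m l) \<le> 1) \<Longrightarrow>
      Lp_norm p (\<lambda>x. \<Sum>l\<in>F. m l * (coef f l * gabor g l x)) \<le> K * Lp_norm p f"
    and R_pos: "0 < R"
    and tail: "K * Lp_norm p (\<lambda>x. if \<bar>x\<bar> \<le> R then 0 else g x) < Lp_norm p g / 2"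
begin

definition trunc :: "real \<Rightarrow> complex" where
  "trunc x = (if \<bar>x\<bar> \<le> R then g x else 0)"

definition blk :: "real \<times> real \<Rightarrow> int" where
  "blk l = \<lfloor>fst l / R\<rfloor>"

lemma g_measurable [measurable]: "g \<in> borel_measurable borel"
  using g_Lp by (simp add: in_Lp_def)

lemma trunc_measurable [measurable]: "trunc \<in> borel_measurable borel"
  unfolding trunc_def[abs_def] by measurable

lemma trunc_Lp: "in_Lp p trunc"
  by (rule in_Lp_mono[OF g_Lp, where C=1]) (auto simp: trunc_def)

text \<open>Blocks are as wide as the truncation radius, so at each point only three of them are
  visible through the truncated window.\<close>

lemma near_block:
  assumes "\<bar>x - fst l\<bar> \<le> R"
  shows "blk l \<in> {\<lfloor>x / R\<rfloor> - 1, \<lfloor>x / R\<rfloor>, \<lfloor>x / R\<rfloor> + 1}"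
proof -
  have "\<bar>x / R - fst l / R\<bar> \<le> 1"
    using assms R_pos by (simp flip: diff_divide_distrib)
  then show ?thesis unfolding blk_def insert_iff empty_iff by linarith
qed

text \<open>Jensen with the weights \<open>(cmod (c l))\<^sup>2\<close> replaces the square function
  by a weighted sum of translates of \<open>cmod h powr p\<close>, all with the same
  integral.\<close>

lemma square_fun_block_le:
  assumes "finite F" "in_Lp p h"
  shows "(\<integral>x. square_fun F (\<lambda>l x. c l * gabor h l x) x \<partial>lborel)
    \<le> (\<Sum>l\<in>F. (cmod (c l))\<^sup>2) powr (p / 2) * Lp_norm p h powr p"
proof -
  define W where "W = (\<Sum>l\<in>F. (cmod (c l))\<^sup>2)"
  have W: "0 \<le> W" by (simp add: W_def sum_nonneg)
  have sq: "(cmod (h y))\<^sup>2 powr (p / 2) = cmod (h y) powr p" for y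
    by (simp add: powr_powr flip: powr_numeral)
  have int: "integrable lborel (\<lambda>x. cmod (gabor h l x) powr p)" for l
    using in_Lp_gabor[OF assms(2), of l] by (simp add: in_Lp_def)
  have pw: "square_fun F (\<lambda>l x. c l * gabor h l x) x
      \<le> W powr (p / 2 - 1) * (\<Sum>l\<in>F. (cmod (c l))\<^sup>2 * cmod (gabor h l x) powr p)" for x
    using powr_sum_le[of "p / 2" F "\<lambda>l. (cmod (c l))\<^sup>2" "\<lambda>l. (cmod (gabor h l x))\<^sup>2"] assms p_gt_2
    by (simp add: square_fun_def norm_mult power_mult_distrib W_def cmod_gabor sq)
  have "(\<integral>x. square_fun F (\<lambda>l x. c l * gabor h l x) x \<partial>lborel)
      \<le> (\<integral>x. W powr (p / 2 - 1) * (\<Sum>l\<in>F. (cmod (c l))\<^sup>2 * cmod (gabor h l x) powr p) \<partial>lborel)"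
    using p_gt_2 assms int by (intro integral_mono pw integrable_square_fun in_Lp_cmult in_Lp_gabor) auto
  also have "\<dots> = W powr (p / 2 - 1) * (\<Sum>l\<in>F. (cmod (c l))\<^sup>2 * (\<integral>x. cmod (gabor h l x) powr p \<partial>lborel))"
    using int by simp
  also have "\<dots> = W powr (p / 2 - 1) * (W * Lp_norm p h powr p)"
    by (simp add: Lp_norm_powr[symmetric] Lp_norm_gabor W_def sum_distrib_right)
  also have "\<dots> = W powr (p / 2) * Lp_norm p h powr p"
    using W by (cases "W = 0") (auto simp: powr_diff)
  finally show ?thesis by (simp add: W_def)
qed

definition mass :: real where
  "mass = (\<integral>x. (cmod (trunc x))\<^sup>2 \<partial>lborel)"

text \<open>On the bounded support the square is at most \<open>1 + cmod (trunc x) powr p\<close>,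
  because p > 2.\<close>

lemma integrable_trunc_square: "integrable lborel (\<lambda>x. (cmod (trunc x))\<^sup>2)"
proof (rule Bochner_Integration.integrable_bound)
  show "integrable lborel (\<lambda>x. indicator {-R..R} x + cmod (trunc x) powr p)"
    using trunc_Lp R_pos by (intro Bochner_Integration.integrable_add) (auto simp: in_Lp_def)
  show "AE x in lborel. norm ((cmod (trunc x))\<^sup>2) \<le> norm (indicator {-R..R} x + cmod (trunc x) powr p)"
  proof (rule AE_I2)
    fix x
    show "norm ((cmod (trunc x))\<^sup>2) \<le> norm (indicator {-R..R} x + cmod (trunc x) powr p)"
    proof (cases "\<bar>x\<bar> \<le> R \<and> 1 < cmod (trunc x)")
      case True
      then have "(cmod (trunc x))\<^sup>2 = cmod (trunc x) powr 2" by simp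
      also have "\<dots> \<le> cmod (trunc x) powr p" using True p_gt_2 by (intro powr_mono) auto
      finally show ?thesis by (simp add: indicator_def)
    next
      case False
      show ?thesis
      proof (cases "\<bar>x\<bar> \<le> R")
        case True
        then have "(cmod (trunc x))\<^sup>2 \<le> 1" using False by (simp add: power_le_one)
        then show ?thesis using True by (simp add: abs_le_iff indicator_def add_increasing2)
      qed (simp add: trunc_def)
    qed
  qed
qed measurable

text \<open>Otherwise \<open>g\<close> would equal its own tail almost everywhere, which the choice
  of R forbids since \<open>K \<ge> 1\<close>.\<close>

lemma mass_pos: "0 < mass"
proof (rule ccontr)
  assume "\<not> 0 < mass"
  then have "mass = 0" unfolding mass_def
    by (metis (no_types, lifting) Bochner_Integration.integral_nonneg order_less_le zero_le_power2)
  then have "AE x in lborel. (cmod (trunc x))\<^sup>2 = 0"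
    unfolding mass_def using integrable_trunc_square by (subst (asm) integral_nonneg_eq_0_iff_AE) auto
  then have "AE x in lborel. g x = (if \<bar>x\<bar> \<le> R then 0 else g x)"
    by eventually_elim (simp add: trunc_def split: if_splits)
  moreover have "in_Lp p (\<lambda>x. if \<bar>x\<bar> \<le> R then 0 else g x)"
    by (rule in_Lp_mono[OF g_Lp, where C=1]) auto
  ultimately have "Lp_norm p g = Lp_norm p (\<lambda>x. if \<bar>x\<bar> \<le> R then 0 else g x)"
    using g_Lp by (intro Lp_norm_cong_AE)
  then have "K * Lp_norm p g < Lp_norm p g / 2" using tail by simp
  moreover have "1 * Lp_norm p g \<le> K * Lp_norm p g" using K_ge_1 g_pos by (intro mult_right_mono) auto
  ultimately show False using g_pos by simp
qed

text \<open>The truncated translates of one block live on a common bounded interval, so Jensen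
  bounds their integrated square sum, \<open>mass\<close> times the coefficient sum. Passing from
  \<open>trunc\<close> back to \<open>g\<close> only enlarges the square function.\<close>

lemma square_fun_block_ge:
  assumes F: "finite F" "\<And>l. l \<in> F \<Longrightarrow> blk l = k"
  shows "mass powr (p / 2) * (\<Sum>l\<in>F. (cmod (c l))\<^sup>2) powr (p / 2)
    \<le> (3 * R) powr (p / 2 - 1) * (\<integral>x. square_fun F (\<lambda>l x. c l * gabor g l x) x \<partial>lborel)"
proof -
  define Y where "Y x = (\<Sum>l\<in>F. (cmod (c l * gabor trunc l x))\<^sup>2)" for x
  have Yr: "Y x powr (p / 2) = square_fun F (\<lambda>l x. c l * gabor trunc l x) x" for x
    by (simp add: Y_def square_fun_def)
  have Lp: "in_Lp p (\<lambda>x. c l * gabor trunc l x)" "in_Lp p (\<lambda>x. c l * gabor g l x)" for l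
    by (intro in_Lp_cmult in_Lp_gabor trunc_Lp g_Lp)+
  have sh: "integrable lborel (\<lambda>x. (cmod (trunc (- t + 1 * x)))\<^sup>2)"
    "(\<integral>x. (cmod (trunc (- t + 1 * x)))\<^sup>2 \<partial>lborel) = mass" for t
    using lborel_integrable_real_affine[OF integrable_trunc_square, of 1 "-t"]
      lborel_integral_real_affine[of 1 "\<lambda>x. (cmod (trunc x))\<^sup>2" "-t"]
    by (simp_all add: mass_def)
  then have sh: "integrable lborel (\<lambda>x. (cmod (trunc (x - t)))\<^sup>2)"
    "(\<integral>x. (cmod (trunc (x - t)))\<^sup>2 \<partial>lborel) = mass" for t
    by (simp_all add: algebra_simps)
  have Yint: "integrable lborel Y" "(\<integral>x. Y x \<partial>lborel) = mass * (\<Sum>l\<in>F. (cmod (c l))\<^sup>2)"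
    unfolding Y_def norm_mult power_mult_distrib cmod_gabor using sh
    by (auto simp: sum_distrib_left mult.commute)
  \<comment> \<open>Translations in the block fill an interval of length R, and the window adds R on
    either side: total length \<open>3 * R\<close>.\<close>
  have supp: "Y x = 0" if "x \<notin> {(of_int k - 1) * R .. (of_int k + 2) * R}" for x
    unfolding Y_def
  proof (rule sum.neutral, rule ballI)
    fix l assume l: "l \<in> F"
    have "of_int k \<le> fst l / R" "fst l / R < of_int k + 1"
      using F(2)[OF l] unfolding blk_def by linarith+
    then have "of_int k * R \<le> fst l" "fst l < (of_int k + 1) * R"
      using R_pos by (simp_all add: field_simps)
    then have "\<not> \<bar>x - fst l\<bar> \<le> R" using that by (auto simp: algebra_simps)
    then show "(cmod (c l * gabor trunc l x))\<^sup>2 = 0"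
      by (simp add: norm_mult cmod_gabor trunc_def)
  qed
  have "mass powr (p / 2) * (\<Sum>l\<in>F. (cmod (c l))\<^sup>2) powr (p / 2) = (\<integral>x. Y x \<partial>lborel) powr (p / 2)"
    using mass_pos by (simp add: Yint powr_mult sum_nonneg)
  also have "\<dots> \<le> ((of_int k + 2) * R - (of_int k - 1) * R) powr (p / 2 - 1) * (\<integral>x. Y x powr (p / 2) \<partial>lborel)"
  proof (rule powr_integral_le)
    show "integrable lborel (\<lambda>x. Y x powr (p / 2))"
      unfolding Yr using p_gt_2 F Lp by (intro integrable_square_fun) auto
    show "(of_int k - 1) * R < (of_int k + 2) * R" using R_pos by (intro mult_strict_right_mono) auto
    show "0 \<le> Y x" for x by (simp add: Y_def sum_nonneg)
  qed (use p_gt_2 supp Yint in auto)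
  also have "(of_int k + 2) * R - (of_int k - 1) * R = 3 * R" by (simp add: algebra_simps)
  also have "(\<integral>x. Y x powr (p / 2) \<partial>lborel) \<le> (\<integral>x. square_fun F (\<lambda>l x. c l * gabor g l x) x \<partial>lborel)"
    unfolding Yr
  proof (intro integral_mono integrable_square_fun Lp F)
    fix x
    show "square_fun F (\<lambda>l x. c l * gabor trunc l x) x \<le> square_fun F (\<lambda>l x. c l * gabor g l x) x"
      unfolding square_fun_def using p_gt_2
      by (intro powr_mono2 sum_mono power_mono sum_nonneg) (auto simp: norm_mult cmod_gabor trunc_def mult_left_mono)
  qed (use p_gt_2 in auto)
  finally show ?thesis using R_pos by (simp add: mult_left_mono)
qed

text \<open>Superadditivity puts the block estimates under one integral, then Khinchine and the
  constant \<open>K\<close> return to \<open>f\<close>. The bound is uniform in \<open>F\<close> and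
  \<open>S\<close>, so that later \<open>F\<close> may exhaust \<Lambda>.\<close>

lemma coef_blocks_le:
  obtains C where "0 < C" "\<And>f F S. in_Lp p f \<Longrightarrow> finite F \<Longrightarrow> F \<subseteq> \<Lambda> \<Longrightarrow> finite S \<Longrightarrow>
    (\<Sum>k\<in>S. (\<Sum>l\<in>{l \<in> F. blk l = k}. (cmod (coef f l))\<^sup>2) powr (p / 2)) \<le> C * Lp_norm p f powr p"
proof -
  define B where "B = (3 * R) powr (p / 2 - 1) / mass powr (p / 2)"
  have B: "0 < B" using R_pos mass_pos by (simp add: B_def)
  show ?thesis
  proof (rule that[of "B * K powr p"])
    show "0 < B * K powr p" using B K_ge_1 by simp
    fix f F and S :: "int set"
    assume f: "in_Lp p f" and F: "finite F" "F \<subseteq> \<Lambda>" and S: "finite S"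
    define w where "w = (\<lambda>l x. coef f l * gabor g l x)"
    have w: "in_Lp p (w l)" for l unfolding w_def by (intro in_Lp_cmult in_Lp_gabor g_Lp)
    have sqi: "integrable lborel (square_fun G w)" if "G \<subseteq> F" for G
      using that F p_gt_2 w by (intro integrable_square_fun) (auto intro: finite_subset)
    have "(\<Sum>k\<in>S. (\<Sum>l\<in>{l \<in> F. blk l = k}. (cmod (coef f l))\<^sup>2) powr (p / 2))
        \<le> (\<Sum>k\<in>S. B * (\<integral>x. square_fun {l \<in> F. blk l = k} w x \<partial>lborel))"
    proof (rule sum_mono)
      fix k
      define G where "G = {l \<in> F. blk l = k}"
      have G: "finite G" "\<And>l. l \<in> G \<Longrightarrow> blk l = k" using F by (auto simp: G_def)
      have M: "0 < mass powr (p / 2)" using mass_pos by simp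
      have "(\<Sum>l\<in>G. (cmod (coef f l))\<^sup>2) powr (p / 2)
          = mass powr (p / 2) * (\<Sum>l\<in>G. (cmod (coef f l))\<^sup>2) powr (p / 2) / mass powr (p / 2)"
        using M by simp
      also have "\<dots> \<le> (3 * R) powr (p / 2 - 1) * (\<integral>x. square_fun G w x \<partial>lborel) / mass powr (p / 2)"
        unfolding w_def using M by (intro divide_right_mono square_fun_block_ge[OF G]) auto
      finally show "(\<Sum>l\<in>{l \<in> F. blk l = k}. (cmod (coef f l))\<^sup>2) powr (p / 2)
          \<le> B * (\<integral>x. square_fun {l \<in> F. blk l = k} w x \<partial>lborel)"
        by (simp add: B_def G_def)
    qed
    also have "\<dots> = B * (\<integral>x. (\<Sum>k\<in>S. square_fun {l \<in> F. blk l = k} w x) \<partial>lborel)"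
      using sqi by (simp add: sum_distrib_left)
    also have "(\<integral>x. (\<Sum>k\<in>S. square_fun {l \<in> F. blk l = k} w x) \<partial>lborel) \<le> (\<integral>x. square_fun F w x \<partial>lborel)"
    proof (intro integral_mono Bochner_Integration.integrable_sum sqi)
      fix x
      have "(\<Sum>k\<in>S. square_fun {l \<in> F. blk l = k} w x)
          \<le> (\<Sum>k\<in>S. \<Sum>l\<in>{l \<in> F. blk l = k}. (cmod (w l x))\<^sup>2) powr (p / 2)"
        unfolding square_fun_def using p_gt_2 S by (intro sum_powr_le_powr_sum sum_nonneg) auto
      also have "\<dots> \<le> square_fun F w x"
        unfolding square_fun_def using p_gt_2 S F
        by (intro powr_mono2 sum_filter_blocks sum_nonneg) auto
      finally show "(\<Sum>k\<in>S. square_fun {l \<in> F. blk l = k} w x) \<le> square_fun F w x" .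
    qed auto
    also have "(\<integral>x. square_fun F w x \<partial>lborel)
        \<le> ravg F (\<lambda>s. Lp_norm p (\<lambda>x. \<Sum>l\<in>F. of_real (s l) * w l x) powr p)"
      using p_gt_2 F w by (intro integral_square_fun_le) auto
    also have "\<dots> \<le> ravg F (\<lambda>s. (K * Lp_norm p f) powr p)"
      using p_gt_2 K[OF f F] unfolding w_def by (intro ravg_mono powr_mono2) auto
    also have "\<dots> = K powr p * Lp_norm p f powr p"
      using F K_ge_1 by (simp add: powr_mult)
    finally show "(\<Sum>k\<in>S. (\<Sum>l\<in>{l \<in> F. blk l = k}. (cmod (coef f l))\<^sup>2) powr (p / 2))
        \<le> B * K powr p * Lp_norm p f powr p"
      using B by (simp add: mult_left_mono)
  qed
qed

text \<open>At a fixed point at most three blocks are nonzero, so the power of the sum over blocks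
  costs only the factor \<open>3 powr (p / 2 - 1)\<close>.\<close>

lemma square_fun_trunc_le:
  assumes F: "finite F"
  shows "square_fun F (\<lambda>l x. c l * gabor trunc l x) x
    \<le> 3 powr (p / 2 - 1) * (\<Sum>k\<in>blk ` F. square_fun {l \<in> F. blk l = k} (\<lambda>l x. c l * gabor g l x) x)"
proof -
  define z where "z l = (cmod (c l * gabor trunc l x))\<^sup>2" for l
  define N where "N = {\<lfloor>x / R\<rfloor> - 1, \<lfloor>x / R\<rfloor>, \<lfloor>x / R\<rfloor> + 1}"
  have far: "z l = 0" if "blk l \<notin> N" for l
  proof -
    have "\<not> \<bar>x - fst l\<bar> \<le> R" using near_block[of x l] that unfolding N_def by blast
    then show ?thesis by (simp add: z_def norm_mult cmod_gabor trunc_def)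
  qed
  have "card N \<le> 3" unfolding N_def by (intro card_insert_le_m1) auto
  moreover have "card (blk ` F \<inter> N) \<le> card N" by (intro card_mono) (auto simp: N_def)
  ultimately have card: "card (blk ` F \<inter> N) \<le> 3" by simp
  have "(\<Sum>l\<in>F. z l) = (\<Sum>k\<in>blk ` F. \<Sum>l\<in>{l \<in> F. blk l = k}. z l)"
    by (rule sum.image_gen[OF F])
  also have "\<dots> = (\<Sum>k\<in>blk ` F \<inter> N. \<Sum>l\<in>{l \<in> F. blk l = k}. z l)"
    using F far by (intro sum.mono_neutral_right) (auto intro!: sum.neutral)
  finally have "square_fun F (\<lambda>l x. c l * gabor trunc l x) x
      = (\<Sum>k\<in>blk ` F \<inter> N. \<Sum>l\<in>{l \<in> F. blk l = k}. z l) powr (p / 2)"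
    by (simp add: square_fun_def z_def)
  also have "\<dots> \<le> real 3 powr (p / 2 - 1) * (\<Sum>k\<in>blk ` F \<inter> N. (\<Sum>l\<in>{l \<in> F. blk l = k}. z l) powr (p / 2))"
    using p_gt_2 F card by (intro powr_sum_le_card sum_nonneg) (auto simp: z_def)
  also have "\<dots> \<le> real 3 powr (p / 2 - 1) * (\<Sum>k\<in>blk ` F. (\<Sum>l\<in>{l \<in> F. blk l = k}. z l) powr (p / 2))"
    using F by (intro mult_left_mono sum_mono2) auto
  also have "\<dots> \<le> real 3 powr (p / 2 - 1) * (\<Sum>k\<in>blk ` F. square_fun {l \<in> F. blk l = k} (\<lambda>l x. c l * gabor g l x) x)"
    unfolding square_fun_def z_def using p_gt_2
    by (intro mult_left_mono sum_mono powr_mono2 power_mono sum_nonneg)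
      (auto simp: norm_mult cmod_gabor trunc_def mult_left_mono)
  finally show ?thesis by simp
qed

text \<open>With \<open>d\<^sub>\<lambda>\<close> the diagonal coefficients of the truncation operator, \<open>\<Sum> d\<^sub>\<lambda> a\<^sub>\<lambda> u\<^sub>\<lambda>\<close> is an average
  over signs of \<open>E s\<close>, because the off-diagonal coefficients are averaged out by orthogonality; and
  \<open>|d\<^sub>\<lambda>| \<ge> 1/2\<close> by the choice of \<open>R\<close>.\<close>

lemma span_norm_le_truncated:
  assumes F: "finite F" "F \<subseteq> \<Lambda>"
  shows "Lp_norm p (\<lambda>x. \<Sum>l\<in>F. a l * gabor g l x) powr p
    \<le> (2 * K * K) powr p *
      ravg F (\<lambda>s. Lp_norm p (\<lambda>x. \<Sum>l\<in>F. of_real (s l) * (a l * gabor trunc l x)) powr p)"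
proof -
  define d where "d l = coef (gabor trunc l) l" for l
  have vL: "in_Lp p (gabor trunc l)" for l by (intro in_Lp_gabor trunc_Lp)
  \<comment> \<open>\<open>1 - d l\<close> is the coefficient at \<open>l\<close> of the part cut
    off from the atom itself; the one-element case of \<open>K\<close> bounds it by \<open>K\<close>
    times the tail over the norm of \<open>g\<close>.\<close>
  have d: "1 / 2 \<le> cmod (d l)" if l: "l \<in> F" for l
  proof -
    define h where "h = (\<lambda>x. gabor g l x - gabor trunc l x)"
    have lL: "l \<in> \<Lambda>" using l F by auto
    have h: "in_Lp p h" unfolding h_def by (intro in_Lp_diff in_Lp_gabor g_Lp trunc_Lp)
    have "coef (gabor g l) l = 1"
      using coef_span[of "{l}" l "\<lambda>_. 1"] lL by simp
    then have ch: "coef h l = 1 - d l"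
      unfolding h_def d_def using coef_diff[OF in_Lp_gabor[OF g_Lp] vL lL] by simp
    have "Lp_norm p (\<lambda>x. \<Sum>l\<in>{l}. 1 * (coef h l * gabor g l x)) \<le> K * Lp_norm p h"
      using lL by (intro K h) auto
    then have "cmod (1 - d l) * Lp_norm p g \<le> K * Lp_norm p h"
      by (simp add: ch Lp_norm_cmult Lp_norm_gabor)
    also have "h = gabor (\<lambda>x. g x - trunc x) l" by (simp add: h_def gabor_diff)
    also have "Lp_norm p \<dots> = Lp_norm p (\<lambda>x. if \<bar>x\<bar> \<le> R then 0 else g x)"
      unfolding Lp_norm_gabor by (rule arg_cong[where f="Lp_norm p"]) (auto simp: trunc_def)
    also have "K * \<dots> \<le> 1 / 2 * Lp_norm p g" using tail by simp
    finally have "cmod (1 - d l) \<le> 1 / 2" using g_pos by simp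
    then show ?thesis using norm_triangle_ineq2[of 1 "1 - d l"] by simp
  qed
  define D where "D = (\<lambda>x. \<Sum>l\<in>F. (d l * a l) * gabor g l x)"
  have D: "in_Lp p D" unfolding D_def using F by (intro in_Lp_span)
  have cD: "coef D l = d l * a l" if "l \<in> F" for l
    using coef_span[OF F, of l "\<lambda>l. d l * a l"] F that by (auto simp: D_def)
  \<comment> \<open>Dividing by the diagonal is an admissible multiplier once halved; the 2
    reappears in \<open>2 * K * K\<close>.\<close>
  have "cmod (1 / (2 * d l)) \<le> 1" if "l \<in> F" for l
    using d[OF that] by (auto simp: norm_divide norm_mult divide_simps)
  then have "Lp_norm p (\<lambda>x. \<Sum>l\<in>F. (1 / (2 * d l)) * (coef D l * gabor g l x)) \<le> K * Lp_norm p D"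
    by (rule K[OF D F])
  also have "(\<lambda>x. \<Sum>l\<in>F. (1 / (2 * d l)) * (coef D l * gabor g l x)) = (\<lambda>x. (1 / 2) * (\<Sum>l\<in>F. a l * gabor g l x))"
  proof (rule ext)
    fix x
    have "(1 / (2 * d l)) * (coef D l * gabor g l x) = (1 / 2) * (a l * gabor g l x)" if "l \<in> F" for l
      using d[OF that] cD[OF that] by auto
    then show "(\<Sum>l\<in>F. (1 / (2 * d l)) * (coef D l * gabor g l x)) = (1 / 2) * (\<Sum>l\<in>F. a l * gabor g l x)"
      unfolding sum_distrib_left by (intro sum.cong) auto
  qed
  finally have f_le: "Lp_norm p (\<lambda>x. \<Sum>l\<in>F. a l * gabor g l x) \<le> 2 * K * Lp_norm p D"
    by (subst (asm) Lp_norm_cmult) simp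
  define h where "h s = (\<lambda>x. \<Sum>l\<in>F. of_real (s l) * (a l * gabor trunc l x))" for s :: "real \<times> real \<Rightarrow> real"
  have h: "in_Lp p (h s)" for s unfolding h_def by (intro in_Lp_scaled_sum in_Lp_cmult vL)
  \<comment> \<open>The truncation operator conjugated with the signs \<open>s\<close> and
    compressed to \<open>F\<close>: signs go onto the input through \<open>h s\<close> and again
    onto the output coefficients. One factor \<open>K\<close> pays for the output signs, the other
    for dividing by the diagonal.\<close>
  define E where "E s = (\<lambda>x. \<Sum>l\<in>F. of_real (s l) * (coef (h s) l * gabor g l x))" for s
  have E: "in_Lp p (E s)" for s
    unfolding E_def by (intro in_Lp_scaled_sum in_Lp_cmult in_Lp_gabor g_Lp)
  have E_le: "Lp_norm p (E (rsign A)) \<le> K * Lp_norm p (h (rsign A))" for A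
    unfolding E_def using F h by (intro K) auto
  have ch: "coef (h s) l' = (\<Sum>l\<in>F. of_real (s l) * (a l * coef (gabor trunc l) l'))" if "l' \<in> F" for s l'
    unfolding h_def using that F
    by (subst coef_scaled_sum) (auto intro!: in_Lp_cmult vL sum.cong simp: coef_cmult vL)
  have orth: "(\<Sum>A\<in>Pow F. complex_of_real (rsign A l' * rsign A l)) = (if l' = l then 2 ^ card F else 0)"
    if "l \<in> F" "l' \<in> F" for l l'
    using ravg_orthogonal[OF F(1) that(2,1)] unfolding ravg_def of_real_sum[symmetric]
    by (auto simp: field_simps split: if_splits)
  have "(\<Sum>A\<in>Pow F. E (rsign A) x) = 2 ^ card F * D x" for x
  proof -
    have "(\<Sum>A\<in>Pow F. E (rsign A) x) = (\<Sum>A\<in>Pow F. \<Sum>l'\<in>F. \<Sum>l\<in>F.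
        complex_of_real (rsign A l' * rsign A l) * (a l * coef (gabor trunc l) l' * gabor g l' x))"
      unfolding E_def by (intro sum.cong refl)
        (simp add: ch sum_distrib_left sum_distrib_right mult_ac)
    also have "\<dots> = (\<Sum>l'\<in>F. \<Sum>l\<in>F. (\<Sum>A\<in>Pow F. complex_of_real (rsign A l' * rsign A l)) *
        (a l * coef (gabor trunc l) l' * gabor g l' x))"
      unfolding sum_distrib_right by (subst sum.swap, intro sum.cong refl sum.swap)
    also have "\<dots> = (\<Sum>l'\<in>F. \<Sum>l\<in>F. (if l' = l then 2 ^ card F else 0) *
        (a l * coef (gabor trunc l) l' * gabor g l' x))"
      using orth by (intro sum.cong refl) simp
    also have "\<dots> = 2 ^ card F * D x"
      using F(1) by (simp add: D_def d_def sum_distrib_left if_distrib[of "\<lambda>z. z * _"] cong: if_cong)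
        (simp add: mult_ac)
    finally show ?thesis .
  qed
  then have D_eq: "D = (\<lambda>x. (1 / 2 ^ card F) * (\<Sum>A\<in>Pow F. E (rsign A) x))"
    by (simp add: fun_eq_iff)
  have "Lp_norm p D = (1 / 2 ^ card F) * Lp_norm p (\<lambda>x. \<Sum>A\<in>Pow F. E (rsign A) x)"
    unfolding D_eq Lp_norm_cmult by (simp add: norm_divide norm_power)
  also have "\<dots> \<le> (1 / 2 ^ card F) * (\<Sum>A\<in>Pow F. Lp_norm p (E (rsign A)))"
    by (intro mult_left_mono Lp_norm_sum E) auto
  also have "\<dots> \<le> (1 / 2 ^ card F) * (\<Sum>A\<in>Pow F. K * Lp_norm p (h (rsign A)))"
    by (intro mult_left_mono sum_mono E_le) auto
  also have "\<dots> = K * ravg F (\<lambda>s. Lp_norm p (h s))"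
    by (simp add: ravg_def sum_distrib_left sum_divide_distrib)
  finally have "Lp_norm p D \<le> K * ravg F (\<lambda>s. Lp_norm p (h s))" .
  then have "2 * K * Lp_norm p D \<le> 2 * K * (K * ravg F (\<lambda>s. Lp_norm p (h s)))"
    using K_ge_1 by (intro mult_left_mono) auto
  then have "Lp_norm p (\<lambda>x. \<Sum>l\<in>F. a l * gabor g l x) \<le> (2 * K * K) * ravg F (\<lambda>s. Lp_norm p (h s))"
    using f_le by (simp add: mult.assoc)
  then have "Lp_norm p (\<lambda>x. \<Sum>l\<in>F. a l * gabor g l x) powr p \<le> ((2 * K * K) * ravg F (\<lambda>s. Lp_norm p (h s))) powr p"
    using p_ge_1 by (intro powr_mono2) auto
  also have "\<dots> = (2 * K * K) powr p * ravg F (\<lambda>s. Lp_norm p (h s)) powr p"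
    using K_ge_1 by (simp add: powr_mult ravg_nonneg)
  also have "\<dots> \<le> (2 * K * K) powr p * ravg F (\<lambda>s. Lp_norm p (h s) powr p)"
    using F by (intro mult_left_mono ravg_powr_le p_ge_1) auto
  finally show ?thesis by (simp add: h_def)
qed

text \<open>The factors of the constant are, in order: passing to truncated atoms, Khinchine's upper
  bound, the threefold overlap, and Jensen inside one block.\<close>

lemma span_norm_le_blocks:
  obtains C where "0 < C" "\<And>F a. finite F \<Longrightarrow> F \<subseteq> \<Lambda> \<Longrightarrow>
    Lp_norm p (\<lambda>x. \<Sum>l\<in>F. a l * gabor g l x) powr p
      \<le> C * (\<Sum>k\<in>blk ` F. (\<Sum>l\<in>{l \<in> F. blk l = k}. (cmod (a l))\<^sup>2) powr (p / 2))"
proof -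
  define C where "C = (2 * K * K) powr p * (khinchine_const p * (3 powr (p / 2 - 1) * Lp_norm p g powr p))"
  show ?thesis
  proof (rule that[of C])
    show "0 < C" unfolding C_def using K_ge_1 g_pos khinchine_const_pos[of p] by simp
    fix F and a :: "real \<times> real \<Rightarrow> complex"
    assume F: "finite F" "F \<subseteq> \<Lambda>"
    have int: "integrable lborel (square_fun G (\<lambda>l x. a l * gabor h l x))" if "G \<subseteq> F" "in_Lp p h" for G h
      using that F p_gt_2 by (intro integrable_square_fun in_Lp_cmult in_Lp_gabor) (auto intro: finite_subset)
    have "ravg F (\<lambda>s. Lp_norm p (\<lambda>x. \<Sum>l\<in>F. of_real (s l) * (a l * gabor trunc l x)) powr p)
        \<le> khinchine_const p * (\<integral>x. square_fun F (\<lambda>l x. a l * gabor trunc l x) x \<partial>lborel)"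
      using p_gt_2 F by (intro ravg_Lp_norm_le in_Lp_cmult in_Lp_gabor trunc_Lp) auto
    also have "(\<integral>x. square_fun F (\<lambda>l x. a l * gabor trunc l x) x \<partial>lborel)
        \<le> (\<integral>x. 3 powr (p / 2 - 1) * (\<Sum>k\<in>blk ` F. square_fun {l \<in> F. blk l = k} (\<lambda>l x. a l * gabor g l x) x) \<partial>lborel)"
      using F by (intro integral_mono square_fun_trunc_le int trunc_Lp integrable_mult_right
          Bochner_Integration.integrable_sum g_Lp) auto
    also have "\<dots> = 3 powr (p / 2 - 1) * (\<Sum>k\<in>blk ` F. \<integral>x. square_fun {l \<in> F. blk l = k} (\<lambda>l x. a l * gabor g l x) x \<partial>lborel)"
      using int[OF _ g_Lp] by (simp add: Bochner_Integration.integral_sum)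
    also have "\<dots> \<le> 3 powr (p / 2 - 1) * (\<Sum>k\<in>blk ` F. (\<Sum>l\<in>{l \<in> F. blk l = k}. (cmod (a l))\<^sup>2) powr (p / 2) * Lp_norm p g powr p)"
      using F by (intro mult_left_mono sum_mono square_fun_block_le g_Lp) auto
    finally have "ravg F (\<lambda>s. Lp_norm p (\<lambda>x. \<Sum>l\<in>F. of_real (s l) * (a l * gabor trunc l x)) powr p)
        \<le> khinchine_const p * (3 powr (p / 2 - 1) * (\<Sum>k\<in>blk ` F. (\<Sum>l\<in>{l \<in> F. blk l = k}. (cmod (a l))\<^sup>2) powr (p / 2) * Lp_norm p g powr p))"
      using khinchine_const_pos[of p] by (simp add: mult_left_mono)
    then have "(2 * K * K) powr p * ravg F (\<lambda>s. Lp_norm p (\<lambda>x. \<Sum>l\<in>F. of_real (s l) * (a l * gabor trunc l x)) powr p)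
        \<le> C * (\<Sum>k\<in>blk ` F. (\<Sum>l\<in>{l \<in> F. blk l = k}. (cmod (a l))\<^sup>2) powr (p / 2))"
      unfolding C_def sum_distrib_right[symmetric] mult.assoc
      by (intro mult_left_mono) (auto simp: mult_ac)
    then show "Lp_norm p (\<lambda>x. \<Sum>l\<in>F. a l * gabor g l x) powr p
      \<le> C * (\<Sum>k\<in>blk ` F. (\<Sum>l\<in>{l \<in> F. blk l = k}. (cmod (a l))\<^sup>2) powr (p / 2))"
      using span_norm_le_truncated[OF F, of a] by linarith
  qed
qed

end

section \<open>Block energies\<close>

context gabor_basis
begin

text \<open>The block condition sits inside the summand so that one net of finite subsets of
  \<Lambda> serves all blocks at once.\<close>

definition energy :: "int \<Rightarrow> (real \<Rightarrow> complex) \<Rightarrow> real" where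
  "energy k f = (\<Sum>\<^sub>\<infinity>l\<in>\<Lambda>. if blk l = k then (cmod (coef f l))\<^sup>2 else 0)"

lemma energy_nonneg: "0 \<le> energy k f"
  unfolding energy_def by (rule infsum_nonneg) auto

lemma energy_summable:
  assumes "in_Lp p f"
  shows "(\<lambda>l. if blk l = k then (cmod (coef f l))\<^sup>2 else 0) summable_on \<Lambda>"
proof -
  obtain C where "0 < C" and C: "\<And>f F S. in_Lp p f \<Longrightarrow> finite F \<Longrightarrow> F \<subseteq> \<Lambda> \<Longrightarrow> finite S \<Longrightarrow>
    (\<Sum>k\<in>S. (\<Sum>l\<in>{l \<in> F. blk l = k}. (cmod (coef f l))\<^sup>2) powr (p / 2)) \<le> C * Lp_norm p f powr p"
    by (rule coef_blocks_le) blast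
  show ?thesis
  proof (rule nonneg_bdd_above_summable_on, simp, rule bdd_aboveI2)
    fix F assume F: "F \<in> {F. F \<subseteq> \<Lambda> \<and> finite F}"
    define y where "y = (\<Sum>l\<in>{l \<in> F. blk l = k}. (cmod (coef f l))\<^sup>2)"
    have y: "0 \<le> y" by (simp add: y_def sum_nonneg)
    have "y powr (p / 2) \<le> C * Lp_norm p f powr p"
      using C[OF assms, of F "{k}"] F by (simp add: y_def)
    then have "(y powr (p / 2)) powr (2 / p) \<le> (C * Lp_norm p f powr p) powr (2 / p)"
      using p_gt_2 by (intro powr_mono2) auto
    then have "y \<le> (C * Lp_norm p f powr p) powr (2 / p)"
      using p_gt_2 y by (simp add: powr_powr)
    then show "(\<Sum>l\<in>F. if blk l = k then (cmod (coef f l))\<^sup>2 else 0) \<le> (C * Lp_norm p f powr p) powr (2 / p)"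
      using F by (simp add: y_def sum.inter_filter)
  qed
qed

lemma block_sum_le_energy:
  assumes "in_Lp p f" "finite F" "F \<subseteq> \<Lambda>"
  shows "(\<Sum>l\<in>{l \<in> F. blk l = k}. (cmod (coef f l))\<^sup>2) \<le> energy k f"
  unfolding energy_def sum.inter_filter[OF assms(2)]
  by (rule finite_sum_le_infsum[OF energy_summable]) (use assms in auto)

text \<open>Energies are quadratic, so averaging over signs removes the cross terms and makes them
  additive in the family \<open>x\<close>.\<close>

lemma ravg_block_sum:
  assumes "finite J" "\<And>n. n \<in> J \<Longrightarrow> in_Lp p (x n)" "F \<subseteq> \<Lambda>"
  shows "ravg J (\<lambda>s. \<Sum>l\<in>{l \<in> F. blk l = k}. (cmod (coef (\<lambda>t. \<Sum>n\<in>J. of_real (s n) * x n t) l))\<^sup>2)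
    = (\<Sum>n\<in>J. \<Sum>l\<in>{l \<in> F. blk l = k}. (cmod (coef (x n) l))\<^sup>2)"
proof -
  have "ravg J (\<lambda>s. (cmod (coef (\<lambda>t. \<Sum>n\<in>J. of_real (s n) * x n t) l))\<^sup>2) = (\<Sum>n\<in>J. (cmod (coef (x n) l))\<^sup>2)"
    if "l \<in> F" for l
    using that assms by (subst coef_scaled_sum) (auto simp: ravg_square)
  then show ?thesis
    unfolding ravg_sum by (subst sum.swap) simp
qed

text \<open>Additivity writes the inner sum as a sign average; Jensen moves the power inside,
  \<open>coef_blocks_le\<close> applies to each signed sum, and Khinchine turns the averaged norms
  into a square function. The finite set of indices then exhausts \<Lambda>.\<close>

lemma sum_energy_le:
  obtains C where "0 < C" "\<And>(J :: (nat \<times> nat) set) x S. finite J \<Longrightarrow> (\<And>n. n \<in> J \<Longrightarrow> in_Lp p (x n)) \<Longrightarrow>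
    finite S \<Longrightarrow> (\<Sum>k\<in>S. (\<Sum>n\<in>J. energy k (x n)) powr (p / 2)) \<le> C * (\<integral>t. square_fun J x t \<partial>lborel)"
proof -
  obtain C where C0: "0 < C" and C: "\<And>f F S. in_Lp p f \<Longrightarrow> finite F \<Longrightarrow> F \<subseteq> \<Lambda> \<Longrightarrow> finite S \<Longrightarrow>
    (\<Sum>k\<in>S. (\<Sum>l\<in>{l \<in> F. blk l = k}. (cmod (coef f l))\<^sup>2) powr (p / 2)) \<le> C * Lp_norm p f powr p"
    by (rule coef_blocks_le) blast
  show ?thesis
  proof (rule that[of "C * khinchine_const p"])
    show "0 < C * khinchine_const p" using C0 khinchine_const_pos by simp
    fix J :: "(nat \<times> nat) set" and x and S :: "int set"
    assume J: "finite J" and x: "\<And>n. n \<in> J \<Longrightarrow> in_Lp p (x n)" and S: "finite S"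
    define a where "a F k f = (\<Sum>l\<in>{l \<in> F. blk l = k}. (cmod (coef f l))\<^sup>2)" for F k f
    define f where "f s = (\<lambda>t. \<Sum>n\<in>J. complex_of_real (s n) * x n t)" for s :: "nat \<times> nat \<Rightarrow> real"
    have f: "in_Lp p (f s)" for s unfolding f_def by (intro in_Lp_scaled_sum x)
    have finite_bound: "(\<Sum>k\<in>S. (\<Sum>n\<in>J. a F k (x n)) powr (p / 2))
        \<le> C * khinchine_const p * (\<integral>t. square_fun J x t \<partial>lborel)"
      if F: "finite F" "F \<subseteq> \<Lambda>" for F
    proof -
      have "(\<Sum>k\<in>S. (\<Sum>n\<in>J. a F k (x n)) powr (p / 2)) = (\<Sum>k\<in>S. ravg J (\<lambda>s. a F k (f s)) powr (p / 2))"
        unfolding a_def f_def using J x F by (simp add: ravg_block_sum)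
      also have "\<dots> \<le> (\<Sum>k\<in>S. ravg J (\<lambda>s. a F k (f s) powr (p / 2)))"
        using J p_gt_2 by (intro sum_mono ravg_powr_le) (auto simp: a_def sum_nonneg)
      also have "\<dots> = ravg J (\<lambda>s. \<Sum>k\<in>S. a F k (f s) powr (p / 2))"
        by (simp add: ravg_sum)
      also have "\<dots> \<le> ravg J (\<lambda>s. C * Lp_norm p (f s) powr p)"
        unfolding a_def by (intro ravg_mono C f F S)
      also have "\<dots> = C * ravg J (\<lambda>s. Lp_norm p (f s) powr p)"
        by (rule ravg_cmult)
      also have "\<dots> \<le> C * (khinchine_const p * (\<integral>t. square_fun J x t \<partial>lborel))"
        unfolding f_def using C0 p_gt_2 J x by (intro mult_left_mono ravg_Lp_norm_le) auto
      finally show ?thesis by (simp add: mult.assoc)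
    qed
    have lim_a: "((\<lambda>F. \<Sum>l\<in>F. if blk l = k then (cmod (coef (x n) l))\<^sup>2 else 0) \<longlongrightarrow> energy k (x n)) (finite_subsets_at_top \<Lambda>)"
      if "n \<in> J" for k n
      unfolding energy_def by (intro infsum_tendsto energy_summable x that)
    show "(\<Sum>k\<in>S. (\<Sum>n\<in>J. energy k (x n)) powr (p / 2))
      \<le> C * khinchine_const p * (\<integral>t. square_fun J x t \<partial>lborel)"
    proof (rule tendsto_upperbound[where F="finite_subsets_at_top \<Lambda>"])
      show "((\<lambda>F. \<Sum>k\<in>S. (\<Sum>n\<in>J. \<Sum>l\<in>F. if blk l = k then (cmod (coef (x n) l))\<^sup>2 else 0) powr (p / 2))
          \<longlongrightarrow> (\<Sum>k\<in>S. (\<Sum>n\<in>J. energy k (x n)) powr (p / 2))) (finite_subsets_at_top \<Lambda>)"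
        using p_gt_2 by (intro tendsto_sum tendsto_powr2 tendsto_const lim_a)
          (auto intro!: always_eventually sum_nonneg)
      show "\<forall>\<^sub>F F in finite_subsets_at_top \<Lambda>.
          (\<Sum>k\<in>S. (\<Sum>n\<in>J. \<Sum>l\<in>F. if blk l = k then (cmod (coef (x n) l))\<^sup>2 else 0) powr (p / 2))
          \<le> C * khinchine_const p * (\<integral>t. square_fun J x t \<partial>lborel)"
        by (rule eventually_finite_subsets_at_top_weakI)
          (use finite_bound in \<open>simp add: a_def sum.inter_filter\<close>)
    qed simp
  qed
qed

text \<open>There are only finitely many signed sums, so the union of their index sets works for all
  of them simultaneously.\<close>

lemma partial_approximates_signed_sums:
  assumes J: "finite J" and x: "\<And>n. n \<in> J \<Longrightarrow> in_Lp p (x n)" and \<epsilon>: "0 < \<epsilon>"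
  shows "\<exists>F. finite F \<and> F \<subseteq> \<Lambda> \<and> (\<forall>A. A \<subseteq> J \<longrightarrow>
    Lp_norm p (\<lambda>t. (\<Sum>n\<in>J. of_real (rsign A n) * x n t)
      - partial F (\<lambda>t. \<Sum>n\<in>J. of_real (rsign A n) * x n t) t) < \<epsilon>)"
proof -
  define f where "f A = (\<lambda>t. \<Sum>n\<in>J. complex_of_real (rsign A n) * x n t)" for A
  have f: "in_Lp p (f A)" for A unfolding f_def by (intro in_Lp_scaled_sum x)
  have "\<forall>A. \<exists>F0. finite F0 \<and> F0 \<subseteq> \<Lambda> \<and> (\<forall>F. finite F \<and> F0 \<subseteq> F \<and> F \<subseteq> \<Lambda> \<longrightarrow>
      Lp_norm p (\<lambda>t. f A t - partial F (f A) t) < \<epsilon>)"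
    using coef_sums[OF f] \<epsilon> unfolding Lp_uncond_sums_def by simp
  from choice[OF this] obtain F0 where "\<forall>A. finite (F0 A) \<and> F0 A \<subseteq> \<Lambda> \<and>
      (\<forall>F. finite F \<and> F0 A \<subseteq> F \<and> F \<subseteq> \<Lambda> \<longrightarrow> Lp_norm p (\<lambda>t. f A t - partial F (f A) t) < \<epsilon>)"
    by (rule exE)
  then have F0: "finite (F0 A)" "F0 A \<subseteq> \<Lambda>"
    "finite F \<and> F0 A \<subseteq> F \<and> F \<subseteq> \<Lambda> \<Longrightarrow> Lp_norm p (\<lambda>t. f A t - partial F (f A) t) < \<epsilon>" for A F
    by simp_all
  show ?thesis
  proof (intro exI[of _ "\<Union>A\<in>Pow J. F0 A"] conjI allI impI)
    fix A assume "A \<subseteq> J"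
    then show "Lp_norm p (\<lambda>t. (\<Sum>n\<in>J. of_real (rsign A n) * x n t)
      - partial (\<Union>A\<in>Pow J. F0 A) (\<lambda>t. \<Sum>n\<in>J. of_real (rsign A n) * x n t) t) < \<epsilon>"
      using F0(3)[of "\<Union>A\<in>Pow J. F0 A" A] F0(1,2) J unfolding f_def by blast
  qed (use F0 J in auto)
qed

text \<open>Within one block the coefficients of a signed sum form a random vector in l^2, which
  calls for the Hilbert-valued form \<open>khinchine_l2\<close>.\<close>

lemma ravg_span_le_energy:
  obtains C where "0 < C" "\<And>(J :: (nat \<times> nat) set) x F. finite J \<Longrightarrow> (\<And>n. n \<in> J \<Longrightarrow> in_Lp p (x n)) \<Longrightarrow>
    finite F \<Longrightarrow> F \<subseteq> \<Lambda> \<Longrightarrow>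
    ravg J (\<lambda>s. Lp_norm p (partial F (\<lambda>t. \<Sum>n\<in>J. of_real (s n) * x n t)) powr p)
      \<le> C * (\<Sum>k\<in>blk ` F. (\<Sum>n\<in>J. energy k (x n)) powr (p / 2))"
proof -
  obtain C where C0: "0 < C" and C: "\<And>F a. finite F \<Longrightarrow> F \<subseteq> \<Lambda> \<Longrightarrow>
    Lp_norm p (\<lambda>x. \<Sum>l\<in>F. a l * gabor g l x) powr p
      \<le> C * (\<Sum>k\<in>blk ` F. (\<Sum>l\<in>{l \<in> F. blk l = k}. (cmod (a l))\<^sup>2) powr (p / 2))"
    by (rule span_norm_le_blocks) blast
  show ?thesis
  proof (rule that[of "C * khinchine_const p"])
    show "0 < C * khinchine_const p" using C0 khinchine_const_pos by simp
    fix J :: "(nat \<times> nat) set" and x F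
    assume J: "finite J" and x: "\<And>n. n \<in> J \<Longrightarrow> in_Lp p (x n)" and F: "finite F" "F \<subseteq> \<Lambda>"
    define f where "f s = (\<lambda>t. \<Sum>n\<in>J. complex_of_real (s n) * x n t)" for s :: "nat \<times> nat \<Rightarrow> real"
    have cf: "coef (f s) l = (\<Sum>n\<in>J. of_real (s n) * coef (x n) l)" if "l \<in> F" for s l
      unfolding f_def using that F x by (intro coef_scaled_sum) auto
    have "ravg J (\<lambda>s. Lp_norm p (partial F (f s)) powr p)
        \<le> ravg J (\<lambda>s. C * (\<Sum>k\<in>blk ` F. (\<Sum>l\<in>{l \<in> F. blk l = k}. (cmod (coef (f s) l))\<^sup>2) powr (p / 2)))"
      by (intro ravg_mono C F)
    also have "\<dots> = C * (\<Sum>k\<in>blk ` F. ravg J (\<lambda>s. (\<Sum>l\<in>{l \<in> F. blk l = k}. (cmod (coef (f s) l))\<^sup>2) powr (p / 2)))"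
      by (simp only: ravg_cmult ravg_sum)
    also have "\<dots> \<le> C * (\<Sum>k\<in>blk ` F. khinchine_const p * (\<Sum>n\<in>J. energy k (x n)) powr (p / 2))"
    proof (intro mult_left_mono sum_mono)
      fix k
      have "ravg J (\<lambda>s. (\<Sum>l\<in>{l \<in> F. blk l = k}. (cmod (coef (f s) l))\<^sup>2) powr (p / 2))
          = ravg J (\<lambda>s. (\<Sum>l\<in>{l \<in> F. blk l = k}. (cmod (\<Sum>n\<in>J. of_real (s n) * coef (x n) l))\<^sup>2) powr (p / 2))"
        using cf by simp
      also have "\<dots> \<le> khinchine_const (2 * (p / 2)) *
          (\<Sum>n\<in>J. \<Sum>l\<in>{l \<in> F. blk l = k}. (cmod (coef (x n) l))\<^sup>2) powr (p / 2)"
        using J F p_gt_2 by (intro khinchine_l2) auto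
      also have "\<dots> \<le> khinchine_const (2 * (p / 2)) * (\<Sum>n\<in>J. energy k (x n)) powr (p / 2)"
        using p_gt_2 F x khinchine_const_pos[of "2 * (p / 2)"]
        by (intro mult_left_mono powr_mono2 sum_mono block_sum_le_energy sum_nonneg) auto
      finally show "ravg J (\<lambda>s. (\<Sum>l\<in>{l \<in> F. blk l = k}. (cmod (coef (f s) l))\<^sup>2) powr (p / 2))
          \<le> khinchine_const p * (\<Sum>n\<in>J. energy k (x n)) powr (p / 2)" by simp
    qed (use C0 in auto)
    finally show "ravg J (\<lambda>s. Lp_norm p (partial F (\<lambda>t. \<Sum>n\<in>J. of_real (s n) * x n t)) powr p)
      \<le> C * khinchine_const p * (\<Sum>k\<in>blk ` F. (\<Sum>n\<in>J. energy k (x n)) powr (p / 2))"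
      unfolding f_def by (simp add: sum_distrib_left mult.assoc)
  qed
qed

text \<open>Stated with a finite \<open>S\<close> depending on the family, so that no infinite sum
  over blocks is needed: the error of a finite expansion is absorbed into the left side.\<close>

lemma square_fun_le_energy:
  obtains C where "0 < C" "\<And>(J :: (nat \<times> nat) set) x. finite J \<Longrightarrow> (\<And>n. n \<in> J \<Longrightarrow> in_Lp p (x n)) \<Longrightarrow>
    \<exists>S. finite S \<and> (\<integral>t. square_fun J x t \<partial>lborel) \<le> C * (\<Sum>k\<in>S. (\<Sum>n\<in>J. energy k (x n)) powr (p / 2))"
proof -
  obtain C where C0: "0 < C" and C: "\<And>(J :: (nat \<times> nat) set) x F. finite J \<Longrightarrow> (\<And>n. n \<in> J \<Longrightarrow> in_Lp p (x n)) \<Longrightarrow>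
    finite F \<Longrightarrow> F \<subseteq> \<Lambda> \<Longrightarrow>
    ravg J (\<lambda>s. Lp_norm p (partial F (\<lambda>t. \<Sum>n\<in>J. of_real (s n) * x n t)) powr p)
      \<le> C * (\<Sum>k\<in>blk ` F. (\<Sum>n\<in>J. energy k (x n)) powr (p / 2))"
    by (rule ravg_span_le_energy) blast
  show ?thesis
  proof (rule that[of "2 * 2 powr p * C"])
    show "0 < 2 * 2 powr p * C" using C0 by simp
    fix J :: "(nat \<times> nat) set" and x
    assume J: "finite J" and x: "\<And>n. n \<in> J \<Longrightarrow> in_Lp p (x n)"
    define Q where "Q = (\<integral>t. square_fun J x t \<partial>lborel)"
    define f where "f s = (\<lambda>t. \<Sum>n\<in>J. complex_of_real (s n) * x n t)" for s :: "nat \<times> nat \<Rightarrow> real"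
    have f: "in_Lp p (f s)" for s unfolding f_def by (intro in_Lp_scaled_sum x)
    show "\<exists>S. finite S \<and> (\<integral>t. square_fun J x t \<partial>lborel)
        \<le> 2 * 2 powr p * C * (\<Sum>k\<in>S. (\<Sum>n\<in>J. energy k (x n)) powr (p / 2))"
    proof (cases "Q \<le> 0")
      case True
      then show ?thesis by (intro exI[of _ "{}"]) (simp add: Q_def)
    next
      case False
      \<comment> \<open>Chosen so that the approximation error, after \<open>powr_add_le\<close>,
        amounts to exactly \<open>Q / 2\<close>.\<close>
      define \<epsilon> where "\<epsilon> = (Q / (2 * 2 powr p)) powr (1 / p)"
      have \<epsilon>: "0 < \<epsilon>" using False by (simp add: \<epsilon>_def)
      have \<epsilon>p: "2 powr p * \<epsilon> powr p = Q / 2"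
        using False p_gt_2 by (simp add: \<epsilon>_def powr_powr)
      from partial_approximates_signed_sums[OF J x \<epsilon>, folded f_def]
      obtain F where "finite F \<and> F \<subseteq> \<Lambda> \<and> (\<forall>A. A \<subseteq> J \<longrightarrow>
          Lp_norm p (\<lambda>t. f (rsign A) t - partial F (f (rsign A)) t) < \<epsilon>)"
        unfolding f_def by (rule exE)
      then have F: "finite F" "F \<subseteq> \<Lambda>"
        and approx: "A \<subseteq> J \<Longrightarrow> Lp_norm p (\<lambda>t. f (rsign A) t - partial F (f (rsign A)) t) < \<epsilon>" for A
        by simp_all
      have "Q \<le> ravg J (\<lambda>s. Lp_norm p (f s) powr p)"
        unfolding Q_def f_def using p_gt_2 J x by (intro integral_square_fun_le) auto
      also have "\<dots> \<le> ravg J (\<lambda>s. 2 powr p * (\<epsilon> powr p + Lp_norm p (partial F (f s)) powr p))"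
      proof (rule ravg_mono)
        fix A assume A: "A \<subseteq> J"
        have "Lp_norm p (f (rsign A)) \<le> \<epsilon> + Lp_norm p (partial F (f (rsign A)))"
          using Lp_norm_le_diff[OF f in_Lp_span[OF F(2)], of "rsign A" "coef (f (rsign A))"] approx[OF A]
          by linarith
        then have "Lp_norm p (f (rsign A)) powr p \<le> (\<epsilon> + Lp_norm p (partial F (f (rsign A)))) powr p"
          using p_gt_2 by (intro powr_mono2) auto
        also have "\<dots> \<le> 2 powr p * (\<epsilon> powr p + Lp_norm p (partial F (f (rsign A))) powr p)"
          using p_ge_1 \<epsilon> by (intro powr_add_le) auto
        finally show "Lp_norm p (f (rsign A)) powr p
          \<le> 2 powr p * (\<epsilon> powr p + Lp_norm p (partial F (f (rsign A))) powr p)" .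
      qed
      also have "\<dots> = Q / 2 + 2 powr p * ravg J (\<lambda>s. Lp_norm p (partial F (f s)) powr p)"
        by (simp only: ravg_cmult ravg_add ravg_const[OF J] distrib_left \<epsilon>p)
      also have "\<dots> \<le> Q / 2 + 2 powr p * (C * (\<Sum>k\<in>blk ` F. (\<Sum>n\<in>J. energy k (x n)) powr (p / 2)))"
        unfolding f_def using C[OF J x F] by (intro add_left_mono mult_left_mono) auto
      finally have "Q \<le> 2 * 2 powr p * C * (\<Sum>k\<in>blk ` F. (\<Sum>n\<in>J. energy k (x n)) powr (p / 2))"
        by simp
      then show ?thesis using F by (intro exI[of _ "blk ` F"]) (simp add: Q_def)
    qed
  qed
qed

end

section \<open>Averages in sequence spaces\<close>

lemma pointwise_convergent_subsequence:
  fixes b :: "nat \<Rightarrow> 'k::countable \<Rightarrow> real"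
  assumes "\<And>m k. \<bar>b m k\<bar> \<le> B"
  obtains \<sigma> \<beta> where "strict_mono (\<sigma> :: nat \<Rightarrow> nat)" "\<And>k. (\<lambda>i. b (\<sigma> i) k) \<longlonglongrightarrow> \<beta> k"
proof -
  define P where "P n s \<longleftrightarrow> convergent (\<lambda>i. b (s i) (from_nat n :: 'k))" for n and s :: "nat \<Rightarrow> nat"
  interpret subseqs P
  proof
    fix n and s :: "nat \<Rightarrow> nat"
    have "\<forall>i. b (s i) (from_nat n) \<in> {- B..B}"
      using assms by (auto simp: abs_le_iff minus_le_iff)
    then obtain l r where "strict_mono (r :: nat \<Rightarrow> nat)" "((\<lambda>i. b (s i) (from_nat n)) \<circ> r) \<longlonglongrightarrow> l"
      using compact_Icc[of "- B" B, THEN compact_imp_seq_compact, THEN seq_compactE] by metis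
    then show "\<exists>r. strict_mono r \<and> P n (s \<circ> r)"
      unfolding P_def convergent_def by (auto simp: o_def)
  qed
  have "convergent (\<lambda>i. b (diagseq i) k)" for k
  proof -
    \<comment> \<open>The diagonal sequence refines the k-th extraction only from a certain index
      on; convergence ignores the initial segment.\<close>
    have "P (to_nat k) (diagseq \<circ> (+) (Suc (to_nat k)))"
      by (rule diagseq_holds)
        (auto simp: P_def o_def intro: convergent_subseq_convergent[unfolded o_def])
    then have "convergent (\<lambda>i. b (diagseq (i + Suc (to_nat k))) k)"
      by (simp add: P_def o_def add.commute)
    then show ?thesis
      by (rule convergent_ignore_initial_segment[THEN iffD1])
  qed
  then have "\<exists>\<beta>. \<forall>k. (\<lambda>i. b (diagseq i) k) \<longlonglongrightarrow> \<beta> k"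
    unfolding convergent_def by (rule choice[OF allI])
  then show ?thesis using that[OF subseq_diagseq] by blast
qed

text \<open>Take \<open>S0\<close> to nearly attain the supremum of the finite sums; a disjoint set
  can then add at most \<epsilon>.\<close>

lemma small_tail:
  fixes f :: "'k \<Rightarrow> real"
  assumes "\<And>k. 0 \<le> f k" "\<And>S. finite S \<Longrightarrow> sum f S \<le> B" "0 < \<epsilon>"
  obtains S0 where "finite S0" "\<And>S. finite S \<Longrightarrow> S \<inter> S0 = {} \<Longrightarrow> sum f S \<le> \<epsilon>"
proof -
  define s where "s = (SUP S\<in>{S. finite S}. sum f S)"
  have bdd: "bdd_above (sum f ` {S. finite S})" using assms(2) by (auto intro!: bdd_aboveI2)
  have "\<exists>S0\<in>{S. finite S}. s - \<epsilon> < sum f S0"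
    using assms(3) bdd unfolding s_def by (subst less_cSUP_iff[symmetric]) auto
  then obtain S0 where S0: "finite S0" "s - \<epsilon> < sum f S0" by auto
  show ?thesis
  proof (rule that[OF S0(1)])
    fix S assume S: "finite S" "S \<inter> S0 = {}"
    have "sum f (S \<union> S0) \<le> s" unfolding s_def using S S0 bdd by (intro cSUP_upper) auto
    moreover have "sum f (S \<union> S0) = sum f S + sum f S0" using S S0 by (intro sum.union_disjoint) auto
    ultimately show "sum f S \<le> \<epsilon>" using S0 by simp
  qed
qed

text \<open>Gliding hump: after subtracting the pointwise limit, a subsequence is almost disjointly
  supported, and averages of disjoint bounded vectors of \<open>\<ell>\<^sup>r\<close> tend to \<open>0\<close> because \<open>1 < r\<close>.\<close>

lemma gliding_hump_sequence:
  fixes b :: "nat \<Rightarrow> 'k \<Rightarrow> real"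
  assumes b0: "\<And>m k. 0 \<le> b m k" and bd: "\<And>m S. finite S \<Longrightarrow> (\<Sum>k\<in>S. b m k powr r) \<le> B"
    and \<sigma>: "strict_mono \<sigma>" "\<And>k. (\<lambda>i. b (\<sigma> i) k) \<longlonglongrightarrow> \<beta> k" and r: "1 < r" and \<epsilon>: "0 < \<epsilon>" and S0: "finite S0"
  obtains m :: "nat \<Rightarrow> nat" and T :: "nat \<Rightarrow> 'k set"
  where "\<And>j. n \<le> m j" "strict_mono m" "\<And>j. finite (T j)" "T 0 = S0" "mono T"
    "\<And>j. (\<Sum>k\<in>T j. \<bar>b (m (Suc j)) k - \<beta> k\<bar> powr r) \<le> \<epsilon>"
    "\<And>j S. finite S \<Longrightarrow> S \<inter> T (Suc j) = {} \<Longrightarrow> (\<Sum>k\<in>S. b (m (Suc j)) k powr r) \<le> \<epsilon>"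
proof -
  \<comment> \<open>A state is the last chosen index together with the coordinates captured so far.
    The initial index is arbitrary, so the estimates start at stage 1; hence
    \<open>m (Suc j)\<close> in the conclusions.\<close>
  define P where "P j a \<longleftrightarrow> n \<le> fst a \<and> finite (snd a) \<and> (j = 0 \<longrightarrow> snd a = S0)"
    for j :: nat and a :: "nat \<times> 'k set"
  define Q where "Q j a a' \<longleftrightarrow> fst a < fst a' \<and> snd a \<subseteq> snd a' \<and>
      (\<Sum>k\<in>snd a. \<bar>b (fst a') k - \<beta> k\<bar> powr r) \<le> \<epsilon> \<and>
      (\<forall>S. finite S \<and> S \<inter> snd a' = {} \<longrightarrow> (\<Sum>k\<in>S. b (fst a') k powr r) \<le> \<epsilon>)"
    for j :: nat and a a' :: "nat \<times> 'k set"
  have "\<exists>a. \<forall>j. P j (a j) \<and> Q j (a j) (a (Suc j))"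
  proof (rule dependent_nat_choice)
    show "\<exists>a. P 0 a" using S0 by (auto simp: P_def)
    fix a j assume a: "P j a"
    have "(\<lambda>i. \<Sum>k\<in>snd a. \<bar>b (\<sigma> i) k - \<beta> k\<bar> powr r) \<longlonglongrightarrow> (\<Sum>k\<in>snd a. \<bar>\<beta> k - \<beta> k\<bar> powr r)"
      using r by (intro tendsto_sum tendsto_powr2 tendsto_rabs tendsto_diff tendsto_const \<sigma>(2)) auto
    then have "\<forall>\<^sub>F i in sequentially. (\<Sum>k\<in>snd a. \<bar>b (\<sigma> i) k - \<beta> k\<bar> powr r) < \<epsilon>"
      using \<epsilon> r by (intro order_tendstoD(2)) auto
    moreover have "\<forall>\<^sub>F i in sequentially. Suc (fst a) \<le> i" by (rule eventually_ge_at_top)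
    ultimately have "\<forall>\<^sub>F i in sequentially. (\<Sum>k\<in>snd a. \<bar>b (\<sigma> i) k - \<beta> k\<bar> powr r) < \<epsilon> \<and> Suc (fst a) \<le> i"
      by eventually_elim simp
    then obtain i where i: "(\<Sum>k\<in>snd a. \<bar>b (\<sigma> i) k - \<beta> k\<bar> powr r) < \<epsilon>" "Suc (fst a) \<le> i"
      by (auto simp: eventually_sequentially)
    have "i \<le> \<sigma> i" by (rule seq_suble[OF \<sigma>(1)])
    obtain T where T: "finite T" "\<And>S. finite S \<Longrightarrow> S \<inter> T = {} \<Longrightarrow> (\<Sum>k\<in>S. b (\<sigma> i) k powr r) \<le> \<epsilon>"
      by (rule small_tail[of "\<lambda>k. b (\<sigma> i) k powr r" B \<epsilon>]) (use bd \<epsilon> in auto)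
    have "(\<Sum>k\<in>S. b (\<sigma> i) k powr r) \<le> \<epsilon>" if "finite S" "S \<inter> (snd a \<union> T) = {}" for S
      using that by (intro T(2)) auto
    then show "\<exists>a'. P (Suc j) a' \<and> Q j a a'"
      using a i \<open>i \<le> \<sigma> i\<close> T(1)
      by (intro exI[of _ "(\<sigma> i, snd a \<union> T)"]) (auto simp: P_def Q_def)
  qed
  then obtain a where a: "\<And>j. P j (a j)" "\<And>j. Q j (a j) (a (Suc j))" by blast
  show ?thesis
  proof (rule that[of "\<lambda>j. fst (a j)" "\<lambda>j. snd (a j)"])
    show "strict_mono (\<lambda>j. fst (a j))" using a(2) by (simp add: Q_def strict_mono_Suc_iff)
    show "mono (\<lambda>j. snd (a j))" using a(2) by (simp add: Q_def mono_iff_le_Suc)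
  qed (use a in \<open>auto simp: P_def Q_def\<close>)
qed

lemma powr_add3_le:
  fixes a b c :: real
  assumes "1 \<le> r" "0 \<le> a" "0 \<le> b" "0 \<le> c"
  shows "(a + b + c) powr r \<le> 4 powr r * (a powr r + b powr r + c powr r)"
proof -
  have "(a + b + c) powr r \<le> 2 powr r * ((a + b) powr r + c powr r)"
    using assms by (intro powr_add_le) auto
  also have "\<dots> \<le> 2 powr r * (2 powr r * (a powr r + b powr r) + 2 powr r * c powr r)"
  proof (intro mult_left_mono add_mono powr_add_le assms)
    have "1 * c powr r \<le> 2 powr r * c powr r"
      using assms by (intro mult_right_mono ge_one_powr_ge_zero) auto
    then show "c powr r \<le> 2 powr r * c powr r" by simp
  qed auto
  also have "\<dots> = (2 powr r * 2 powr r) * (a powr r + b powr r + c powr r)"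
    by (simp add: algebra_simps)
  also have "2 powr r * 2 powr r = (4::real) powr r"
    by (simp flip: powr_mult)
  finally show ?thesis .
qed

lemma sum_disjoint_powr_le:
  fixes z :: "'j \<Rightarrow> real"
  assumes r: "1 \<le> r" and J: "finite J" and z: "\<And>j. j \<in> J \<Longrightarrow> 0 \<le> z j"
    and disj: "\<And>i j. i \<in> J \<Longrightarrow> j \<in> J \<Longrightarrow> z i \<noteq> 0 \<Longrightarrow> z j \<noteq> 0 \<Longrightarrow> i = j"
  shows "(\<Sum>j\<in>J. z j) powr r \<le> (\<Sum>j\<in>J. z j powr r)"
proof -
  define G where "G = {j \<in> J. z j \<noteq> 0}"
  have G: "finite G" "\<And>j. j \<in> G \<Longrightarrow> 0 \<le> z j" using J z by (auto simp: G_def)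
  have "\<forall>i\<in>G. \<forall>j\<in>G. i = j" using disj by (auto simp: G_def)
  then have c: "card G \<le> 1" using card_le_Suc0_iff_eq[OF G(1)] by simp
  have "(\<Sum>j\<in>G. z j) powr r \<le> real 1 powr (r - 1) * (\<Sum>j\<in>G. z j powr r)"
    by (rule powr_sum_le_card[OF r G c])
  moreover have "(\<Sum>j\<in>G. z j) = (\<Sum>j\<in>J. z j)"
    by (rule sum.mono_neutral_left[OF J]) (auto simp: G_def)
  moreover have "(\<Sum>j\<in>G. z j powr r) = (\<Sum>j\<in>J. z j powr r)"
    by (rule sum.mono_neutral_left[OF J]) (auto simp: G_def)
  ultimately show ?thesis by simp
qed

text \<open>\<open>S0\<close> depends only on the pointwise limit and is fixed before n, so one
  finite set serves averages starting arbitrarily late. Single terms need not have this property,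
  since their humps may leave every finite set.\<close>

lemma averages_with_small_tails:
  fixes b :: "nat \<Rightarrow> 'k::countable \<Rightarrow> real"
  assumes r: "1 < r" and b0: "\<And>m k. 0 \<le> b m k"
    and bd: "\<And>m S. finite S \<Longrightarrow> (\<Sum>k\<in>S. b m k powr r) \<le> B" and \<eta>: "0 < \<eta>"
  obtains S0 where "finite S0" "\<And>n. \<exists>M. finite M \<and> M \<noteq> {} \<and> M \<subseteq> {n..} \<and>
    (\<forall>S. finite S \<and> S \<inter> S0 = {} \<longrightarrow> (\<Sum>k\<in>S. (\<Sum>m\<in>M. b m k) powr r) \<le> \<eta> * real (card M) powr r)"
proof -
  have B0: "0 \<le> B" using bd[of "{}"] by simp
  have "\<bar>b m k\<bar> \<le> B powr (1 / r)" for m k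
  proof -
    have "b m k powr r \<le> B" using bd[of "{k}" m] by simp
    then have "(b m k powr r) powr (1 / r) \<le> B powr (1 / r)" using r by (intro powr_mono2) auto
    then show ?thesis using r b0 by (simp add: powr_powr)
  qed
  then obtain \<sigma> \<beta> where \<sigma>: "strict_mono \<sigma>" "\<And>k. (\<lambda>i. b (\<sigma> i) k) \<longlonglongrightarrow> \<beta> k"
    by (rule pointwise_convergent_subsequence[of b "B powr (1 / r)"]) blast
  have \<beta>0: "0 \<le> \<beta> k" for k using b0 by (intro LIMSEQ_le_const[OF \<sigma>(2)]) auto
  have \<beta>B: "(\<Sum>k\<in>S. \<beta> k powr r) \<le> B" if "finite S" for S
  proof (rule LIMSEQ_le_const2)
    show "(\<lambda>i. \<Sum>k\<in>S. b (\<sigma> i) k powr r) \<longlonglongrightarrow> (\<Sum>k\<in>S. \<beta> k powr r)"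
      using r b0 by (intro tendsto_sum tendsto_powr2 tendsto_const \<sigma>(2)) auto
  qed (use bd that in auto)
  \<comment> \<open>The three parts will contribute \<epsilon>, \<open>2 * \<epsilon>\<close> and
    \<epsilon> (times \<open>N powr r\<close>), and splitting into three costs
    \<open>4 powr r\<close>: altogether \<open>\<eta> / 2\<close>.\<close>
  define \<epsilon> where "\<epsilon> = \<eta> / (8 * 4 powr r)"
  have \<epsilon>: "0 < \<epsilon>" using \<eta> by (simp add: \<epsilon>_def)
  obtain S0 where S0: "finite S0" "\<And>S. finite S \<Longrightarrow> S \<inter> S0 = {} \<Longrightarrow> (\<Sum>k\<in>S. \<beta> k powr r) \<le> \<epsilon>"
    by (rule small_tail[of "\<lambda>k. \<beta> k powr r" B \<epsilon>]) (use \<beta>B \<epsilon> in auto)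
  have "filterlim (\<lambda>N. real N powr (r - 1)) at_top sequentially"
    using r by (intro filterlim_compose[OF real_powr_at_top filterlim_real_sequentially]) auto
  then have "\<forall>\<^sub>F N in sequentially. B / \<epsilon> \<le> real N powr (r - 1)"
    by (simp add: filterlim_at_top)
  then have "\<forall>\<^sub>F N in sequentially. B / \<epsilon> \<le> real N powr (r - 1) \<and> 1 \<le> N"
    using eventually_ge_at_top[of 1] by eventually_elim simp
  then obtain N where N: "B / \<epsilon> \<le> real N powr (r - 1)" "1 \<le> N"
    by (auto simp: eventually_sequentially)
  have "B \<le> \<epsilon> * real N powr (r - 1)" using N \<epsilon> by (simp add: pos_divide_le_eq mult.commute)
  \<comment> \<open>N disjoint humps cost only \<open>N * B\<close>, which r > 1 makes negligible
    against \<open>N powr r\<close>.\<close>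
  then have "real N * B \<le> real N * (\<epsilon> * real N powr (r - 1))" by (intro mult_left_mono) auto
  also have "\<dots> = \<epsilon> * real N powr r" using N by (simp add: powr_diff)
  finally have NB: "real N * B \<le> \<epsilon> * real N powr r" .
  show ?thesis
  proof (rule that[OF S0(1)])
    fix n
    obtain m :: "nat \<Rightarrow> nat" and T :: "nat \<Rightarrow> 'k set" where
      m: "\<And>j. n \<le> m j" "strict_mono m" and T: "\<And>j. finite (T j)" "T 0 = S0" "mono T"
      and near: "\<And>j. (\<Sum>k\<in>T j. \<bar>b (m (Suc j)) k - \<beta> k\<bar> powr r) \<le> \<epsilon>"
      and far: "\<And>j S. finite S \<Longrightarrow> S \<inter> T (Suc j) = {} \<Longrightarrow> (\<Sum>k\<in>S. b (m (Suc j)) k powr r) \<le> \<epsilon>"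
      by (rule gliding_hump_sequence[OF b0 bd \<sigma> r \<epsilon> S0(1), of n]) blast+
    \<comment> \<open>The error \<open>w\<close> collects the old coordinates, where the vector is
      already near \<beta>, and those not yet captured, where it is small. The hump \<open>z\<close>
      lives on the coordinates captured at this stage, and these sets are disjoint for different
      stages.\<close>
    define w where "w j k = (if k \<in> T j then \<bar>b (m (Suc j)) k - \<beta> k\<bar> else
        if k \<in> T (Suc j) then 0 else b (m (Suc j)) k)" for j k
    define z where "z j k = (if k \<in> T (Suc j) \<and> k \<notin> T j then b (m (Suc j)) k else 0)" for j k
    have w0: "0 \<le> w j k" and z0: "0 \<le> z j k" for j k using b0 by (auto simp: w_def z_def)
    have split: "b (m (Suc j)) k \<le> \<beta> k + w j k + z j k" for j k
      using \<beta>0[of k] by (auto simp: w_def z_def)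
    have z_disj: "i = j" if "z i k \<noteq> 0" "z j k \<noteq> 0" for i j k
    proof (rule ccontr)
      have less: False if "i < j" "z i k \<noteq> 0" "z j k \<noteq> 0" for i j
      proof -
        have "T (Suc i) \<subseteq> T j" using T(3) that(1) by (simp add: monoD Suc_le_eq)
        then show False using that by (auto simp: z_def split: if_splits)
      qed
      assume "i \<noteq> j"
      then show False using less[of i j] less[of j i] that by (cases i j rule: linorder_cases) auto
    qed
    define M where "M = (\<lambda>j. m (Suc j)) ` {..<N}"
    have inj: "inj_on (\<lambda>j. m (Suc j)) {..<N}"
      using strict_mono_eq[OF m(2)] by (auto intro!: inj_onI)
    have cM: "card M = N" unfolding M_def using inj by (simp add: card_image)
    have sumM: "(\<Sum>m\<in>M. b m k) = (\<Sum>j<N. b (m (Suc j)) k)" for k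
      unfolding M_def by (simp add: sum.reindex[OF inj])
    have bound: "(\<Sum>k\<in>S. (\<Sum>m\<in>M. b m k) powr r) \<le> \<eta> * real (card M) powr r"
      if S: "finite S" "S \<inter> S0 = {}" for S
    proof -
      have swap: "(\<Sum>k\<in>S. \<Sum>j<N. f j k) = (\<Sum>j<N. \<Sum>k\<in>S. f j k)" for f :: "nat \<Rightarrow> 'k \<Rightarrow> real"
        by (rule sum.swap)
      have wS: "(\<Sum>k\<in>S. w j k powr r) \<le> 2 * \<epsilon>" for j
      proof -
        have sub: "T j \<subseteq> T (Suc j)" using T(3) by (simp add: monoD)
        have "(\<Sum>k\<in>S. w j k powr r) = (\<Sum>k\<in>S \<inter> T j. w j k powr r) + (\<Sum>k\<in>S - T j. w j k powr r)"
          using S by (metis add.commute sum.Int_Diff)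
        also have "(\<Sum>k\<in>S \<inter> T j. w j k powr r) = (\<Sum>k\<in>S \<inter> T j. \<bar>b (m (Suc j)) k - \<beta> k\<bar> powr r)"
          by (intro sum.cong) (auto simp: w_def)
        also have "(\<Sum>k\<in>S - T j. w j k powr r) = (\<Sum>k\<in>S - T (Suc j). b (m (Suc j)) k powr r)"
          using S sub by (intro sum.mono_neutral_cong_right) (auto simp: w_def)
        finally have "(\<Sum>k\<in>S. w j k powr r) = (\<Sum>k\<in>S \<inter> T j. \<bar>b (m (Suc j)) k - \<beta> k\<bar> powr r)
            + (\<Sum>k\<in>S - T (Suc j). b (m (Suc j)) k powr r)" .
        moreover have "(\<Sum>k\<in>S \<inter> T j. \<bar>b (m (Suc j)) k - \<beta> k\<bar> powr r) \<le> (\<Sum>k\<in>T j. \<bar>b (m (Suc j)) k - \<beta> k\<bar> powr r)"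
          using T by (intro sum_mono2) auto
        moreover have "(\<Sum>k\<in>S - T (Suc j). b (m (Suc j)) k powr r) \<le> \<epsilon>"
          using S by (intro far) auto
        ultimately show ?thesis using near[of j] by linarith
      qed
      have zS: "(\<Sum>k\<in>S. z j k powr r) \<le> B" for j
      proof -
        have "(\<Sum>k\<in>S. z j k powr r) \<le> (\<Sum>k\<in>S. b (m (Suc j)) k powr r)"
          using b0 r by (intro sum_mono powr_mono2) (auto simp: z_def)
        also have "\<dots> \<le> B" by (rule bd[OF S(1)])
        finally show ?thesis .
      qed
      have pw: "(\<Sum>m\<in>M. b m k) powr r \<le> 4 powr r * (real N powr r * \<beta> k powr r
          + real N powr (r - 1) * (\<Sum>j<N. w j k powr r) + (\<Sum>j<N. z j k powr r))" for k
      proof -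
        have "(\<Sum>m\<in>M. b m k) \<le> (\<Sum>j<N. \<beta> k + w j k + z j k)"
          unfolding sumM by (intro sum_mono split)
        also have "\<dots> = real N * \<beta> k + (\<Sum>j<N. w j k) + (\<Sum>j<N. z j k)"
          by (simp add: sum.distrib)
        finally have "(\<Sum>m\<in>M. b m k) powr r \<le> (real N * \<beta> k + (\<Sum>j<N. w j k) + (\<Sum>j<N. z j k)) powr r"
          using r b0 by (intro powr_mono2 sum_nonneg) auto
        also have "\<dots> \<le> 4 powr r * ((real N * \<beta> k) powr r + (\<Sum>j<N. w j k) powr r + (\<Sum>j<N. z j k) powr r)"
          using r \<beta>0 w0 z0 by (intro powr_add3_le sum_nonneg) auto
        also have "\<dots> \<le> 4 powr r * (real N powr r * \<beta> k powr r
          + real N powr (r - 1) * (\<Sum>j<N. w j k powr r) + (\<Sum>j<N. z j k powr r))"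
          using r \<beta>0 w0 z0 z_disj
          by (intro mult_left_mono add_mono powr_sum_le_card sum_disjoint_powr_le) (auto simp: powr_mult)
        finally show ?thesis .
      qed
      have "(\<Sum>k\<in>S. (\<Sum>m\<in>M. b m k) powr r) \<le> (\<Sum>k\<in>S. 4 powr r * (real N powr r * \<beta> k powr r
          + real N powr (r - 1) * (\<Sum>j<N. w j k powr r) + (\<Sum>j<N. z j k powr r)))"
        by (intro sum_mono pw)
      also have "\<dots> = 4 powr r * (real N powr r * (\<Sum>k\<in>S. \<beta> k powr r)
          + real N powr (r - 1) * (\<Sum>k\<in>S. \<Sum>j<N. w j k powr r) + (\<Sum>k\<in>S. \<Sum>j<N. z j k powr r))"
        by (simp only: sum_distrib_left[symmetric] sum.distrib)
      also have "\<dots> = 4 powr r * (real N powr r * (\<Sum>k\<in>S. \<beta> k powr r)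
          + real N powr (r - 1) * (\<Sum>j<N. \<Sum>k\<in>S. w j k powr r) + (\<Sum>j<N. \<Sum>k\<in>S. z j k powr r))"
        unfolding swap[of "\<lambda>j k. w j k powr r"] swap[of "\<lambda>j k. z j k powr r"] ..
      also have "\<dots> \<le> 4 powr r * (real N powr r * \<epsilon> + real N powr (r - 1) * (\<Sum>j<N. 2 * \<epsilon>) + (\<Sum>j<N. B))"
        using S by (intro mult_left_mono add_mono sum_mono wS zS S0(2)) auto
      also have "\<dots> = 4 powr r * (3 * (\<epsilon> * real N powr r) + real N * B)"
        using N by (simp add: powr_diff)
      also have "\<dots> \<le> 4 powr r * (3 * (\<epsilon> * real N powr r) + \<epsilon> * real N powr r)"
        using NB by (intro mult_left_mono add_left_mono) auto
      also have "\<dots> = \<eta> / 2 * real N powr r" by (simp add: \<epsilon>_def)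
      also have "\<dots> \<le> \<eta> * real (card M) powr r" unfolding cM using \<eta> by (intro mult_right_mono) auto
      finally show ?thesis .
    qed
    show "\<exists>M. finite M \<and> M \<noteq> {} \<and> M \<subseteq> {n..} \<and>
      (\<forall>S. finite S \<and> S \<inter> S0 = {} \<longrightarrow> (\<Sum>k\<in>S. (\<Sum>m\<in>M. b m k) powr r) \<le> \<eta> * real (card M) powr r)"
    proof (intro exI[of _ M] conjI allI impI)
      show "M \<noteq> {}" using cM N(2) by auto
    qed (use bound m(1) in \<open>auto simp: M_def\<close>)
  qed
qed

section \<open>Dyadic subdivision\<close>

definition dyadic :: "nat \<times> nat \<Rightarrow> real \<Rightarrow> complex" where
  "dyadic = (\<lambda>(m, j) x. indicator {real j / 2 ^ m..<(real j + 1) / 2 ^ m} x)"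

definition dyadic_children :: "nat \<Rightarrow> nat \<Rightarrow> nat \<Rightarrow> nat set" where
  "dyadic_children n i m = {i * 2 ^ (m - n)..<i * 2 ^ (m - n) + 2 ^ (m - n)}"

lemma sum_indicator_adjacent:
  fixes h :: real
  assumes "0 < h" "a \<le> b"
  shows "(\<Sum>j = a..<b. indicator {real j / h..<(real j + 1) / h} x) = (indicator {real a / h..<real b / h} x :: real)"
  using assms(2)
proof (induction b rule: dec_induct)
  case (step b)
  have "real a / h \<le> real b / h" "real b / h \<le> (real b + 1) / h"
    using step assms(1) by (auto intro!: divide_right_mono)
  then have "indicator {real a / h..<real b / h} x + indicator {real b / h..<(real b + 1) / h} x
      = (indicator {real a / h..<(real b + 1) / h} x :: real)"
    by (auto simp: indicator_def)
  then show ?case using step by (simp add: add.commute)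
qed simp

text \<open>Half-open intervals tile their parent without overlap, so the sum of squares does not
  depend on the level m.\<close>

lemma sum_dyadic_children:
  assumes "n \<le> m"
  shows "(\<Sum>j\<in>dyadic_children n i m. (cmod (dyadic (m, j) x))\<^sup>2)
    = indicator {real i / 2 ^ n..<(real i + 1) / 2 ^ n} x"
proof -
  define d where "d = m - n"
  have m: "m = n + d" using assms by (simp add: d_def)
  have "(\<Sum>j\<in>dyadic_children n i m. (cmod (dyadic (m, j) x))\<^sup>2)
    = (\<Sum>j = i * 2 ^ d..<i * 2 ^ d + 2 ^ d. indicator {real j / 2 ^ m..<(real j + 1) / 2 ^ m} x)"
    unfolding dyadic_children_def d_def[symmetric]
    by (intro sum.cong) (auto simp: dyadic_def indicator_def)
  also have "\<dots> = indicator {real (i * 2 ^ d) / 2 ^ m..<real (i * 2 ^ d + 2 ^ d) / 2 ^ m} x"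
    by (rule sum_indicator_adjacent) auto
  also have "real (i * 2 ^ d) / 2 ^ m = real i / 2 ^ n"
    by (simp add: m power_add)
  also have "real (i * 2 ^ d + 2 ^ d) / 2 ^ m = (real i + 1) / 2 ^ n"
  proof -
    have "real (i * 2 ^ d + 2 ^ d) = (real i + 1) * 2 ^ d" by (simp add: algebra_simps)
    then show ?thesis by (simp add: m power_add)
  qed
  finally show ?thesis .
qed

lemma sum_over_dyadic_children:
  fixes f :: "nat \<Rightarrow> real"
  assumes "n \<le> m"
  shows "(\<Sum>i<2 ^ n. \<Sum>j\<in>dyadic_children n i m. f j) = (\<Sum>j\<in>dyadic_children 0 0 m. f j)"
proof -
  have "(2::nat) ^ n * 2 ^ (m - n) = 2 ^ m" using assms by (simp flip: power_add)
  then show ?thesis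
    unfolding dyadic_children_def sum.nat_group by (simp add: atLeast0LessThan)
qed

lemma powr_le_cancel_base:
  fixes a b r :: real
  assumes "a powr r \<le> b powr r" "0 < r" "0 \<le> b"
  shows "a \<le> b"
  using assms by (meson linorder_not_le powr_less_mono2)

context Lp_exponent
begin

lemma dyadic_Lp: "in_Lp p (dyadic l)"
proof (cases l)
  case (Pair m j)
  show ?thesis
  proof (rule in_Lp_bounded_on_interval[where C=1])
    show "dyadic l \<in> borel_measurable borel" by (simp add: dyadic_def Pair)
    show "cmod (dyadic l x) \<le> 1 * indicator {real j / 2 ^ m..(real j + 1) / 2 ^ m} x" for x
      by (auto simp: dyadic_def Pair indicator_def)
  qed
qed

text \<open>Each level in \<open>M\<close> contributes the same parent indicator, so superposing
  levels loses nothing on the function side.\<close>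

lemma integral_square_fun_dyadic:
  assumes "finite M" "M \<subseteq> {n..}"
  shows "(\<integral>x. square_fun (SIGMA m:M. dyadic_children n i m) dyadic x \<partial>lborel)
    = real (card M) powr (p / 2) / 2 ^ n"
proof -
  have "square_fun (SIGMA m:M. dyadic_children n i m) dyadic x
    = real (card M) powr (p / 2) * indicator {real i / 2 ^ n..<(real i + 1) / 2 ^ n} x" for x
  proof -
    have "(\<Sum>l\<in>(SIGMA m:M. dyadic_children n i m). (cmod (dyadic l x))\<^sup>2)
        = (\<Sum>m\<in>M. \<Sum>j\<in>dyadic_children n i m. (cmod (dyadic (m, j) x))\<^sup>2)"
      using assms(1) by (subst sum.Sigma) (auto simp: dyadic_children_def case_prod_beta)
    also have "\<dots> = (\<Sum>m\<in>M. indicator {real i / 2 ^ n..<(real i + 1) / 2 ^ n} x)"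
      using assms(2) by (intro sum.cong refl sum_dyadic_children) auto
    finally show ?thesis
      using p_ge_1 by (simp add: square_fun_def indicator_def)
  qed
  moreover have "(real i + 1) / 2 ^ n - real i / 2 ^ n = 1 / 2 ^ n"
    by (simp flip: diff_divide_distrib)
  moreover have "real i / 2 ^ n \<le> (real i + 1) / 2 ^ n" by (intro divide_right_mono) auto
  ultimately show ?thesis by simp
qed

text \<open>The hypotheses say that \<open>\<Sum>|x\<^sub>n|\<^sup>2 \<mapsto> (\<Sum>\<^sub>n V k x\<^sub>n)\<^sub>k\<close> behaves like a positive linear
  isomorphism of the cone of \<open>L\<^sup>p\<^sup>/\<^sup>2\<close> into that of \<open>\<ell>\<^sup>p\<^sup>/\<^sup>2\<close>. Its coordinates have no atoms, so
  subdividing \<open>[0,1]\<close> makes finitely many coordinates negligible.\<close>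

lemma no_embedding_of_cones:
  fixes V :: "'k::countable \<Rightarrow> (real \<Rightarrow> complex) \<Rightarrow> real"
  assumes p: "2 < p" and V0: "\<And>k f. 0 \<le> V k f" and C1: "0 < C1" and C2: "0 < C2"
    and le: "\<And>(J :: (nat \<times> nat) set) x S. finite J \<Longrightarrow> (\<And>n. n \<in> J \<Longrightarrow> in_Lp p (x n)) \<Longrightarrow> finite S \<Longrightarrow>
      (\<Sum>k\<in>S. (\<Sum>n\<in>J. V k (x n)) powr (p / 2)) \<le> C1 * (\<integral>t. square_fun J x t \<partial>lborel)"
    and ge: "\<And>(J :: (nat \<times> nat) set) x. finite J \<Longrightarrow> (\<And>n. n \<in> J \<Longrightarrow> in_Lp p (x n)) \<Longrightarrow>
      \<exists>S. finite S \<and> (\<integral>t. square_fun J x t \<partial>lborel) \<le> C2 * (\<Sum>k\<in>S. (\<Sum>n\<in>J. V k (x n)) powr (p / 2))"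
  shows False
proof -
  define r where "r = p / 2"
  have r: "1 < r" using p by (simp add: r_def)
  define c where "c n i m k = (\<Sum>j\<in>dyadic_children n i m. V k (dyadic (m, j)))" for n i m k
  define b where "b m k = c 0 0 m k" for m k
  have c0: "0 \<le> c n i m k" for n i m k unfolding c_def by (intro sum_nonneg V0)
  have sum_c: "(\<Sum>i<2 ^ n. c n i m k) = b m k" if "n \<le> m" for n m k
    unfolding c_def b_def by (rule sum_over_dyadic_children[OF that])
  have fin: "finite (SIGMA m:M. dyadic_children n i m)" if "finite M" for M n i
    using that by (auto simp: dyadic_children_def)
  have V_sum: "(\<Sum>l\<in>(SIGMA m:M. dyadic_children n i m). V k (dyadic l)) = (\<Sum>m\<in>M. c n i m k)"
    if "finite M" for M n i k
    unfolding c_def using that by (subst sum.Sigma) (auto simp: dyadic_children_def case_prod_beta)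
  have LE: "(\<Sum>k\<in>S. (\<Sum>m\<in>M. c n i m k) powr r) \<le> C1 * real (card M) powr r / 2 ^ n"
    if "finite M" "M \<subseteq> {n..}" "finite S" for M n i S
    using le[of "SIGMA m:M. dyadic_children n i m" dyadic S, OF fin[OF that(1)] dyadic_Lp that(3)] that
    by (simp add: V_sum integral_square_fun_dyadic r_def)
  have GE: "\<exists>S. finite S \<and> real (card M) powr r / 2 ^ n \<le> C2 * (\<Sum>k\<in>S. (\<Sum>m\<in>M. c n i m k) powr r)"
    if "finite M" "M \<subseteq> {n..}" for M n i
    using ge[of "SIGMA m:M. dyadic_children n i m" dyadic, OF fin[OF that(1)] dyadic_Lp] that
    by (simp add: V_sum integral_square_fun_dyadic r_def)
  have b0: "0 \<le> b m k" for m k by (simp add: b_def c0)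
  have b_bd: "(\<Sum>k\<in>S. b m k powr r) \<le> C1" if "finite S" for m S
    using LE[of "{m}" 0 S 0] that by (simp add: b_def)
  \<comment> \<open>The coordinates in \<open>S0\<close> and those outside will each contribute
    \<eta>, and \<open>C2 * (2 * \<eta>) = 1 / 2\<close> is below 1.\<close>
  define \<eta> where "\<eta> = 1 / (4 * C2)"
  have \<eta>: "0 < \<eta>" using C2 by (simp add: \<eta>_def)
  obtain S0 where S0: "finite S0" and avg: "\<And>n. \<exists>M. finite M \<and> M \<noteq> {} \<and> M \<subseteq> {n..} \<and>
    (\<forall>S. finite S \<and> S \<inter> S0 = {} \<longrightarrow> (\<Sum>k\<in>S. (\<Sum>m\<in>M. b m k) powr r) \<le> \<eta> * real (card M) powr r)"
    by (rule averages_with_small_tails[of r b C1 \<eta>, OF r b0 b_bd \<eta>]) blast+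
  \<comment> \<open>Up to a constant this bounds the share of one interval of length
    \<open>1 / 2 ^ n\<close> in any coordinate, relative to the number of levels.\<close>
  define q where "q n = (1 / 2 ^ n) powr (1 / r)" for n :: nat
  have "(\<lambda>n. (1 / 2) ^ n :: real) \<longlonglongrightarrow> 0" by (intro LIMSEQ_realpow_zero) auto
  then have "(\<lambda>n. ((1 / 2) ^ n) powr ((1 / r) * (r - 1))) \<longlonglongrightarrow> 0 powr ((1 / r) * (r - 1))"
    using r by (intro tendsto_powr2 tendsto_const) auto
  then have "(\<lambda>n. q n powr (r - 1)) \<longlonglongrightarrow> 0"
    by (simp add: q_def powr_powr power_divide)
  then have "(\<lambda>n. real (card S0) * C1 * q n powr (r - 1)) \<longlonglongrightarrow> real (card S0) * C1 * 0"
    by (intro tendsto_mult tendsto_const)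
  then have "\<forall>\<^sub>F n in sequentially. real (card S0) * C1 * q n powr (r - 1) < \<eta>"
    using \<eta> by (intro order_tendstoD(2)) auto
  then obtain n where n: "real (card S0) * C1 * q n powr (r - 1) < \<eta>"
    by (auto simp: eventually_sequentially)
  from avg[of n] obtain M where "finite M \<and> M \<noteq> {} \<and> M \<subseteq> {n..} \<and>
    (\<forall>S. finite S \<and> S \<inter> S0 = {} \<longrightarrow> (\<Sum>k\<in>S. (\<Sum>m\<in>M. b m k) powr r) \<le> \<eta> * real (card M) powr r)"
    by (rule exE)
  then have M: "finite M" "M \<noteq> {}" "M \<subseteq> {n..}" and
    M_tail: "finite S \<Longrightarrow> S \<inter> S0 = {} \<Longrightarrow> (\<Sum>k\<in>S. (\<Sum>m\<in>M. b m k) powr r) \<le> \<eta> * real (card M) powr r" for S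
    by simp_all
  define N where "N = real (card M)"
  have N: "0 < N" using M by (simp add: N_def card_gt_0_iff)
  define A where "A = C1 powr (1 / r) * N"
  have A: "0 < A" using C1 N by (simp add: A_def)
  have Ar: "A powr r = C1 * N powr r" using C1 N r by (simp add: A_def powr_mult powr_powr)
  have q: "0 < q n" "q n powr r = 1 / 2 ^ n" using r by (simp_all add: q_def powr_powr)
  define y where "y i k = (\<Sum>m\<in>M. c n i m k)" for i k
  have y0: "0 \<le> y i k" for i k unfolding y_def by (intro sum_nonneg c0)
  have y_le: "y i k \<le> A * q n" for i k
  proof (rule powr_le_cancel_base)
    have "y i k powr r \<le> C1 * N powr r / 2 ^ n"
      using LE[OF M(1,3), of "{k}" i] by (simp add: y_def N_def)
    also have "\<dots> = (A * q n) powr r" using A q by (simp add: powr_mult Ar)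
    finally show "y i k powr r \<le> (A * q n) powr r" .
  qed (use r A q in auto)
  have y_sum: "(\<Sum>i<2 ^ n. y i k) = (\<Sum>m\<in>M. b m k)" for k
  proof -
    have "(\<Sum>i<2 ^ n. y i k) = (\<Sum>m\<in>M. \<Sum>i<2 ^ n. c n i m k)"
      unfolding y_def by (rule sum.swap)
    also have "\<dots> = (\<Sum>m\<in>M. b m k)" using M(3) by (intro sum.cong refl sum_c) auto
    finally show ?thesis .
  qed
  have b_sum_le: "(\<Sum>m\<in>M. b m k) \<le> A" for k
  proof (rule powr_le_cancel_base)
    show "(\<Sum>m\<in>M. b m k) powr r \<le> A powr r"
      using LE[of M 0 "{k}" 0] M(1) by (simp add: b_def Ar N_def)
  qed (use r A in auto)
  \<comment> \<open>Absence of atoms: the sum of r-th powers is at most the largest piece to the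
    power r - 1 times the total, and the pieces shrink with n while the total stays at most
    \<open>A\<close>.\<close>
  have head: "(\<Sum>i<2 ^ n. y i k powr r) \<le> C1 * q n powr (r - 1) * N powr r" for k
  proof -
    have "(\<Sum>i<2 ^ n. y i k powr r) \<le> (\<Sum>i<2 ^ n. (A * q n) powr (r - 1) * y i k)"
    proof (rule sum_mono)
      fix i
      have "y i k powr r = y i k powr (r - 1) * y i k"
        using y0[of i k] by (cases "y i k = 0") (auto simp: powr_diff)
      also have "\<dots> \<le> (A * q n) powr (r - 1) * y i k"
        using r y_le y0 by (intro mult_right_mono powr_mono2) auto
      finally show "y i k powr r \<le> (A * q n) powr (r - 1) * y i k" .
    qed
    also have "\<dots> = (A * q n) powr (r - 1) * (\<Sum>m\<in>M. b m k)"
      by (simp add: sum_distrib_left[symmetric] y_sum)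
    also have "\<dots> \<le> (A * q n) powr (r - 1) * A" by (intro mult_left_mono b_sum_le) auto
    also have "\<dots> = A powr r * q n powr (r - 1)" using A q by (simp add: powr_mult powr_diff)
    finally show ?thesis by (simp add: Ar mult_ac)
  qed
  have "\<forall>i. \<exists>S. finite S \<and> N powr r / 2 ^ n \<le> C2 * (\<Sum>k\<in>S. y i k powr r)"
    using GE[OF M(1,3)] by (simp add: y_def N_def)
  from choice[OF this] obtain S where "\<forall>i. finite (S i) \<and> N powr r / 2 ^ n \<le> C2 * (\<Sum>k\<in>S i. y i k powr r)"
    by (rule exE)
  then have S: "finite (S i)" "N powr r / 2 ^ n \<le> C2 * (\<Sum>k\<in>S i. y i k powr r)" for i
    by simp_all
  define U where "U = (\<Union>i<2 ^ n. S i)"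
  have U: "finite U" using S by (simp add: U_def)
  \<comment> \<open>Summing the lower bound over all \<open>2 ^ n\<close> intervals recovers the
    full \<open>N powr r\<close>, whereas the coordinates can account for only half of it.\<close>
  have "N powr r = (\<Sum>i<(2::nat) ^ n. N powr r / 2 ^ n)" by simp
  also have "\<dots> \<le> (\<Sum>i<2 ^ n. C2 * (\<Sum>k\<in>S0 \<union> (U - S0). y i k powr r))"
  proof (rule sum_mono)
    fix i :: nat assume i: "i \<in> {..<2 ^ n}"
    have "(\<Sum>k\<in>S i. y i k powr r) \<le> (\<Sum>k\<in>S0 \<union> (U - S0). y i k powr r)"
      using i S0 U by (intro sum_mono2) (auto simp: U_def)
    then show "N powr r / 2 ^ n \<le> C2 * (\<Sum>k\<in>S0 \<union> (U - S0). y i k powr r)"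
      using S(2)[of i] C2 by (meson mult_left_mono less_imp_le order_trans)
  qed
  also have "\<dots> = C2 * (\<Sum>k\<in>S0 \<union> (U - S0). \<Sum>i<2 ^ n. y i k powr r)"
    unfolding sum_distrib_left[symmetric] by (subst sum.swap) simp
  also have "(\<Sum>k\<in>S0 \<union> (U - S0). \<Sum>i<2 ^ n. y i k powr r)
      = (\<Sum>k\<in>S0. \<Sum>i<2 ^ n. y i k powr r) + (\<Sum>k\<in>U - S0. \<Sum>i<2 ^ n. y i k powr r)"
    using S0 U by (intro sum.union_disjoint) auto
  also have "C2 * \<dots> \<le> C2 * (\<eta> * N powr r + \<eta> * N powr r)"
  proof (intro mult_left_mono add_mono)
    have "(\<Sum>k\<in>S0. \<Sum>i<2 ^ n. y i k powr r) \<le> (\<Sum>k\<in>S0. C1 * q n powr (r - 1) * N powr r)"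
      by (intro sum_mono head)
    also have "\<dots> = (real (card S0) * C1 * q n powr (r - 1)) * N powr r" by simp
    also have "\<dots> \<le> \<eta> * N powr r" using n by (intro mult_right_mono) auto
    finally show "(\<Sum>k\<in>S0. \<Sum>i<2 ^ n. y i k powr r) \<le> \<eta> * N powr r" .
    \<comment> \<open>Outside \<open>S0\<close> the subdivision is undone by superadditivity, and
      the averaged vector has a small tail there.\<close>
    have "(\<Sum>k\<in>U - S0. \<Sum>i<2 ^ n. y i k powr r) \<le> (\<Sum>k\<in>U - S0. (\<Sum>m\<in>M. b m k) powr r)"
      unfolding y_sum[symmetric] using r y0 by (intro sum_mono sum_powr_le_powr_sum) auto
    also have "\<dots> \<le> \<eta> * N powr r" unfolding N_def using U by (intro M_tail) auto
    finally show "(\<Sum>k\<in>U - S0. \<Sum>i<2 ^ n. y i k powr r) \<le> \<eta> * N powr r" .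
  qed (use C2 in auto)
  also have "\<dots> = N powr r / 2" using C2 by (simp add: \<eta>_def)
  finally show False using N by simp
qed

end

context gabor_basis
begin

lemma no_gabor_basis: False
proof -
  obtain C1 where C1: "0 < C1" "\<And>(J :: (nat \<times> nat) set) x S. finite J \<Longrightarrow> (\<And>n. n \<in> J \<Longrightarrow> in_Lp p (x n)) \<Longrightarrow>
    finite S \<Longrightarrow> (\<Sum>k\<in>S. (\<Sum>n\<in>J. energy k (x n)) powr (p / 2)) \<le> C1 * (\<integral>t. square_fun J x t \<partial>lborel)"
    by (rule sum_energy_le) blast
  obtain C2 where C2: "0 < C2" "\<And>(J :: (nat \<times> nat) set) x. finite J \<Longrightarrow> (\<And>n. n \<in> J \<Longrightarrow> in_Lp p (x n)) \<Longrightarrow>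
    \<exists>S. finite S \<and> (\<integral>t. square_fun J x t \<partial>lborel) \<le> C2 * (\<Sum>k\<in>S. (\<Sum>n\<in>J. energy k (x n)) powr (p / 2))"
    by (rule square_fun_le_energy) blast
  show False
    by (rule no_embedding_of_cones[of energy C1 C2, OF p_gt_2 energy_nonneg C1(1) C2(1) C1(2) C2(2)])
qed

end

theorem theorem2p1:
  fixes p :: real
  assumes "2 < p"
  shows "\<not> (\<exists>(g :: real \<Rightarrow> complex) (\<Lambda> :: (real \<times> real) set).
            in_Lp p g \<and> countable \<Lambda> \<and> Lp_unconditional_basis p (gabor g) \<Lambda>)"
proof (intro notI, elim exE conjE)
  fix g :: "real \<Rightarrow> complex" and \<Lambda> :: "(real \<times> real) set"
  assume g: "in_Lp p g" and basis: "Lp_unconditional_basis p (gabor g) \<Lambda>"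
  interpret Lp_basis p "gabor g" \<Lambda>
    using assms basis by unfold_locales auto
  \<comment> \<open>The empty system would expand every function to 0, but the indicator of [0, 1)
    has norm 1. An index in \<Lambda> is needed to see that the window has positive norm.\<close>
  have "\<Lambda> \<noteq> {}"
  proof
    assume "\<Lambda> = {}"
    then have "Lp_norm p (dyadic (0, 0)) < 1"
      using coef_sums[OF dyadic_Lp[of "(0, 0)"]] unfolding Lp_uncond_sums_def
      by (auto dest: spec[of _ 1])
    moreover have "cmod (dyadic (0, 0) x) powr p = indicator {0..<1} x" for x
      by (simp add: dyadic_def indicator_def)
    then have "Lp_norm p (dyadic (0, 0)) = 1"
      by (simp add: Lp_norm_def)
    ultimately show False by simp
  qed
  then obtain l where "l \<in> \<Lambda>" by blast
  then have g_pos: "0 < Lp_norm p g" using norm_u_pos[of l] by (simp add: Lp_norm_gabor)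
  obtain K where K: "1 \<le> K" "\<And>f F m. in_Lp p f \<Longrightarrow> finite F \<Longrightarrow> F \<subseteq> \<Lambda> \<Longrightarrow> (\<And>i. i \<in> F \<Longrightarrow> cmod (m i) \<le> 1) \<Longrightarrow>
      Lp_norm p (\<lambda>x. \<Sum>i\<in>F. m i * (coef f i * gabor g i x)) \<le> K * Lp_norm p f"
    by (rule unconditional_constant) blast
  have "0 < Lp_norm p g / (2 * K)" using g_pos K(1) by simp
  then obtain R where R: "0 < R" "Lp_norm p (\<lambda>x. if \<bar>x\<bar> \<le> R then 0 else g x) < Lp_norm p g / (2 * K)"
    by (rule Lp_norm_tail[OF g]) blast
  have "K * Lp_norm p (\<lambda>x. if \<bar>x\<bar> \<le> R then 0 else g x) < K * (Lp_norm p g / (2 * K))"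
    using R(2) K(1) by (intro mult_strict_left_mono) auto
  then have tail: "K * Lp_norm p (\<lambda>x. if \<bar>x\<bar> \<le> R then 0 else g x) < Lp_norm p g / 2"
    using K(1) by simp
  interpret gabor_basis p g \<Lambda> K R
    by unfold_locales (use assms g g_pos K R(1) tail in auto)
  show False by (rule no_gabor_basis)
qed

end
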